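(* Let $d\ge 2$, $\alpha\in(0,2)$, and let $\mu$ be an $\alpha$-stable distribution on $\mathbb{R}^d$ with no shift whose spectral spherical measure is $\lambda(dv)=P(v)\,\omega(dv)$ with $P\in L^2(\mathbb{S}^{d-1})$. Let $P_j=\pi_j P$, $j\in\mathbb{Z}_+$. Then, for $z\ne 0$, $$\Phi_\mu(z)=|z|^\alpha\Big[\sum_{j\ \mathrm{even}} w_j(\alpha)P_j(u_z)-i\tan\frac{\pi\alpha}{2}\sum_{j\ \mathrm{odd}} w_j(\alpha)P_j(u_z)\Big]\quad\text{if }\alpha\ne1,$$ $$\Phi_\mu(z)=|z|\Big[\sum_{j\ \mathrm{even}} w_j(1)P_j(u_z)+i\frac{2}{\pi}\sum_{j\ \mathrm{odd}} w^*_jP_j(u_z)\Big]+i|z|\ln|z|\,\frac{2\pi^{d/2-1}}{\Gamma(d/2+1)}P_1(u_z)\quad\text{if }\alpha=1,$$ where $$w_j(\alpha)=\frac{\pi^{d/2}\Gamma(\alpha+1)}{2^{\alpha-1}\Gamma((j+\alpha+d)/2)\,\Gamma((\alpha-j)/2+1)}=\frac{\pi^{d/2-1}\sin((j-\alpha)\pi/2)\Gamma(\alpha+1)\Gamma((j-\alpha)/2)}{2^{\alpha-1}\Gamma((j+\alpha+d)/2)},$$ $$w_1^*=\frac{\pi^{d/2}}{\Gamma(d/2+1)}\beta_d,\qquad w^*_j=\frac{(-1)^{(j-3)/2}\pi^{d/2}\Gamma((j-1)/2)}{2\Gamma((d+1+j)/2)}\ \ (j>1\text{ odd}),$$ with $s_0=0$,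 $s_n=s_{n-1}+1/n$ ($n\ge1$), and $\beta_d=1-\ln 2-s_{d/2}/2$ if $d$ is even, $\beta_d=1-s_{d+1}+s_{(d+1)/2}/2$ if $d$ is odd. All the series above converge absolutely.
   Context: Let $d\ge 2$, $\mathbb{S}^{d-1}=\{x\in\mathbb{R}^d:|x|=1\}$, and $\omega$ the surface measure on $\mathbb{S}^{d-1}$, normalized so that $\int_{\mathbb{R}^d}f(x)\,dx=\int_{\mathbb{S}^{d-1}}\int_0^\infty f(sv)s^{d-1}\,ds\,\omega(dv)$. For $x\ne0$, $u_x=x/|x|$. $L^2(\mathbb{S}^{d-1})$ is taken w.r.t. $\omega$. $\mathcal{H}_{j,d}$ denotes the space of spherical harmonics of degree $j$ (restrictions to $\mathbb{S}^{d-1}$ of homogeneous harmonic polynomials of degree $j$ with complex coefficients); $L^2(\mathbb{S}^{d-1})=\bigoplus_{j\ge0}\mathcal{H}_{j,d}$ orthogonally, and $\pi_j$ denotes the orthogonal projection of $L^2(\mathbb{S}^{d-1})$ onto $\mathcal{H}_{j,d}$. An $\alpha$-stable distribution $\mu$ on $\mathbb{R}^d$ ($\alpha\in(0,2)$) with no shift has $\int e^{i\langle x,z\rangle}\mu(dx)=\exp\{-\Phi_\mu(z)\}$ with characteristic exponent $\Phi_\mu(z)=\int_{\mathbb{S}^{d-1}}|\langle z,v\rangle|^\alpha[1-i\tan(\pi\alpha/2)\,\mathrm{sgn}\langle z,v\rangle]\lambda(dv)$ if $\alpha\ne1$, and $\Phi_\mu(z)=\int_{\mathbb{S}^{d-1}}[|\langle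 z,v\rangle|+i\frac{2}{\pi}\langle z,v\rangle\ln|\langle z,v\rangle|]\lambda(dv)$ if $\alpha=1$, where $\lambda$ is a finite nonzero Borel measure on $\mathbb{S}^{d-1}$ called the spectral spherical measure; if $\lambda=P\omega$, $P$ is the spectral spherical density. The reciprocal $1/\Gamma$ is understood as the entire function vanishing at nonpositive integers. *)

theory Defs
  imports "HOL-Analysis.Analysis" "HOL-Probability.Probability"
begin

text \<open>Surface measure on the unit sphere: omega(A) = d * Leb{ x : 0 < |x| <= 1, x/|x| in A }.
  This is the (unique) measure satisfying the polar-coordinates normalisation of the paper.\<close>
definition sphere_measure :: "(real^'n) measure" where
  "sphere_measure = measure_of (sphere 0 1) (sets (restrict_space borel (sphere 0 1)))
     (\<lambda>A. of_nat CARD('n) * emeasure lborel {x. x \<noteq> 0 \<and> norm x \<le> 1 \<and> sgn x \<in> A})"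

definition hom_poly :: "nat \<Rightarrow> (real^'n \<Rightarrow> complex) \<Rightarrow> bool" where
  "hom_poly j f \<longleftrightarrow> (\<exists>c :: ('n \<Rightarrow> nat) \<Rightarrow> complex.
      f = (\<lambda>x. \<Sum>k\<in>{k :: 'n \<Rightarrow> nat. sum k UNIV = j}. c k * of_real (\<Prod>i\<in>UNIV. (x $ i) ^ k i)))"

definition partial_deriv :: "'n \<Rightarrow> (real^'n \<Rightarrow> complex) \<Rightarrow> real^'n \<Rightarrow> complex" where
  "partial_deriv i f x = vector_derivative (\<lambda>t. f (x + t *\<^sub>R axis i 1)) (at 0)"

definition laplacian :: "(real^'n \<Rightarrow> complex) \<Rightarrow> real^'n \<Rightarrow> complex" where
  "laplacian f x = (\<Sum>i\<in>UNIV. partial_deriv i (partial_deriv i f) x)"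

definition harmonic :: "(real^'n \<Rightarrow> complex) \<Rightarrow> bool" where
  "harmonic f \<longleftrightarrow> (\<forall>x. laplacian f x = 0)"

text \<open>H_{j,d}: homogeneous harmonic polynomials of degree j (to be restricted to the sphere).\<close>
definition sph_harm :: "nat \<Rightarrow> (real^'n \<Rightarrow> complex) set" where
  "sph_harm j = {f. hom_poly j f \<and> harmonic f}"

text \<open>Orthogonal projection pi_j of L^2(S^{d-1}, omega) onto H_{j,d}: the unique element h of
  H_{j,d} with P - h orthogonal to H_{j,d}.  (A homogeneous polynomial is determined by its
  restriction to the sphere, so h is unique.)\<close>
definition sph_proj :: "nat \<Rightarrow> (real^'n \<Rightarrow> complex) \<Rightarrow> (real^'n \<Rightarrow> complex)" where
  "sph_proj j P = (THE h. h \<in> sph_harm j \<and>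
      (\<forall>g \<in> sph_harm j. integral\<^sup>L sphere_measure (\<lambda>v. (P v - h v) * cnj (g v)) = 0))"

definition stable_exponent :: "real \<Rightarrow> (real^'n) measure \<Rightarrow> real^'n \<Rightarrow> complex" where
  "stable_exponent \<alpha> Lam z =
    (if \<alpha> \<noteq> 1 then
       integral\<^sup>L Lam (\<lambda>v. of_real (\<bar>z \<bullet> v\<bar> powr \<alpha>) *
                         (1 - \<i> * of_real (tan (pi * \<alpha> / 2) * sgn (z \<bullet> v))))
     else
       integral\<^sup>L Lam (\<lambda>v. of_real \<bar>z \<bullet> v\<bar> + \<i> * of_real (2 / pi * (z \<bullet> v) * ln \<bar>z \<bullet> v\<bar>)))"

text \<open>w_j(alpha), using the reciprocal Gamma function rGamma (entire, zero at nonpositive integers).\<close>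
definition w_coef :: "nat \<Rightarrow> nat \<Rightarrow> real \<Rightarrow> real" where
  "w_coef d j \<alpha> = pi powr (real d / 2) * Gamma (\<alpha> + 1)
      * rGamma ((real j + \<alpha> + real d) / 2) * rGamma ((\<alpha> - real j) / 2 + 1) / 2 powr (\<alpha> - 1)"

definition beta_d :: "nat \<Rightarrow> real" where
  "beta_d d = (if even d then 1 - ln 2 - harm (d div 2) / 2
               else 1 - harm (d + 1) + harm ((d + 1) div 2) / 2)"

definition w_star :: "nat \<Rightarrow> nat \<Rightarrow> real" where
  "w_star d j = (if j = 1 then pi powr (real d / 2) / Gamma (real d / 2 + 1) * beta_d d
     else (-1) ^ ((j - 3) div 2) * pi powr (real d / 2) * Gamma ((real j - 1) / 2)
          / (2 * Gamma ((real d + 1 + real j) / 2)))"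

end

theory Submission
  imports Defs "HOL-Real_Asymp.Real_Asymp"
begin

text \<open>Gaussian integration by parts, written in polar coordinates, becomes integration by parts on the
  sphere. Combined with Euler's identity it yields a recursion for the moments of a spherical harmonic
  $h$ of degree $j$, solved by $\int h(v) (u \cdot v)^m \, \omega(dv) = w_j(m) h(u)$ for even $m + j$.
  The homogenised Legendre polynomials $Q_j(u \cdot v)$ are harmonic in $v$, so these moments make them
  reproducing kernels: $P_j(u)$ is $\int Q_j(u \cdot v) P(v) \, \omega(dv)$ divided by the squared norm of $Q_j$.
  By Weierstrass the $Q_j(u \cdot v)$ span a dense set of functions of $u \cdot v$. Parseval's identity
  therefore expands $\int q(u \cdot v) P(v) \, \omega(dv)$ into the $P_j(u)$ with coefficients
  $\int q(u \cdot v) Q_j(u \cdot v) \, \omega(dv)$, and Bessel's inequality makes the series converge absolutely.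

  For $q(t) = |t|^\alpha$ and $j = 0$ the coefficient is an absolute moment of the standard normal
  distribution, which is the law of $u \cdot X$ for a standard Gaussian vector $X$. The three-term
  recursion of the $Q_j$ is matched by one for $w_j(\alpha)$, and induction on $j$ gives all coefficients of the signed
  powers. Differentiating them in $\alpha$ at $1$ handles $t \ln |t|$.\<close>

section \<open>Polar coordinates\<close>

notation sphere_measure ("\<omega>")

text \<open>Unlike \<open>sgn\<close>, this maps every vector, including \<open>0\<close>, into the sphere.\<close>

definition direction :: "real^'n \<Rightarrow> real^'n" where
  "direction x = (if x = 0 then axis undefined 1 else sgn x)"

lemma norm_direction [simp]: "norm (direction x) = 1"
  by (simp add: direction_def norm_sgn)

lemma norm_scaleR_direction [simp]: "norm x *\<^sub>R direction x = x"
  by (simp add: direction_def sgn_div_norm)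

lemma direction_scaleR: "c > 0 \<Longrightarrow> direction (c *\<^sub>R x) = direction x"
  by (simp add: direction_def sgn_scaleR)

lemma measurable_direction: "direction \<in> borel \<rightarrow>\<^sub>M restrict_space borel (sphere 0 1)"
proof (rule measurable_restrict_space2)
  have "(sgn :: real^'n \<Rightarrow> _) = (\<lambda>x. x /\<^sub>R norm x)"
    by (simp add: sgn_div_norm fun_eq_iff)
  then have [measurable]: "(sgn :: real^'n \<Rightarrow> _) \<in> borel_measurable borel" by simp
  show "(direction :: real^'n \<Rightarrow> _) \<in> borel_measurable borel"
    unfolding direction_def by measurable
qed simp

lemma measurable_direction_cball:
  "direction \<in> scale_measure c (restrict_space lborel (cball 0 R)) \<rightarrow>\<^sub>M restrict_space borel (sphere 0 1)"
  using measurable_restrict_space1[OF measurable_direction]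
  by (simp add: measurable_def space_scale_measure space_restrict_space sets_restrict_space)

lemma sphere_measure_eq_distr:
  "(\<omega> :: (real^'n) measure) =
      distr (scale_measure (of_nat CARD('n)) (restrict_space lborel (cball 0 1)))
     (restrict_space borel (sphere 0 1)) direction"
  (is "_ = distr ?M ?S direction")
proof -
  have space: "space ?S = sphere 0 1" by (simp add: space_restrict_space)
  have "of_nat CARD('n) * emeasure lborel {x. x \<noteq> 0 \<and> norm x \<le> 1 \<and> sgn x \<in> B} =
      emeasure ?M (direction -` B \<inter> space ?M)" if measurable_B: "B \<in> sets ?S" for B
  proof -
    have preimage: "direction -` B \<in> sets lborel"
      using measurable_sets[OF measurable_direction measurable_B] by simp
    have "{x. x \<noteq> 0 \<and> norm x \<le> 1 \<and> sgn x \<in> B} = direction -` B \<inter> cball 0 1 - {0}"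
      by (auto simp: direction_def)
    also have "emeasure lborel \<dots> = emeasure lborel (direction -` B \<inter> cball 0 1)"
      by (intro emeasure_Diff_null_set) (use preimage in \<open>auto simp: null_sets_def\<close>)
    finally show ?thesis
      using preimage by (simp add: emeasure_restrict_space space_scale_measure space_restrict_space)
  qed
  then show ?thesis
    unfolding sphere_measure_def distr_def space
    by (intro measure_of_eq) (use space sets.sets_into_space[of _ ?S] sets.sigma_sets_eq[of ?S] in auto)
qed

lemma space_sphere_measure [simp]: "space \<omega> = sphere 0 1"
  by (simp add: sphere_measure_eq_distr space_restrict_space)

lemma sets_sphere_measure [measurable_cong]:
  "sets \<omega> = sets (restrict_space borel (sphere 0 1))"
  by (simp add: sphere_measure_eq_distr)

lemma measurable_direction_sphere [measurable]: "direction \<in> borel \<rightarrow>\<^sub>M \<omega>"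
  using measurable_direction by (simp cong: measurable_cong_sets add: sets_sphere_measure)

lemma vimage_direction_in_sets [measurable]: "B \<in> sets \<omega> \<Longrightarrow> direction -` B \<in> sets borel"
  using measurable_sets[OF measurable_direction_sphere] by simp

lemma emeasure_sphere_measure:
  assumes measurable_B: "B \<in> sets (\<omega> :: (real^'n) measure)"
  shows "emeasure \<omega> B = of_nat CARD('n) * emeasure lborel {x. norm x \<le> 1 \<and> direction x \<in> B}"
proof -
  have "{x. norm x \<le> 1 \<and> direction x \<in> B} = direction -` B \<inter> cball 0 1" by auto
  then show ?thesis
    using measurable_B unfolding sphere_measure_eq_distr
    by (subst emeasure_distr[OF measurable_direction_cball])
      (auto simp: emeasure_restrict_space space_scale_measure space_restrict_space)
qed

interpretation sphere: finite_measure "\<omega> :: (real^'n) measure"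
proof
  have "emeasure (\<omega> :: (real^'n) measure) (sphere 0 1) \<noteq> \<infinity>"
    using emeasure_lborel_cball_finite[of "0::real^'n" 1]
    by (subst emeasure_sphere_measure)
      (auto simp: sets_sphere_measure sets_restrict_space cball_def ennreal_mult_eq_top_iff)
  then show "emeasure (\<omega> :: (real^'n) measure) (space \<omega>) \<noteq> \<infinity>" by simp
qed

lemma measurable_sphere_continuous:
  fixes F :: "real^'n \<Rightarrow> 'b::{banach, second_countable_topology}"
  shows "continuous_on (sphere 0 1) F \<Longrightarrow> F \<in> borel_measurable \<omega>"
  using borel_measurable_continuous_on_restrict[of "sphere 0 1" F]
  by (simp cong: measurable_cong_sets add: sets_sphere_measure)

lemma integrable_sphere_continuous_mult:
  fixes F G :: "real^'n \<Rightarrow> 'b::{banach, second_countable_topology, real_normed_field}"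
  assumes cont_F: "continuous_on (sphere 0 1) F" and integrable_G: "integrable \<omega> G"
  shows "integrable \<omega> (\<lambda>v. F v * G v)"
proof -
  have "bounded (F ` sphere 0 1)"
    using cont_F by (intro compact_imp_bounded compact_continuous_image) auto
  then obtain B where bound_F: "\<And>v. v \<in> sphere 0 1 \<Longrightarrow> norm (F v) \<le> B" unfolding bounded_iff by blast
  show ?thesis
  proof (rule Bochner_Integration.integrable_bound)
    show "integrable \<omega> (\<lambda>v. B * norm (G v))" using integrable_G by simp
    show "(\<lambda>v. F v * G v) \<in> borel_measurable \<omega>"
      using integrable_G
      by (intro borel_measurable_times[OF measurable_sphere_continuous[OF cont_F]]) auto
    show "AE v in \<omega>. norm (F v * G v) \<le> norm (B * norm (G v))"
      by (rule AE_I2) (auto simp: norm_mult abs_mult intro!: mult_right_mono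
          order_trans[OF bound_F abs_ge_self])
  qed
qed

lemma integrable_sphere_continuous:
  fixes F :: "real^'n \<Rightarrow> 'b::{banach, second_countable_topology, real_normed_field}"
  shows "continuous_on (sphere 0 1) F \<Longrightarrow> integrable \<omega> F"
  using integrable_sphere_continuous_mult[of F "\<lambda>_. 1"] by simp

lemma emeasure_lborel_scaleR:
  fixes A :: "'a::euclidean_space set"
  assumes measurable_A: "A \<in> sets borel" and nonzero_c: "c \<noteq> 0"
  shows "emeasure lborel A = ennreal (\<bar>c\<bar> ^ DIM('a)) * emeasure lborel ((\<lambda>x. c *\<^sub>R x) -` A)"
proof -
  have "emeasure lborel A =
      emeasure (density (distr lborel borel (\<lambda>x::'a. 0 + c *\<^sub>R x)) (\<lambda>_. \<bar>c\<bar> ^ DIM('a))) A"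
    using nonzero_c by (subst lborel_affine[of c "0::'a"]) auto
  also have "\<dots> = ennreal (\<bar>c\<bar> ^ DIM('a)) * emeasure (distr lborel borel (\<lambda>x::'a. 0 + c *\<^sub>R x)) A"
    using measurable_A by (subst emeasure_density_const) auto
  also have "emeasure (distr lborel borel (\<lambda>x::'a. 0 + c *\<^sub>R x)) A =
      emeasure lborel ((\<lambda>x. c *\<^sub>R x) -` A)"
    using measurable_A by (subst emeasure_distr) auto
  finally show ?thesis .
qed

lemma measurable_uminus_sphere [measurable]: "uminus \<in> (\<omega> :: (real^'n) measure) \<rightarrow>\<^sub>M \<omega>"
  using measurable_restrict_space3[of uminus "borel :: (real^'n) measure" borel "sphere 0 1"
      "sphere 0 1"]
  by (simp cong: measurable_cong_sets add: sets_sphere_measure)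

lemma distr_sphere_uminus: "distr \<omega> \<omega> uminus = (\<omega> :: (real^'n) measure)"
proof (rule measure_eqI)
  show "sets (distr \<omega> \<omega> uminus) = sets (\<omega> :: (real^'n) measure)" by simp
  fix B assume "B \<in> sets (distr \<omega> (\<omega> :: (real^'n) measure) uminus)"
  then have measurable_B [measurable]: "B \<in> sets \<omega>" by simp
  have measurable_uminus_B: "uminus -` B \<inter> space \<omega> \<in> sets \<omega>" by measurable
  define cone where "cone B = {x::real^'n. norm x \<le> 1 \<and> direction x \<in> B}" for B
  have cone: "cone B' \<in> sets borel" if "B' \<in> sets \<omega>" for B'
  proof -
    have "cone B' = direction -` B' \<inter> cball 0 1" by (auto simp: cone_def)
    then show ?thesis using that by auto
  qed
  have "emeasure lborel (cone (uminus -` B \<inter> space \<omega>)) = emeasure lborel ((\<lambda>x. (-1) *\<^sub>R x) -` cone B)"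
  proof (rule emeasure_eq_AE)
    show "AE x in lborel. (x \<in> cone (uminus -` B \<inter> space \<omega>)) = (x \<in> (\<lambda>x. (-1) *\<^sub>R x) -` cone B)"
      using AE_lborel_singleton[of 0]
      by eventually_elim (simp add: cone_def direction_def sgn_minus norm_sgn)
    show "(\<lambda>x. (-1) *\<^sub>R x) -` cone B \<in> sets lborel"
      using measurable_sets[of "\<lambda>x. (-1) *\<^sub>R x" borel borel "cone B"] cone[OF measurable_B] by simp
  qed (use cone[OF measurable_uminus_B] in simp)
  also have "\<dots> = emeasure lborel (cone B)"
    using emeasure_lborel_scaleR[OF cone[OF measurable_B], of "-1"] by simp
  finally show "emeasure (distr \<omega> \<omega> uminus) B = emeasure \<omega> B"
    by (subst emeasure_distr)
      (simp_all only: emeasure_sphere_measure[OF measurable_uminus_B]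
          emeasure_sphere_measure[OF measurable_B] cone_def
        measurable_uminus_sphere measurable_B)
qed

lemma integral_sphere_uminus:
  fixes F :: "real^'n \<Rightarrow> 'b::{banach, second_countable_topology}"
  assumes "F \<in> borel_measurable \<omega>"
  shows "(LINT v|\<omega>. F (- v)) = (LINT v|\<omega>. F v)"
  using integral_distr[OF measurable_uminus_sphere assms] by (simp add: distr_sphere_uminus)

definition radial_measure :: "nat \<Rightarrow> real measure" where
  "radial_measure d = density lborel (\<lambda>r. ennreal (indicator {0<..} r * r ^ (d - 1)))"

lemma sets_radial_measure [simp, measurable_cong]: "sets (radial_measure d) = sets borel"
  by (simp add: radial_measure_def)

lemma space_radial_measure [simp]: "space (radial_measure d) = UNIV"
  by (simp add: radial_measure_def)

lemma emeasure_radial_measure_atMost: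
  assumes "d > 0"
  shows "emeasure (radial_measure d) {..R} = ennreal (max 0 R ^ d / d)"
proof -
  have "emeasure (radial_measure d) {..R} =
      (\<integral>\<^sup>+r. ennreal (r ^ (d - 1)) * indicator {0..max 0 R} r \<partial>lborel)"
    unfolding radial_measure_def
    by (subst emeasure_density)
      (auto intro!: nn_integral_cong_AE eventually_mono[OF AE_lborel_singleton[of 0]]
          simp: indicator_def max_def)
  also have "\<dots> = ennreal (max 0 R ^ d / d - 0 ^ d / d)"
    using assms by (intro nn_integral_FTC_Icc) (auto intro!: derivative_eq_intros)
  finally show ?thesis using assms by (simp add: zero_power)
qed

lemma sigma_finite_radial_measure: "sigma_finite_measure (radial_measure d)"
  unfolding radial_measure_def
  by (subst sigma_finite_measure.sigma_finite_iff_density_finite[OF sigma_finite_lborel]) auto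

lemma emeasure_lborel_cone:
  assumes measurable_B: "B \<in> sets (\<omega> :: (real^'n) measure)"
  shows "emeasure lborel {x. norm x \<le> R \<and> direction x \<in> B} =
    emeasure (radial_measure CARD('n)) {..R} * emeasure \<omega> B"
proof (cases "R > 0")
  case True
  let ?C = "{x. norm x \<le> R \<and> direction x \<in> B}"
  have "?C = direction -` B \<inter> cball 0 R" by auto
  then have "?C \<in> sets borel" using measurable_B by auto
  moreover have "(\<lambda>x. R *\<^sub>R x) -` ?C = {x. norm x \<le> 1 \<and> direction x \<in> B}"
    using True by (auto simp: direction_scaleR)
  ultimately have "emeasure lborel ?C =
      ennreal (R ^ CARD('n)) * emeasure lborel {x. norm x \<le> 1 \<and> direction x \<in> B}"
    using emeasure_lborel_scaleR[of ?C R] True by simp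
  also have "ennreal (R ^ CARD('n)) = ennreal (R ^ CARD('n) / CARD('n)) * of_nat CARD('n)"
    using True by (simp add: ennreal_of_nat_eq_real_of_nat flip: ennreal_mult')
  finally show ?thesis
    using True
    by (simp add: emeasure_radial_measure_atMost emeasure_sphere_measure[OF measurable_B] mult.assoc)
next
  case False
  then have "{x::real^'n. norm x \<le> R \<and> direction x \<in> B} \<subseteq> {0}"
    by (auto simp: not_less) (metis norm_le_zero_iff order_trans)
  then have "emeasure lborel {x::real^'n. norm x \<le> R \<and> direction x \<in> B} \<le> emeasure lborel {0::real^'n}"
    by (intro emeasure_mono) auto
  then show ?thesis using False by (simp add: emeasure_radial_measure_atMost zero_power)
qed

lemma measure_eqI_atMost:
  fixes M N :: "real measure"
  assumes sets_M: "sets M = sets borel" and sets_N: "sets N = sets borel"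
    and eq: "\<And>a. emeasure M {..a} = emeasure N {..a}" and finite: "\<And>a. emeasure M {..a} \<noteq> \<infinity>"
  shows "M = N"
proof (rule measure_eqI_generator_eq[where E="range (\<lambda>a. {..a})" and \<Omega>=UNIV and A="\<lambda>n. {..real n}"])
  have "sets (borel :: real measure) = sigma_sets UNIV (range (\<lambda>a. {..a}))"
    by (subst borel_eq_atMost) (rule sets_measure_of, simp)
  then show "sets M = sigma_sets UNIV (range (\<lambda>a. {..a}))"
    "sets N = sigma_sets UNIV (range (\<lambda>a. {..a}))"
    by (simp_all add: sets_M sets_N)
  show "Int_stable (range (\<lambda>a::real. {..a}))"
    unfolding Int_stable_def by (simp add: Int_atMost)
  show "(\<Union>i. {..real i}) = UNIV" by (simp add: set_eq_iff real_arch_simple)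
qed (use eq finite in auto)

lemma emeasure_lborel_polar:
  assumes measurable_A [measurable]: "A \<in> sets borel"
    and measurable_B [measurable]: "B \<in> sets (\<omega> :: (real^'n) measure)"
  shows "emeasure lborel {x. norm x \<in> A \<and> direction x \<in> B} =
    emeasure (radial_measure CARD('n)) A * emeasure \<omega> B"
proof -
  let ?r = "radial_measure CARD('n)"
  define norm_law where "norm_law =
      distr (restrict_space lborel (direction -` B :: (real^'n) set)) borel norm"
  have norm_law: "emeasure norm_law C = emeasure lborel {x. norm x \<in> C \<and> direction x \<in> B}"
    if [measurable]: "C \<in> sets borel" for C
  proof -
    have "{x. norm x \<in> C \<and> direction x \<in> B} = norm -` C \<inter> direction -` B" by auto
    moreover have "(norm -` C \<inter> direction -` B :: (real^'n) set) \<in> sets borel"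
      using measurable_sets[of norm "borel :: (real^'n) measure" borel C] by simp
    ultimately show ?thesis
      unfolding norm_law_def
      by (subst emeasure_distr)
        (auto simp: emeasure_restrict_space space_restrict_space intro!: measurable_restrict_space1)
  qed
  have "norm_law = scale_measure (emeasure \<omega> B) ?r"
  proof (rule measure_eqI_atMost)
    show "emeasure norm_law {..R} = emeasure (scale_measure (emeasure \<omega> B) ?r) {..R}" for R
      using emeasure_lborel_cone[OF measurable_B, of R] norm_law[of "{..R}"] by (simp add: mult.commute)
    show "emeasure norm_law {..R} \<noteq> \<infinity>" for R
      using emeasure_lborel_cone[OF measurable_B, of R] norm_law[of "{..R}"]
      by (simp add: emeasure_radial_measure_atMost ennreal_mult_eq_top_iff)
  qed (simp_all add: norm_law_def)
  then show ?thesis using norm_law[OF measurable_A] by (simp add: mult.commute)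
qed

theorem polar_coordinates:
  "radial_measure CARD('n) \<Otimes>\<^sub>M (\<omega> :: (real^'n) measure) =
     distr lborel (borel \<Otimes>\<^sub>M \<omega>) (\<lambda>x. (norm x, direction x))"
proof (rule pair_measure_eqI)
  let ?w = "\<omega> :: (real^'n) measure" and ?r = "radial_measure CARD('n)"
  let ?M = "distr lborel (borel \<Otimes>\<^sub>M ?w) (\<lambda>x. (norm x, direction x))"
  show "sigma_finite_measure ?r" by (rule sigma_finite_radial_measure)
  show "sigma_finite_measure ?w" ..
  show "sets (?r \<Otimes>\<^sub>M ?w) = sets ?M"
    by (simp cong: sets_pair_measure_cong)
  fix A B assume "A \<in> sets ?r" and [measurable]: "B \<in> sets ?w"
  then have [measurable]: "A \<in> sets borel" by simp
  have "(\<lambda>x. (norm x, direction x)) -` (A \<times> B) = {x. norm x \<in> A \<and> direction x \<in> B}" by auto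
  then show "emeasure ?r A * emeasure ?w B = emeasure ?M (A \<times> B)"
    by (subst emeasure_distr) (simp_all add: emeasure_lborel_polar)
qed

section \<open>Homogeneous polynomials\<close>

definition monomial :: "('n::finite \<Rightarrow> nat) \<Rightarrow> real^'n \<Rightarrow> real" where
  "monomial k x = (\<Prod>i\<in>UNIV. (x $ i) ^ k i)"

lemma finite_multiindex: "finite {k :: 'n::finite \<Rightarrow> nat. sum k UNIV = j}"
proof (rule finite_subset)
  show "{k :: 'n \<Rightarrow> nat. sum k UNIV = j} \<subseteq> PiE UNIV (\<lambda>_. {..j})"
    by (auto intro: member_le_sum)
qed (auto intro: finite_PiE)

lemma monomial_mult: "monomial k x * monomial l x = monomial (\<lambda>i. k i + l i) x"
  by (simp add: monomial_def power_add prod.distrib)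

lemma monomial_upd: "monomial (k(i := m)) x = (x $ i) ^ m * (\<Prod>l\<in>UNIV - {i}. (x $ l) ^ k l)"
  unfolding monomial_def by (subst prod.remove[of _ i]) (auto intro!: prod.cong)

lemma monomial_remove: "monomial k x = (x $ i) ^ k i * (\<Prod>l\<in>UNIV - {i}. (x $ l) ^ k l)"
  using monomial_upd[of k i "k i"] by simp

lemma hom_poly_altdef:
  "hom_poly j f \<longleftrightarrow> (\<exists>c. f = (\<lambda>x. \<Sum>k | sum k UNIV = j. c k * of_real (monomial k x)))"
  by (simp add: hom_poly_def monomial_def)

lemma hom_poly_monomial: "sum k UNIV = j \<Longrightarrow> hom_poly j (\<lambda>x. c * of_real (monomial k x))"
  unfolding hom_poly_altdef
  by (rule exI[of _ "\<lambda>l. if l = k then c else 0"])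
    (simp add: if_distrib[of "\<lambda>a. a * _"] finite_multiindex cong: if_cong)

lemma hom_poly_zero: "hom_poly j (\<lambda>x. 0)"
  unfolding hom_poly_altdef by (rule exI[of _ "\<lambda>_. 0"]) simp

lemma hom_poly_add:
  assumes "hom_poly j f" "hom_poly j g"
  shows "hom_poly j (\<lambda>x. f x + g x)"
proof -
  obtain a b where "f = (\<lambda>x. \<Sum>k | sum k UNIV = j. a k * of_real (monomial k x))"
    "g = (\<lambda>x. \<Sum>k | sum k UNIV = j. b k * of_real (monomial k x))"
    using assms unfolding hom_poly_altdef by blast
  then have "(\<lambda>x. f x + g x) = (\<lambda>x. \<Sum>k | sum k UNIV = j. (a k + b k) * of_real (monomial k x))"
    by (simp add: sum.distrib distrib_right)
  then show ?thesis unfolding hom_poly_altdef by (rule exI[of _ "\<lambda>k. a k + b k"])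
qed

lemma hom_poly_sum: "(\<And>i. i \<in> I \<Longrightarrow> hom_poly j (f i)) \<Longrightarrow> hom_poly j (\<lambda>x. \<Sum>i\<in>I. f i x)"
  by (induction I rule: infinite_finite_induct) (auto intro: hom_poly_zero hom_poly_add)

lemma hom_poly_induct [consumes 1, case_names monomial add]:
  fixes f :: "real^'n \<Rightarrow> complex"
  assumes "hom_poly j f"
    and monomial: "\<And>c k. sum k UNIV = j \<Longrightarrow> Q (\<lambda>x. c * of_real (monomial k x))"
    and add: "\<And>f g. hom_poly j f \<Longrightarrow> hom_poly j g \<Longrightarrow> Q f \<Longrightarrow> Q g \<Longrightarrow> Q (\<lambda>x. f x + g x)"
  shows "Q f"
proof -
  obtain c where f_eq: "f = (\<lambda>x. \<Sum>k | sum k UNIV = j. c k * of_real (monomial k x))"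
    using assms(1) by (auto simp: hom_poly_altdef)
  have "Q (\<lambda>x. \<Sum>k\<in>K. c k * of_real (monomial k x))" if "finite K" "\<forall>k\<in>K. sum k UNIV = j" for K
    using that
  proof (induction K rule: finite_induct)
    case empty
    show ?case using monomial[of "\<lambda>i. if i = undefined then j else 0" 0] by simp
  next
    case (insert k K)
    have "hom_poly j (\<lambda>x. \<Sum>k\<in>K. c k * of_real (monomial k x))"
      using insert by (intro hom_poly_sum hom_poly_monomial) auto
    then show ?case using insert by (simp add: monomial add hom_poly_monomial)
  qed
  then show ?thesis unfolding f_eq by (auto simp: finite_multiindex)
qed

lemma hom_poly_mult:
  assumes "hom_poly i f" "hom_poly j g"
  shows "hom_poly (i + j) (\<lambda>x. f x * g x)"
  using assms(1)
proof (induction rule: hom_poly_induct)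
  case (monomial c k)
  note degree_k = monomial
  show ?case using assms(2)
  proof (induction rule: hom_poly_induct)
    case (monomial e l)
    have "hom_poly (i + j) (\<lambda>x. (c * e) * of_real (monomial (\<lambda>i. k i + l i) x))"
      using monomial degree_k by (intro hom_poly_monomial) (simp add: sum.distrib)
    then show ?case by (simp add: ac_simps flip: monomial_mult)
  next
    case (add f g)
    then show ?case using hom_poly_add[OF add(3,4)] by (simp add: algebra_simps)
  qed
next
  case (add f g)
  then show ?case using hom_poly_add[OF add(3,4)] by (simp add: algebra_simps)
qed

lemma hom_poly_const: "hom_poly 0 (\<lambda>x. c)"
  using hom_poly_monomial[of "\<lambda>_. 0" 0 c] by (simp add: monomial_def)

lemma hom_poly_cmult: "hom_poly j f \<Longrightarrow> hom_poly j (\<lambda>x. c * f x)"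
  using hom_poly_mult[OF hom_poly_const] by simp

lemma hom_poly_power: "hom_poly j f \<Longrightarrow> hom_poly (j * m) (\<lambda>x. f x ^ m)"
  by (induction m) (auto intro: hom_poly_const dest: hom_poly_mult)

lemma hom_poly_component: "hom_poly 1 (\<lambda>x. of_real (x $ i))"
proof -
  have "monomial (\<lambda>l. if l = i then 1 else 0) x = x $ i" for x :: "real^'a"
    unfolding monomial_def by (subst prod.remove[of _ i]) auto
  then show ?thesis
    using hom_poly_monomial[of "\<lambda>l. if l = i then 1 else 0" 1 1] by simp
qed

lemma hom_poly_inner: "hom_poly 1 (\<lambda>x. of_real (y \<bullet> x))"
proof -
  have "hom_poly 1 (\<lambda>x. \<Sum>i\<in>UNIV. of_real (y $ i) * of_real (x $ i))"
    by (intro hom_poly_sum hom_poly_cmult hom_poly_component)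
  then show ?thesis by (simp add: inner_vec_def)
qed

lemma hom_poly_inner_power: "hom_poly m (\<lambda>x. of_real ((y \<bullet> x) ^ m))"
  using hom_poly_power[OF hom_poly_inner[of y], of m] by simp

lemma hom_poly_inner_self: "hom_poly 2 (\<lambda>x. of_real (x \<bullet> x))"
proof -
  have "hom_poly (1+1) (\<lambda>x. \<Sum>i\<in>UNIV. of_real (x $ i) * of_real (x $ i))"
    by (intro hom_poly_sum hom_poly_mult hom_poly_component)
  then show ?thesis by (simp add: inner_vec_def numeral_2_eq_2)
qed

lemma hom_poly_scaleR:
  assumes "hom_poly j f" shows "f (a *\<^sub>R x) = of_real (a ^ j) * f x"
  using assms
  by (induction rule: hom_poly_induct)
    (auto simp: monomial_def power_mult_distrib prod.distrib power_sum[symmetric] algebra_simps)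

lemma hom_poly_eqI_sphere:
  assumes hom_f: "hom_poly j f" and hom_g: "hom_poly j g" and eq: "\<And>v. norm v = 1 \<Longrightarrow> f v = g v"
  shows "f = g"
proof
  fix x
  show "f x = g x"
    using hom_poly_scaleR[OF hom_f, of "norm x" "direction x"]
      hom_poly_scaleR[OF hom_g, of "norm x" "direction x"] eq[of "direction x"] by simp
qed

lemma continuous_on_hom_poly: "hom_poly j f \<Longrightarrow> continuous_on A f"
  by (induction rule: hom_poly_induct) (auto simp: monomial_def intro!: continuous_intros)

lemma integrable_sphere_hom_poly: "hom_poly j f \<Longrightarrow> integrable \<omega> f"
  by (intro integrable_sphere_continuous continuous_on_hom_poly)

definition has_partial_deriv ::
    "'n::finite \<Rightarrow> (real^'n \<Rightarrow> complex) \<Rightarrow> (real^'n \<Rightarrow> complex) \<Rightarrow> bool" where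
  "has_partial_deriv i f f' \<longleftrightarrow>
    (\<forall>x. ((\<lambda>t. f (x + t *\<^sub>R axis i 1)) has_vector_derivative f' x) (at 0))"

lemma has_partial_deriv_imp_eq: "has_partial_deriv i f f' \<Longrightarrow> partial_deriv i f = f'"
  by (auto simp: has_partial_deriv_def partial_deriv_def vector_derivative_at fun_eq_iff)

lemma has_partial_deriv_const: "has_partial_deriv i (\<lambda>x. c) (\<lambda>x. 0)"
  by (simp add: has_partial_deriv_def)

lemma has_partial_deriv_add:
  "has_partial_deriv i f f' \<Longrightarrow> has_partial_deriv i g g' \<Longrightarrow>
    has_partial_deriv i (\<lambda>x. f x + g x) (\<lambda>x. f' x + g' x)"
  by (auto simp: has_partial_deriv_def intro!: has_vector_derivative_add)

lemma has_partial_deriv_mult: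
  "has_partial_deriv i f f' \<Longrightarrow> has_partial_deriv i g g' \<Longrightarrow>
    has_partial_deriv i (\<lambda>x. f x * g x) (\<lambda>x. f' x * g x + f x * g' x)"
  unfolding has_partial_deriv_def by (auto intro!: derivative_eq_intros)

lemma has_partial_deriv_cmult:
  "has_partial_deriv i f f' \<Longrightarrow> has_partial_deriv i (\<lambda>x. c * f x) (\<lambda>x. c * f' x)"
  using has_partial_deriv_mult[OF has_partial_deriv_const] by simp

lemma has_partial_deriv_sum:
  "(\<And>l. l \<in> I \<Longrightarrow> has_partial_deriv i (f l) (f' l)) \<Longrightarrow>
    has_partial_deriv i (\<lambda>x. \<Sum>l\<in>I. f l x) (\<lambda>x. \<Sum>l\<in>I. f' l x)"
  by (induction I rule: infinite_finite_induct)
    (auto intro: has_partial_deriv_const has_partial_deriv_add)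

lemma has_partial_deriv_of_real:
  assumes "\<And>x. ((\<lambda>t. f (x + t *\<^sub>R axis i 1)) has_real_derivative f' x) (at 0)"
  shows "has_partial_deriv i (\<lambda>x. of_real (f x)) (\<lambda>x. of_real (f' x))"
  using assms unfolding has_partial_deriv_def
  by (auto intro!: has_vector_derivative_of_real simp: has_real_derivative_iff_has_vector_derivative)

lemma has_partial_deriv_monomial:
  "has_partial_deriv i (\<lambda>x. of_real (monomial k x))
     (\<lambda>x. of_real (real (k i) * monomial (k(i := k i - 1)) x))"
proof (rule has_partial_deriv_of_real)
  fix x :: "real^'a"
  let ?p = "\<Prod>l\<in>UNIV - {i}. (x $ l) ^ k l"
  have "monomial k (x + t *\<^sub>R axis i 1) = (x $ i + t) ^ k i * ?p" for t
    unfolding monomial_remove[of k _ i] by (auto simp: axis_def intro!: prod.cong)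
  moreover have "((\<lambda>t. (x $ i + t) ^ k i * ?p) has_real_derivative
      real (k i) * ((x $ i) ^ (k i - 1) * ?p)) (at 0)"
    by (auto intro!: derivative_eq_intros)
  ultimately show "((\<lambda>t. monomial k (x + t *\<^sub>R axis i 1)) has_real_derivative
      real (k i) * monomial (k(i := k i - 1)) x) (at 0)" by (simp add: monomial_upd)
qed

lemma partial_deriv_monomial:
  "partial_deriv i (\<lambda>x. c * of_real (monomial k x)) =
    (\<lambda>x. (c * of_nat (k i)) * of_real (monomial (k(i := k i - 1)) x))"
  using has_partial_deriv_imp_eq[OF has_partial_deriv_cmult[OF has_partial_deriv_monomial]]
  by (simp add: mult.assoc)

lemma sum_fun_upd_pred:
  fixes k :: "'n::finite \<Rightarrow> nat"
  assumes "k i \<noteq> 0" shows "sum (k(i := k i - 1)) UNIV = sum k UNIV - 1"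
proof -
  have "sum k UNIV = k i + sum k (UNIV - {i})" by (subst sum.remove[of _ i]) auto
  moreover have "sum (k(i := k i - 1)) UNIV = (k i - 1) + sum k (UNIV - {i})"
    by (subst sum.remove[of _ i]) auto
  ultimately show ?thesis using assms by simp
qed

lemma
  assumes "hom_poly j f"
  shows has_partial_deriv_hom_poly: "has_partial_deriv i f (partial_deriv i f)"
    and hom_poly_partial_deriv: "hom_poly (j - 1) (partial_deriv i f)"
proof -
  have "has_partial_deriv i f (partial_deriv i f) \<and> hom_poly (j - 1) (partial_deriv i f)"
    using assms
  proof (induction rule: hom_poly_induct)
    case (monomial c k)
    have "hom_poly (j - 1) (\<lambda>x. (c * of_nat (k i)) * of_real (monomial (k(i := k i - 1)) x))"
    proof (cases "k i = 0")
      case False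
      then show ?thesis
        using sum_fun_upd_pred[of k i, OF False] monomial by (intro hom_poly_monomial) simp
    qed (simp add: hom_poly_zero)
    then show ?case
      using has_partial_deriv_cmult[OF has_partial_deriv_monomial, of i c k]
      by (simp add: partial_deriv_monomial mult.assoc)
  next
    case (add f g)
    then have "has_partial_deriv i (\<lambda>x. f x + g x) (\<lambda>x. partial_deriv i f x + partial_deriv i g x)"
      by (intro has_partial_deriv_add) auto
    note has_partial_deriv_imp_eq[OF this] this
    with add show ?case by (simp add: hom_poly_add)
  qed
  then show "has_partial_deriv i f (partial_deriv i f)" "hom_poly (j - 1) (partial_deriv i f)"
    by auto
qed

lemma partial_deriv_add:
  "hom_poly j f \<Longrightarrow> hom_poly m g \<Longrightarrow>
    partial_deriv i (\<lambda>x. f x + g x) = (\<lambda>x. partial_deriv i f x + partial_deriv i g x)"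
  by (intro has_partial_deriv_imp_eq has_partial_deriv_add has_partial_deriv_hom_poly)

lemma partial_deriv_mult:
  "hom_poly j f \<Longrightarrow> hom_poly m g \<Longrightarrow>
    partial_deriv i (\<lambda>x. f x * g x) = (\<lambda>x. partial_deriv i f x * g x + f x * partial_deriv i g x)"
  by (intro has_partial_deriv_imp_eq has_partial_deriv_mult has_partial_deriv_hom_poly)

lemma partial_deriv_cmult:
  "hom_poly j f \<Longrightarrow> partial_deriv i (\<lambda>x. c * f x) = (\<lambda>x. c * partial_deriv i f x)"
  by (intro has_partial_deriv_imp_eq has_partial_deriv_cmult has_partial_deriv_hom_poly)

lemma partial_deriv_sum:
  "(\<And>l. l \<in> I \<Longrightarrow> hom_poly j (f l)) \<Longrightarrow>
    partial_deriv i (\<lambda>x. \<Sum>l\<in>I. f l x) = (\<lambda>x. \<Sum>l\<in>I. partial_deriv i (f l) x)"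
  by (intro has_partial_deriv_imp_eq has_partial_deriv_sum has_partial_deriv_hom_poly)

lemma partial_deriv_const: "partial_deriv i (\<lambda>x. c) = (\<lambda>x. 0)"
  by (intro has_partial_deriv_imp_eq has_partial_deriv_const)

lemma partial_deriv_inner: "partial_deriv i (\<lambda>x. of_real (y \<bullet> x)) = (\<lambda>x. of_real (y $ i))"
  by (intro has_partial_deriv_imp_eq has_partial_deriv_of_real)
    (auto intro!: derivative_eq_intros simp: inner_add_right inner_axis)

lemma partial_deriv_inner_self: "partial_deriv i (\<lambda>x. of_real (x \<bullet> x)) = (\<lambda>x. of_real (2 * x $ i))"
  by (intro has_partial_deriv_imp_eq has_partial_deriv_of_real)
    (auto intro!: derivative_eq_intros simp: inner_add_left inner_add_right inner_axis inner_axis')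

lemma partial_deriv_commute:
  assumes "hom_poly j f"
  shows "partial_deriv i (partial_deriv l f) = partial_deriv l (partial_deriv i f)"
  using assms
proof (induction rule: hom_poly_induct)
  case (monomial c k)
  then show ?case
    by (cases "i = l") (auto simp: partial_deriv_monomial fun_upd_twist fun_eq_iff)
next
  case (add f g)
  then show ?case
    by (simp add: partial_deriv_add[OF add(1,2)]
      partial_deriv_add[OF hom_poly_partial_deriv[OF add(1)] hom_poly_partial_deriv[OF add(2)]])
qed

definition dir_deriv :: "real^'n \<Rightarrow> (real^'n \<Rightarrow> complex) \<Rightarrow> real^'n \<Rightarrow> complex" where
  "dir_deriv y f x = (\<Sum>i\<in>UNIV. of_real (y $ i) * partial_deriv i f x)"

lemma hom_poly_dir_deriv: "hom_poly j f \<Longrightarrow> hom_poly (j - 1) (dir_deriv y f)"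
  unfolding dir_deriv_def[abs_def] by (intro hom_poly_sum hom_poly_cmult hom_poly_partial_deriv)

lemma dir_deriv_add:
  "hom_poly j f \<Longrightarrow> hom_poly m g \<Longrightarrow> dir_deriv y (\<lambda>x. f x + g x) x = dir_deriv y f x + dir_deriv y g x"
  by (simp add: dir_deriv_def partial_deriv_add distrib_left sum.distrib)

lemma dir_deriv_cmult: "hom_poly j f \<Longrightarrow> dir_deriv y (\<lambda>x. c * f x) x = c * dir_deriv y f x"
  by (simp add: dir_deriv_def partial_deriv_cmult sum_distrib_left ac_simps)

lemma dir_deriv_mult:
  "hom_poly j f \<Longrightarrow> hom_poly m g \<Longrightarrow>
    dir_deriv y (\<lambda>x. f x * g x) x = dir_deriv y f x * g x + f x * dir_deriv y g x"
  by (simp add: dir_deriv_def partial_deriv_mult distrib_left sum.distrib sum_distrib_left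
      sum_distrib_right ac_simps)

lemma dir_deriv_const: "dir_deriv y (\<lambda>x. c) x = 0"
  by (simp add: dir_deriv_def partial_deriv_const)

lemma dir_deriv_inner: "dir_deriv y (\<lambda>x. of_real (z \<bullet> x)) x = of_real (y \<bullet> z)"
  unfolding dir_deriv_def partial_deriv_inner by (simp add: inner_vec_def)

lemma dir_deriv_inner_self: "dir_deriv y (\<lambda>x. of_real (x \<bullet> x)) x = 2 * of_real (y \<bullet> x)"
  unfolding dir_deriv_def partial_deriv_inner_self
  by (simp add: inner_vec_def sum_distrib_left ac_simps)

lemma dir_deriv_inner_power:
  "dir_deriv y (\<lambda>x. of_real ((z \<bullet> x) ^ m)) x = of_real (real m * (z \<bullet> x) ^ (m - 1) * (y \<bullet> z))"
proof (induction m)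
  case (Suc m)
  have "dir_deriv y (\<lambda>x. of_real (z \<bullet> x) * of_real ((z \<bullet> x) ^ m)) x =
      of_real ((y \<bullet> z) * (z \<bullet> x) ^ m + (z \<bullet> x) * (real m * (z \<bullet> x) ^ (m - 1) * (y \<bullet> z)))"
    by (simp add: dir_deriv_mult[OF hom_poly_inner hom_poly_inner_power] dir_deriv_inner Suc.IH
        del: of_real_power)
  also have "(y \<bullet> z) * (z \<bullet> x) ^ m + (z \<bullet> x) * (real m * (z \<bullet> x) ^ (m - 1) * (y \<bullet> z)) =
      real (Suc m) * (z \<bullet> x) ^ m * (y \<bullet> z)"
    by (cases m) (simp_all add: algebra_simps)
  finally show ?case by simp
qed (simp add: dir_deriv_const)

lemma Euler_hom_poly:
  assumes "hom_poly j f"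
  shows "dir_deriv x f x = of_nat j * f x"
  using assms
proof (induction rule: hom_poly_induct)
  case (monomial c k)
  have component: "x $ i * (real (k i) * monomial (k(i := k i - 1)) x) =
      real (k i) * monomial k x" for i
  proof (cases "k i")
    case (Suc m)
    then show ?thesis unfolding monomial_upd monomial_remove[of k x i] by simp
  qed simp
  have "dir_deriv x (\<lambda>x. c * of_real (monomial k x)) x =
      (\<Sum>i\<in>UNIV. c * of_real (x $ i * (real (k i) * monomial (k(i := k i - 1)) x)))"
    by (simp add: dir_deriv_def partial_deriv_monomial ac_simps)
  also have "\<dots> = of_nat (sum k UNIV) * (c * of_real (monomial k x))"
    unfolding component by (simp add: sum_distrib_left sum_distrib_right ac_simps)
  finally show ?case using monomial by simp
next
  case (add f g)
  then show ?case by (simp add: dir_deriv_add[OF add(1,2)] algebra_simps)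
qed

lemma laplacian_add:
  assumes "hom_poly j f" "hom_poly j g"
  shows "laplacian (\<lambda>x. f x + g x) x = laplacian f x + laplacian g x"
  unfolding laplacian_def partial_deriv_add[OF assms]
    partial_deriv_add[OF assms[THEN hom_poly_partial_deriv]] by (rule sum.distrib)

lemma laplacian_cmult:
  assumes "hom_poly j f"
  shows "laplacian (\<lambda>x. c * f x) x = c * laplacian f x"
  unfolding laplacian_def partial_deriv_cmult[OF assms]
    partial_deriv_cmult[OF assms[THEN hom_poly_partial_deriv]] by (rule sum_distrib_left[symmetric])

lemma laplacian_mult:
  assumes hom_f: "hom_poly j f" and hom_g: "hom_poly m g"
  shows "laplacian (\<lambda>x. f x * g x) x =
    laplacian f x * g x + 2 * (\<Sum>i\<in>UNIV. partial_deriv i f x * partial_deriv i g x) +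
      f x * laplacian g x"
proof -
  note hom_partial_f = hom_poly_partial_deriv[OF hom_f]
    and hom_partial_g = hom_poly_partial_deriv[OF hom_g]
  have "partial_deriv i (\<lambda>x. partial_deriv i f x * g x + f x * partial_deriv i g x) x =
      partial_deriv i (partial_deriv i f) x * g x + partial_deriv i f x * partial_deriv i g x +
      (partial_deriv i f x * partial_deriv i g x + f x * partial_deriv i (partial_deriv i g) x)" for i
    by (simp add:
        partial_deriv_add[OF hom_poly_mult[OF hom_partial_f hom_g] hom_poly_mult[OF hom_f hom_partial_g]]
        partial_deriv_mult[OF hom_partial_f hom_g] partial_deriv_mult[OF hom_f hom_partial_g])
  then show ?thesis
    by (simp add: laplacian_def partial_deriv_mult[OF hom_f hom_g] sum.distrib sum_distrib_left
        sum_distrib_right)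
qed

lemma laplacian_inner_mult:
  assumes hom_f: "hom_poly j f"
  shows "laplacian (\<lambda>x. of_real (y \<bullet> x) * f x) x =
      of_real (y \<bullet> x) * laplacian f x + 2 * dir_deriv y f x"
proof -
  have "laplacian (\<lambda>x. of_real (y \<bullet> x)) x = 0"
    by (simp add: laplacian_def partial_deriv_inner partial_deriv_const)
  then show ?thesis
    by (simp add: laplacian_mult[OF hom_poly_inner hom_f] partial_deriv_inner dir_deriv_def)
qed

lemma laplacian_inner_self_mult:
  fixes f :: "real^'n \<Rightarrow> complex"
  assumes hom_f: "hom_poly j f"
  shows "laplacian (\<lambda>x. of_real (x \<bullet> x) * f x) x =
    of_real (x \<bullet> x) * laplacian f x + (4 * of_nat j + 2 * of_nat CARD('n)) * f x"
proof -
  have "partial_deriv i (\<lambda>x. complex_of_real (2 * x $ i)) = (\<lambda>x. of_real 2)" for i :: 'n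
    by (intro has_partial_deriv_imp_eq has_partial_deriv_of_real) (auto intro!: derivative_eq_intros)
  then have "laplacian (\<lambda>x. of_real (x \<bullet> x)) x = 2 * of_nat CARD('n)" for x :: "real^'n"
    by (simp add: laplacian_def partial_deriv_inner_self)
  moreover have "(\<Sum>i\<in>UNIV. partial_deriv i (\<lambda>x. of_real (x \<bullet> x)) x * partial_deriv i f x) =
      2 * dir_deriv x f x"
    by (simp add: partial_deriv_inner_self dir_deriv_def sum_distrib_left ac_simps)
  ultimately show ?thesis
    unfolding laplacian_mult[OF hom_poly_inner_self hom_f]
    by (simp add: Euler_hom_poly[OF hom_f] algebra_simps)
qed

lemma laplacian_partial_deriv:
  assumes "hom_poly j f"
  shows "laplacian (partial_deriv i f) x = partial_deriv i (laplacian f) x"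
proof -
  have "partial_deriv i (laplacian f) x =
      (\<Sum>l\<in>UNIV. partial_deriv i (partial_deriv l (partial_deriv l f)) x)"
    unfolding laplacian_def[abs_def]
    by (subst partial_deriv_sum[OF hom_poly_partial_deriv[OF hom_poly_partial_deriv[OF assms]]]) simp
  also have "\<dots> = laplacian (partial_deriv i f) x"
    unfolding laplacian_def
    by (intro sum.cong refl) (metis partial_deriv_commute assms hom_poly_partial_deriv)
  finally show ?thesis by simp
qed

section \<open>Spherical harmonics\<close>

lemma
  assumes "f \<in> sph_harm j"
  shows sph_harm_hom_poly: "hom_poly j f" and sph_harm_laplacian: "laplacian f x = 0"
  using assms by (auto simp: sph_harm_def harmonic_def)

lemma sph_harmI: "hom_poly j f \<Longrightarrow> (\<And>x. laplacian f x = 0) \<Longrightarrow> f \<in> sph_harm j"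
  by (simp add: sph_harm_def harmonic_def)

lemma sph_harm_const: "(\<lambda>x. c) \<in> sph_harm 0"
  by (intro sph_harmI hom_poly_const) (simp add: laplacian_def partial_deriv_const)

lemma sph_harm_inner: "(\<lambda>x. of_real (y \<bullet> x)) \<in> sph_harm 1"
  by (intro sph_harmI hom_poly_inner) (simp add: laplacian_def partial_deriv_inner partial_deriv_const)

lemma sph_harm_zero: "(\<lambda>x. 0) \<in> sph_harm j"
  by (intro sph_harmI hom_poly_zero) (simp add: laplacian_def partial_deriv_const)

lemma sph_harm_add:
  assumes "f \<in> sph_harm j" "g \<in> sph_harm j"
  shows "(\<lambda>x. f x + g x) \<in> sph_harm j"
  using assms
  by (intro sph_harmI hom_poly_add)
    (simp_all add: sph_harm_hom_poly laplacian_add[OF sph_harm_hom_poly sph_harm_hom_poly]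
        sph_harm_laplacian)

lemma sph_harm_cmult: "f \<in> sph_harm j \<Longrightarrow> (\<lambda>x. c * f x) \<in> sph_harm j"
  by (intro sph_harmI hom_poly_cmult)
    (simp_all add: sph_harm_hom_poly laplacian_cmult[OF sph_harm_hom_poly] sph_harm_laplacian)

lemma sph_harm_sum: "(\<And>i. i \<in> I \<Longrightarrow> f i \<in> sph_harm j) \<Longrightarrow> (\<lambda>x. \<Sum>i\<in>I. f i x) \<in> sph_harm j"
  by (induction I rule: infinite_finite_induct) (auto intro: sph_harm_zero sph_harm_add)

lemma sph_harm_diff: "f \<in> sph_harm j \<Longrightarrow> g \<in> sph_harm j \<Longrightarrow> (\<lambda>x. f x - g x) \<in> sph_harm j"
  using sph_harm_add[of f j "\<lambda>x. -1 * g x"] sph_harm_cmult[of g j "-1"] by simp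

lemma sph_harm_dir_deriv:
  assumes harm_f: "f \<in> sph_harm j"
  shows "dir_deriv y f \<in> sph_harm (j - 1)"
proof -
  have "partial_deriv i f \<in> sph_harm (j - 1)" for i
  proof (rule sph_harmI)
    show "hom_poly (j - 1) (partial_deriv i f)"
      using harm_f by (intro hom_poly_partial_deriv sph_harm_hom_poly)
    have "laplacian f = (\<lambda>x. 0)" using harm_f by (simp add: sph_harm_laplacian fun_eq_iff)
    then show "laplacian (partial_deriv i f) x = 0" for x
      using harm_f by (simp add: laplacian_partial_deriv[OF sph_harm_hom_poly] partial_deriv_const)
  qed
  then show ?thesis unfolding dir_deriv_def[abs_def] by (intro sph_harm_sum sph_harm_cmult)
qed

section \<open>The standard Gaussian measure\<close>

lemma borel_measurable_vec_lambda:
  fixes f :: "'n::finite \<Rightarrow> 'a \<Rightarrow> real"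
  assumes "\<And>i. f i \<in> borel_measurable M"
  shows "(\<lambda>x. \<chi> i. f i x) \<in> borel_measurable M"
  using assms by (subst borel_measurable_euclidean_space) (auto simp: Basis_vec_def inner_axis)

lemma lborel_vec_eq_distr:
  "(lborel :: (real^'n) measure) = distr (\<Pi>\<^sub>M i\<in>UNIV. lborel) borel (\<lambda>g. \<chi> i. g i)"
proof (rule lborel_eqI)
  interpret product_sigma_finite "\<lambda>_::'n. lborel :: real measure" ..
  let ?T = "\<lambda>g. (\<chi> i. g i) :: real^'n"
  have measurable_T: "?T \<in> (\<Pi>\<^sub>M i\<in>UNIV. lborel) \<rightarrow>\<^sub>M borel"
    by (intro borel_measurable_vec_lambda) measurable
  have inj_axis: "inj (\<lambda>i::'n. axis i (1::real))" by (auto simp: inj_def axis_eq_axis)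
  have Basis: "(Basis :: (real^'n) set) = range (\<lambda>i. axis i 1)" by (auto simp: Basis_vec_def)
  fix l u :: "real^'n" assume "\<And>b. b \<in> Basis \<Longrightarrow> l \<bullet> b \<le> u \<bullet> b"
  from this[of "axis _ 1"] have l_le_u: "l $ i \<le> u $ i" for i by (simp add: inner_axis)
  have "?T -` box l u \<inter> space (\<Pi>\<^sub>M i\<in>UNIV. lborel) = (\<Pi>\<^sub>E i\<in>UNIV. {l $ i<..<u $ i})"
    by (auto simp: space_PiM mem_box_cart PiE_iff)
  then have "emeasure (distr (\<Pi>\<^sub>M i\<in>UNIV. lborel) borel ?T) (box l u) =
      (\<Prod>i\<in>UNIV. ennreal (u $ i - l $ i))"
    using l_le_u by (subst emeasure_distr[OF measurable_T]) (simp_all add: emeasure_PiM)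
  also have "\<dots> = ennreal (\<Prod>b\<in>Basis. (u - l) \<bullet> b)"
    unfolding Basis prod.reindex[OF inj_axis] using l_le_u by (simp add: prod_ennreal inner_axis)
  finally show "emeasure (distr (\<Pi>\<^sub>M i\<in>UNIV. lborel) borel ?T) (box l u) =
      ennreal (\<Prod>b\<in>Basis. (u - l) \<bullet> b)" .
qed simp

definition std_gaussian :: "(real^'n) measure" where
  "std_gaussian = density lborel (\<lambda>x. \<Prod>i\<in>UNIV. std_normal_density (x $ i))"

lemma sets_std_gaussian [simp, measurable_cong]: "sets std_gaussian = sets borel"
  by (simp add: std_gaussian_def)

lemma
  fixes f :: "'n::finite \<Rightarrow> real \<Rightarrow> 'b::{real_normed_field, banach, second_countable_topology}"
  assumes integrable_f: "\<And>i. integrable std_normal_distribution (f i)"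
  shows integrable_std_gaussian_prod: "integrable std_gaussian (\<lambda>x::real^'n. \<Prod>i\<in>UNIV. f i (x $ i))"
    and integral_std_gaussian_prod:
      "(LINT x|std_gaussian. (\<Prod>i\<in>UNIV. f i ((x::real^'n) $ i))) =
        (\<Prod>i\<in>UNIV. LINT t|std_normal_distribution. f i t)"
proof -
  interpret product_sigma_finite "\<lambda>_::'n. lborel :: real measure" ..
  let ?\<phi> = std_normal_density and ?T = "\<lambda>g. (\<chi> i. g i) :: real^'n"
  let ?F = "\<lambda>x::real^'n. \<Prod>i\<in>UNIV. f i (x $ i)"
  have [measurable]: "f i \<in> borel_measurable borel" for i
    using borel_measurable_integrable[OF integrable_f] by simp
  have measurable_T: "?T \<in> (\<Pi>\<^sub>M i\<in>UNIV. lborel) \<rightarrow>\<^sub>M borel"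
    by (intro borel_measurable_vec_lambda) measurable
  have density: "(\<Prod>i\<in>UNIV. ?\<phi> (x $ i)) *\<^sub>R ?F x =
      (\<Prod>i\<in>UNIV. ?\<phi> (x $ i) *\<^sub>R f i (x $ i))" for x :: "real^'n"
    by (simp add: scaleR_conv_of_real prod.distrib)
  have integrable: "integrable lborel (\<lambda>t. ?\<phi> t *\<^sub>R f i t)" for i
    using integrable_f[of i] by (subst (asm) integrable_density) auto
  have measurable_integrand: "(\<lambda>x. \<Prod>i\<in>UNIV. ?\<phi> (x $ i) *\<^sub>R f i (x $ i)) \<in>
      borel_measurable (borel :: (real^'n) measure)"
    by measurable
  have "integrable lborel (\<lambda>x::real^'n. \<Prod>i\<in>UNIV. ?\<phi> (x $ i) *\<^sub>R f i (x $ i))"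
    unfolding lborel_vec_eq_distr using product_integrable_prod[OF finite integrable]
    by (subst integrable_distr_eq[OF measurable_T measurable_integrand]) simp
  then show "integrable std_gaussian ?F"
    unfolding std_gaussian_def by (subst integrable_density) (auto simp: density prod_nonneg)
  have "(LINT x|std_gaussian. ?F x) = (LINT x|lborel. (\<Prod>i\<in>UNIV. ?\<phi> (x $ i) *\<^sub>R f i (x $ i)))"
    unfolding std_gaussian_def by (subst integral_density) (auto simp: density prod_nonneg)
  also have "\<dots> = (\<Prod>i\<in>UNIV. LINT t|lborel. ?\<phi> t *\<^sub>R f i t)"
    unfolding lborel_vec_eq_distr using product_integral_prod[OF finite integrable]
    by (subst integral_distr[OF measurable_T measurable_integrand]) simp
  also have "\<dots> = (\<Prod>i\<in>UNIV. LINT t|std_normal_distribution. f i t)"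
    by (simp add: integral_density)
  finally show "(LINT x|std_gaussian. ?F x) = (\<Prod>i\<in>UNIV. LINT t|std_normal_distribution. f i t)" .
qed

lemma prob_space_std_gaussian: "prob_space (std_gaussian :: (real^'n) measure)"
proof
  interpret std_normal: real_distribution std_normal_distribution by (rule real_dist_normal_dist)
  have integrable_one: "integrable std_normal_distribution (\<lambda>_. 1 :: real)" by simp
  have "integrable std_gaussian (\<lambda>_::real^'n. 1 :: real)"
    "(LINT x::real^'n|std_gaussian. 1) =
        (\<Prod>i\<in>(UNIV :: 'n set). LINT t|std_normal_distribution. 1 :: real)"
    using integrable_std_gaussian_prod[OF integrable_one, where 'n='n]
      integral_std_gaussian_prod[OF integrable_one, where 'n='n] by simp_all
  then show "emeasure std_gaussian (space (std_gaussian :: (real^'n) measure)) = 1"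
    using std_normal.prob_space by (simp add: integrable_iff_bounded emeasure_eq_ennreal_measure)
qed

definition normal_moment :: "nat \<Rightarrow> real" where
  "normal_moment m = (LINT t|std_normal_distribution. t ^ m)"

lemma normal_moment_Suc: "normal_moment (Suc m) = m * normal_moment (m - 1)"
proof (cases "even m")
  case True
  then have "m = 0 \<or> normal_moment (m - 1) = 0"
    by (cases m) (auto simp: normal_moment_def integral_std_normal_distribution_moment_odd)
  moreover have "normal_moment (Suc m) = 0"
    unfolding normal_moment_def using True by (intro integral_std_normal_distribution_moment_odd) simp
  ultimately show ?thesis by auto
next
  case False
  then obtain k where m_eq: "m = 2 * k + 1" by (elim oddE)
  have "normal_moment (Suc m) = fact (2 * Suc k) / (2 ^ Suc k * fact (Suc k))"
    using std_normal_distribution_even_moments(1)[of "Suc k"] by (simp add: normal_moment_def m_eq)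
  also have "\<dots> = m * (fact (2 * k) / (2 ^ k * fact k))"
    using m_eq by (simp add: divide_simps)
  also have "\<dots> = m * normal_moment (m - 1)"
    using std_normal_distribution_even_moments(1)[of k] by (simp add: normal_moment_def m_eq)
  finally show ?thesis .
qed

lemma
  fixes k :: "'n::finite \<Rightarrow> nat"
  shows integrable_std_gaussian_monomial: "integrable std_gaussian (monomial k)"
    and integral_std_gaussian_monomial:
      "(LINT x|std_gaussian. monomial k x) = (\<Prod>i\<in>UNIV. normal_moment (k i))"
  unfolding monomial_def[abs_def] normal_moment_def
  by (intro integrable_std_gaussian_prod integral_std_gaussian_prod
      integrable_std_normal_distribution_moment)+

lemma integrable_std_gaussian_hom_poly: "hom_poly j F \<Longrightarrow> integrable std_gaussian F"
  by (induction rule: hom_poly_induct)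
    (auto intro!: integrable_mult_right integrable_of_real integrable_std_gaussian_monomial)

theorem std_gaussian_integration_by_parts:
  assumes "hom_poly j F"
  shows "(LINT x|std_gaussian. of_real (x $ i) * F x) = (LINT x|std_gaussian. partial_deriv i F x)"
  using assms
proof (induction rule: hom_poly_induct)
  case (monomial c k)
  let ?p = "\<Prod>l\<in>UNIV - {i}. normal_moment (k l)"
  have moment: "(LINT x|std_gaussian. c * complex_of_real (monomial k x)) =
      c * of_real (\<Prod>l\<in>UNIV. normal_moment (k l))" for c and k :: "'a \<Rightarrow> nat"
    by (simp add: integral_std_gaussian_monomial)
  have upd: "(\<Prod>l\<in>UNIV. normal_moment ((k(i := m)) l)) = normal_moment m * ?p" for m
    by (subst prod.remove[of _ i]) (auto intro!: prod.cong)
  have "of_real (x $ i) * (c * of_real (monomial k x)) =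
      c * of_real (monomial (k(i := Suc (k i))) x)" for x
    unfolding monomial_upd monomial_remove[of k x i] by simp
  then have "(LINT x|std_gaussian. of_real (x $ i) * (c * of_real (monomial k x))) =
      c * of_real (normal_moment (Suc (k i)) * ?p)"
    by (simp only: moment upd)
  also have "\<dots> = (LINT x|std_gaussian. partial_deriv i (\<lambda>x. c * of_real (monomial k x)) x)"
    unfolding partial_deriv_monomial moment upd by (simp add: normal_moment_Suc)
  finally show ?case .
next
  case (add f g)
  have "integrable std_gaussian (\<lambda>x. of_real (x $ i) * F x)" if "hom_poly j F" for F
    using hom_poly_mult[OF hom_poly_component that] by (rule integrable_std_gaussian_hom_poly)
  moreover have "integrable std_gaussian (partial_deriv i F)" if "hom_poly j F" for F
    by (rule integrable_std_gaussian_hom_poly[OF hom_poly_partial_deriv[OF that]])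
  ultimately show ?case
    using add by (simp add: distrib_left partial_deriv_add[OF add(1,2)])
qed

definition gaussian_radial_density :: "nat \<Rightarrow> real \<Rightarrow> real" where
  "gaussian_radial_density d r = exp (- r\<^sup>2 / 2) / (2 * pi) powr (d / 2)"

lemma std_normal_density_prod:
  "(\<Prod>i\<in>UNIV. std_normal_density (x $ i)) = gaussian_radial_density CARD('n) (norm (x::real^'n))"
proof -
  have "(\<Prod>i\<in>UNIV. std_normal_density (x $ i)) =
      (\<Prod>i\<in>(UNIV::'n set). 1 / sqrt (2 * pi)) * (\<Prod>i\<in>UNIV. exp (- (x $ i)\<^sup>2 / 2))"
    unfolding std_normal_density_def by (simp only: prod.distrib)
  also have "(\<Prod>i\<in>UNIV. exp (- (x $ i)\<^sup>2 / 2)) = exp (\<Sum>i\<in>UNIV. - (x $ i)\<^sup>2 / 2)"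
    by (simp add: exp_sum)
  also have "(\<Sum>i\<in>UNIV. - (x $ i)\<^sup>2 / 2) = - (norm x)\<^sup>2 / 2"
    by (simp add: norm_vec_def L2_set_def sum_nonneg sum_negf sum_divide_distrib)
  also have "(\<Prod>i\<in>(UNIV::'n set). 1 / sqrt (2 * pi)) = 1 / (2 * pi) powr (CARD('n) / 2)"
    by (simp add: powr_half_sqrt[symmetric] power_divide powr_powr flip: powr_realpow)
  finally show ?thesis by (simp add: gaussian_radial_density_def)
qed

lemma
  fixes F :: "real^'n \<Rightarrow> 'b::{banach, second_countable_topology}"
  assumes "F \<in> borel_measurable borel"
  shows integrable_std_gaussian_iff:
      "integrable std_gaussian F \<longleftrightarrow>
          integrable lborel (\<lambda>x. gaussian_radial_density CARD('n) (norm x) *\<^sub>R F x)"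
    and integral_std_gaussian:
      "(LINT x|std_gaussian. F x) = (LINT x|lborel. gaussian_radial_density CARD('n) (norm x) *\<^sub>R F x)"
proof -
  have std_gaussian: "std_gaussian =
      density lborel (\<lambda>x::real^'n. gaussian_radial_density CARD('n) (norm x))"
    unfolding std_gaussian_def std_normal_density_prod ..
  show "integrable std_gaussian F \<longleftrightarrow>
      integrable lborel (\<lambda>x. gaussian_radial_density CARD('n) (norm x) *\<^sub>R F x)"
    "(LINT x|std_gaussian. F x) = (LINT x|lborel. gaussian_radial_density CARD('n) (norm x) *\<^sub>R F x)"
    unfolding std_gaussian using assms
    by (intro integrable_density integral_density; simp add: gaussian_radial_density_def)+
qed

lemma has_bochner_integral_Gamma:
  assumes pos_s: "s > (0::real)"
  shows "has_bochner_integral lborel (\<lambda>t. indicator {0<..} t *\<^sub>R (t powr (s - 1) / exp t)) (Gamma s)"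
proof (rule has_bochner_integral_nn_integral)
  have "indicator {0<..} t *\<^sub>R (t powr (s - 1) / exp t) =
      indicator {0..} t * t powr (s - 1) / exp t" for t :: real
    by (auto simp: indicator_def)
  then show "(\<integral>\<^sup>+t. ennreal (indicator {0<..} t *\<^sub>R (t powr (s - 1) / exp t)) \<partial>lborel) =
      ennreal (Gamma s)"
    unfolding Gamma_conv_nn_integral_real[OF pos_s] by (simp only:)
qed (use Gamma_real_pos[OF pos_s] in auto)

lemma powr_exp_square_substitution:
  assumes pos_t: "t > (0::real)"
  shows "sqrt (2 * t) powr (s - 1) * exp (- (sqrt (2 * t))\<^sup>2 / 2) * (1 / sqrt (2 * t)) =
    2 powr (s / 2 - 1) * (t powr (s / 2 - 1) / exp t)"
proof -
  have root: "sqrt (2 * t) = (2 * t) powr (1 / 2)" using pos_t by (simp add: powr_half_sqrt)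
  have "sqrt (2 * t) powr (s - 1) * (1 / sqrt (2 * t)) = (2 * t) powr (1 / 2 * (s - 1) - 1 / 2)"
    unfolding root powr_powr by (simp only: powr_diff times_divide_eq_right mult_1_right)
  also have "1 / 2 * (s - 1) - 1 / 2 = s / 2 - 1" by (simp add: field_simps)
  finally have powr: "sqrt (2 * t) powr (s - 1) * (1 / sqrt (2 * t)) = (2 * t) powr (s / 2 - 1)" .
  have "sqrt (2 * t) powr (s - 1) * exp (- (sqrt (2 * t))\<^sup>2 / 2) * (1 / sqrt (2 * t)) =
      sqrt (2 * t) powr (s - 1) * (1 / sqrt (2 * t)) * exp (- (sqrt (2 * t))\<^sup>2 / 2)"
    by (simp only: mult_ac)
  also have "\<dots> = 2 powr (s / 2 - 1) * (t powr (s / 2 - 1) / exp t)"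
    unfolding powr using pos_t by (simp add: powr_mult exp_minus field_simps)
  finally show ?thesis .
qed

lemma integral_powr_exp_square:
  assumes pos_s: "s > (0::real)"
  shows "(LBINT r:{0<..}. r powr (s - 1) * exp (- r\<^sup>2 / 2)) = 2 powr (s / 2 - 1) * Gamma (s / 2)"
proof -
  let ?f = "\<lambda>r. r powr (s - 1) * exp (- r\<^sup>2 / 2)" and ?g = "\<lambda>t. sqrt (2 * t)"
    and ?g' = "\<lambda>t. 1 / sqrt (2 * t)"
  let ?h = "\<lambda>t. 2 powr (s / 2 - 1) * (t powr (s / 2 - 1) / exp t)"
  have substituted: "indicator {0<..} t *\<^sub>R (?f (?g t) * ?g' t) = indicator {0<..} t *\<^sub>R ?h t" for t
    by (cases "t > 0")
      (simp_all only: indicator_simps greaterThan_iff scaleR_zero_left not_False_eq_True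
          powr_exp_square_substitution)
  have bochner_h: "has_bochner_integral lborel (\<lambda>t. indicator {0<..} t *\<^sub>R ?h t)
      (2 powr (s / 2 - 1) * Gamma (s / 2))"
    using pos_s has_bochner_integral_mult_right[OF has_bochner_integral_Gamma[of "s / 2"],
        of "2 powr (s / 2 - 1)"]
    by (simp add: mult.left_commute)
  have "(LBINT r=0..\<infinity>. ?f r) = (LBINT t=0..\<infinity>. ?f (?g t) * ?g' t)"
  proof (rule interval_integral_substitution_nonneg(2))
    show "((ereal \<circ> ?g \<circ> real_of_ereal) \<longlongrightarrow> 0) (at_right 0)"
      unfolding zero_ereal_def ereal_tendsto_simps by (auto intro!: tendsto_eq_intros)
    show "((ereal \<circ> ?g \<circ> real_of_ereal) \<longlongrightarrow> \<infinity>) (at_left \<infinity>)"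
      unfolding ereal_tendsto_simps
      by (intro tendsto_PInfty_eq_at_top[THEN iffD2] filterlim_compose[OF sqrt_at_top]
          filterlim_tendsto_pos_mult_at_top[OF tendsto_const]) (auto intro: filterlim_ident)
    show "set_integrable lborel (einterval 0 \<infinity>) (\<lambda>t. ?f (?g t) * ?g' t)"
      using bochner_h unfolding set_integrable_def zero_ereal_def einterval_eq substituted
      by (rule integrable.intros)
    fix t :: real assume "0 < ereal t"
    then have pos_t: "t > 0" by simp
    then show "DERIV ?g t :> ?g' t"
      by (auto intro!: derivative_eq_intros simp: inverse_eq_divide)
    show "isCont ?f (?g t)" "isCont ?g' t" using pos_t by (intro continuous_intros; simp)+
    show "0 \<le> ?f (?g t)" by simp
  next
    show "0 \<le> ?g' t" if "0 \<le> ereal t" for t using that by simp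
  qed simp
  also have "\<dots> = (LBINT t:{0<..}. ?h t)"
    unfolding interval_lebesgue_integral_0_infty set_lebesgue_integral_def substituted ..
  also have "\<dots> = 2 powr (s / 2 - 1) * Gamma (s / 2)"
    using bochner_h by (simp add: set_lebesgue_integral_def has_bochner_integral_integral_eq)
  finally show ?thesis by (simp add: interval_lebesgue_integral_0_infty)
qed

definition gaussian_radial_moment :: "nat \<Rightarrow> real \<Rightarrow> real" where
  "gaussian_radial_moment d \<beta> = 2 powr (\<beta> / 2 - 1) * Gamma ((d + \<beta>) / 2) / pi powr (d / 2)"

lemma gaussian_radial_moment_pos: "\<beta> \<ge> 0 \<Longrightarrow> d > 0 \<Longrightarrow> gaussian_radial_moment d \<beta> > 0"
  by (simp add: gaussian_radial_moment_def Gamma_real_pos)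

lemma gaussian_radial_moment_add_2:
  assumes "\<beta> \<ge> 0" "d > 0"
  shows "gaussian_radial_moment d (\<beta> + 2) = (d + \<beta>) * gaussian_radial_moment d \<beta>"
proof -
  have "(d + (\<beta> + 2)) / 2 = (d + \<beta>) / 2 + 1" by (simp add: field_simps)
  moreover have "Gamma ((d + \<beta>) / 2 + 1) = (d + \<beta>) / 2 * Gamma ((d + \<beta>) / 2)"
    using assms nonpos_Ints_nonpos[of "(d + \<beta>) / 2"] by (intro Gamma_plus1) auto
  moreover have "2 powr ((\<beta> + 2) / 2 - 1) = 2 * 2 powr (\<beta> / 2 - 1)"
    by (simp add: powr_diff add_divide_distrib powr_add)
  ultimately show ?thesis by (simp only: gaussian_radial_moment_def) simp
qed

lemma integral_radial_measure_gaussian: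
  assumes "\<beta> \<ge> 0" and pos: "d > 0"
  shows "(LINT r|radial_measure d. r powr \<beta> * gaussian_radial_density d r) = gaussian_radial_moment d \<beta>"
proof -
  have "indicator {0<..} r * r ^ (d - 1) * (r powr \<beta> * gaussian_radial_density d r) =
      indicator {0<..} r *\<^sub>R (r powr (d + \<beta> - 1) * exp (- r\<^sup>2 / 2)) / (2 * pi) powr (d / 2)" for r :: real
  proof (cases "r > 0")
    case True
    then have "r ^ (d - 1) = r powr (real d - 1)"
      using pos by (simp add: powr_realpow[symmetric] of_nat_diff)
    then have "r ^ (d - 1) * r powr \<beta> = r powr (d + \<beta> - 1)" by (simp add: algebra_simps flip: powr_add)
    then show ?thesis using True by (simp add: gaussian_radial_density_def mult.assoc[symmetric])
  qed simp
  moreover have "(LINT r|radial_measure d. r powr \<beta> * gaussian_radial_density d r) =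
      (LBINT r. indicator {0<..} r * r ^ (d - 1) * (r powr \<beta> * gaussian_radial_density d r))"
    unfolding radial_measure_def gaussian_radial_density_def
    by (subst integral_density) (auto intro!: AE_I2 simp: indicator_def)
  ultimately have "(LINT r|radial_measure d. r powr \<beta> * gaussian_radial_density d r) =
      (LBINT r:{0<..}. r powr (d + \<beta> - 1) * exp (- r\<^sup>2 / 2)) / (2 * pi) powr (d / 2)"
    by (simp only: set_lebesgue_integral_def integral_divide_zero)
  also have "\<dots> = 2 powr ((d + \<beta>) / 2 - 1) * Gamma ((d + \<beta>) / 2) / (2 powr (d / 2) * pi powr (d / 2))"
    using integral_powr_exp_square[of "d + \<beta>"] assms by (simp add: powr_mult)
  also have "\<dots> = gaussian_radial_moment d \<beta>"
    unfolding gaussian_radial_moment_def by (simp add: add_divide_distrib powr_add powr_diff)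
  finally show ?thesis .
qed

lemma integrable_radial_measure_gaussian:
  assumes "\<beta> \<ge> 0" "d > 0"
  shows "integrable (radial_measure d) (\<lambda>r. r powr \<beta> * gaussian_radial_density d r)"
  using integral_radial_measure_gaussian[OF assms] gaussian_radial_moment_pos[OF assms]
    not_integrable_integral_eq by fastforce

theorem std_gaussian_polar:
  fixes F :: "real^'n \<Rightarrow> 'b::{banach, second_countable_topology}"
  assumes integrable: "integrable std_gaussian F" and nonneg: "\<beta> \<ge> 0"
    and homogeneous: "\<And>x. x \<noteq> 0 \<Longrightarrow> F x = norm x powr \<beta> *\<^sub>R F (direction x)"
  shows "(LINT x|std_gaussian. F x) = gaussian_radial_moment CARD('n) \<beta> *\<^sub>R (LINT v|\<omega>. F v)"
proof -
  let ?w = "\<omega> :: (real^'n) measure" and ?R = "radial_measure CARD('n)"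
    and ?\<rho> = "gaussian_radial_density CARD('n)"
  let ?G = "\<lambda>(r, v). (r powr \<beta> * ?\<rho> r) *\<^sub>R F v"
  interpret radial: sigma_finite_measure ?R by (rule sigma_finite_radial_measure)
  interpret polar: pair_sigma_finite ?R ?w ..
  have measurable_F [measurable]: "F \<in> borel_measurable borel"
    using integrable borel_measurable_integrable by fastforce
  then have [measurable]: "F \<in> borel_measurable ?w"
    by (simp add: measurable_restrict_space1 sets_sphere_measure cong: measurable_cong_sets)
  have [measurable]: "?\<rho> \<in> borel_measurable borel"
    unfolding gaussian_radial_density_def by measurable
  have measurable_polar: "(\<lambda>x. (norm x, direction x)) \<in> lborel \<rightarrow>\<^sub>M borel \<Otimes>\<^sub>M ?w" by measurable
  have measurable_G [measurable]: "?G \<in> borel_measurable (borel \<Otimes>\<^sub>M ?w)" by measurable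
  have G_polar: "AE x in lborel. ?\<rho> (norm x) *\<^sub>R F x = ?G (norm x, direction x)"
    using AE_lborel_singleton[of 0] by eventually_elim (subst homogeneous, simp_all add: mult.commute)
  have "integrable lborel (\<lambda>x. ?G (norm x, direction x))"
    using integrable measurable_polar unfolding integrable_std_gaussian_iff[OF measurable_F]
    by (subst integrable_cong_AE[OF _ _ G_polar, symmetric]) measurable
  then have integrable_G: "integrable (?R \<Otimes>\<^sub>M ?w) ?G"
    unfolding polar_coordinates by (subst integrable_distr_eq[OF measurable_polar measurable_G])
  have "(LINT x|std_gaussian. F x) = (LINT x|lborel. ?G (norm x, direction x))"
    unfolding integral_std_gaussian[OF measurable_F]
    using measurable_polar by (intro integral_cong_AE G_polar) measurable
  also have "\<dots> = (LINT z|(?R \<Otimes>\<^sub>M ?w). ?G z)"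
    unfolding polar_coordinates by (rule integral_distr[OF measurable_polar measurable_G, symmetric])
  also have "\<dots> = (LINT r|?R. LINT v|?w. ?G (r, v))"
    by (rule polar.integral_fst'[OF integrable_G, symmetric])
  also have "\<dots> = (LINT r|?R. (r powr \<beta> * ?\<rho> r) *\<^sub>R (LINT v|?w. F v))"
    by simp
  also have "\<dots> = (LINT r|?R. r powr \<beta> * ?\<rho> r) *\<^sub>R (LINT v|?w. F v)"
    by (intro integral_scaleR_left integrable_radial_measure_gaussian nonneg) simp
  finally show ?thesis by (simp add: integral_radial_measure_gaussian nonneg)
qed

corollary std_gaussian_polar_hom_poly:
  fixes F :: "real^'n \<Rightarrow> complex"
  assumes hom_F: "hom_poly m F"
  shows "(LINT x|std_gaussian. F x) = of_real (gaussian_radial_moment CARD('n) m) * (LINT v|\<omega>. F v)"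
proof -
  have "F x = norm x powr real m *\<^sub>R F (direction x)" if "x \<noteq> 0" for x
  proof -
    have "F x = of_real (norm x ^ m) * F (direction x)"
      using hom_poly_scaleR[OF hom_F, of "norm x" "direction x"] by simp
    then show ?thesis using that by (simp add: powr_realpow scaleR_conv_of_real)
  qed
  from std_gaussian_polar[OF integrable_std_gaussian_hom_poly[OF hom_F] _ this]
  show ?thesis by (simp add: scaleR_conv_of_real)
qed

section \<open>Integration by parts on the sphere\<close>

lemma measure_sphere: "measure (\<omega> :: (real^'n) measure) (sphere 0 1) =
    1 / gaussian_radial_moment CARD('n) 0"
proof -
  interpret prob_space "std_gaussian :: (real^'n) measure" by (rule prob_space_std_gaussian)
  have "gaussian_radial_moment CARD('n) 0 * measure (\<omega> :: (real^'n) measure) (sphere 0 1) = 1"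
    using std_gaussian_polar_hom_poly[OF hom_poly_const, where 'n='n, of 1] prob_space
    by (simp add: scaleR_conv_of_real flip: of_real_mult)
  then show ?thesis by (metis mult_zero_left nonzero_eq_divide_eq mult.commute zero_neq_one)
qed

theorem sphere_integration_by_parts:
  fixes F :: "real^'n \<Rightarrow> complex"
  assumes hom_F: "hom_poly m F"
  shows "(real m + real CARD('n) - 1) * (LINT v|\<omega>. of_real (v $ i) * F v) =
      (LINT v|\<omega>. partial_deriv i F v)"
proof -
  let ?R = "gaussian_radial_moment CARD('n)"
  let ?I = "LINT v|\<omega>. of_real (v $ i) * F v" and ?J = "LINT v|\<omega>. partial_deriv i F v"
  have parts: "?R (1 + m) * ?I = ?R (m - 1) * ?J"
    using std_gaussian_integration_by_parts[OF hom_F, of i]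
    by (simp add: std_gaussian_polar_hom_poly[OF hom_poly_partial_deriv[OF hom_F]]
        std_gaussian_polar_hom_poly[OF hom_poly_mult[OF hom_poly_component hom_F]])
  show ?thesis
  proof (cases m)
    case 0
    have "F x = F 0" for x using hom_poly_scaleR[OF hom_F, of 0 x] 0 by simp
    then have "F = (\<lambda>_. F 0)" by (rule ext)
    then have partial_deriv_0: "partial_deriv i F = (\<lambda>_. 0)" by (metis partial_deriv_const)
    then have "?I = 0"
      using parts gaussian_radial_moment_pos[of 1 "CARD('n)"] 0 by simp
    with partial_deriv_0 show ?thesis by simp
  next
    case (Suc l)
    have "?R (1 + m) = (real m + real CARD('n) - 1) * ?R l"
      using gaussian_radial_moment_add_2[of l "CARD('n)"] by (simp add: Suc algebra_simps)
    then have "of_real (?R l) * ((real m + real CARD('n) - 1) * ?I) = of_real (?R l) * ?J"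
      using parts Suc by (simp add: ac_simps)
    then show ?thesis
      using gaussian_radial_moment_pos[of l "CARD('n)"] by simp
  qed
qed

corollary sphere_integral_dir_deriv:
  fixes F :: "real^'n \<Rightarrow> complex"
  assumes hom_F: "hom_poly m F"
  shows "(LINT v|\<omega>. dir_deriv y F v) = (real m + real CARD('n) - 1) * (LINT v|\<omega>. of_real (y \<bullet> v) * F v)"
proof -
  have integrable: "integrable \<omega> (partial_deriv i F)" "integrable \<omega> (\<lambda>v. of_real (v $ i) * F v)" for i
    by (rule integrable_sphere_hom_poly[OF hom_poly_partial_deriv[OF hom_F]]
        integrable_sphere_hom_poly[OF hom_poly_mult[OF hom_poly_component hom_F]])+
  have "(LINT v|\<omega>. dir_deriv y F v) = (\<Sum>i\<in>UNIV. of_real (y $ i) * (LINT v|\<omega>. partial_deriv i F v))"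
    unfolding dir_deriv_def by (simp add: integrable)
  also have "\<dots> = (real m + real CARD('n) - 1) *
      (\<Sum>i\<in>UNIV. of_real (y $ i) * (LINT v|\<omega>. of_real (v $ i) * F v))"
    unfolding sphere_integration_by_parts[OF hom_F, symmetric] by (simp add: sum_distrib_left ac_simps)
  also have "(\<Sum>i\<in>UNIV. of_real (y $ i) * (LINT v|\<omega>. of_real (v $ i) * F v)) =
      (LINT v|\<omega>. (\<Sum>i\<in>UNIV. of_real (y $ i) * (of_real (v $ i) * F v)))"
    by (simp add: integrable)
  finally show ?thesis by (simp add: inner_vec_def sum_distrib_right mult.assoc)
qed

section \<open>The coefficients $w_j(\alpha)$\<close>

lemma not_nonpos_Ints_if_pos: "x > 0 \<Longrightarrow> x \<notin> \<int>\<^sub>\<le>\<^sub>0" for x :: real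
  using nonpos_Ints_nonpos[of x] by auto

lemma w_coef_add_1:
  assumes "\<alpha> > - 1"
  shows "w_coef d j (\<alpha> + 1) = pi powr (real d / 2) * Gamma (\<alpha> + 1) / 2 powr (\<alpha> - 1) * ((\<alpha> + 1) / 2)
    * rGamma ((real j + \<alpha> + 1 + real d) / 2) * rGamma ((\<alpha> + 1 - real j) / 2 + 1)"
proof -
  have "Gamma (\<alpha> + 1 + 1) = (\<alpha> + 1) * Gamma (\<alpha> + 1)"
    using assms by (intro Gamma_plus1 not_nonpos_Ints_if_pos) simp
  moreover have "2 powr (\<alpha> + 1 - 1) = 2 * 2 powr (\<alpha> - 1)" by (simp add: powr_diff)
  ultimately show ?thesis by (simp add: w_coef_def ac_simps)
qed

lemma w_coef_diff_1:
  assumes nonneg: "\<alpha> \<ge> 0" and odd: "\<alpha> = 0 \<Longrightarrow> odd j"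
  shows "\<alpha> * w_coef d j (\<alpha> - 1) = pi powr (real d / 2) * Gamma (\<alpha> + 1) / 2 powr (\<alpha> - 1) * 2
    * rGamma ((real j + (\<alpha> - 1) + real d) / 2) * rGamma ((\<alpha> - 1 - real j) / 2 + 1)"
proof (cases "\<alpha> = 0")
  case True
  then obtain l where "j = 2 * l + 1" using odd by (blast elim: oddE)
  then have "(\<alpha> - 1 - real j) / 2 + 1 = - real l" using True by (simp add: field_simps)
  then have "rGamma ((\<alpha> - 1 - real j) / 2 + 1) = 0" by (simp only: rGamma_eq_zero_iff) simp
  then show ?thesis using True by simp
next
  case False
  then have "Gamma (\<alpha> + 1) = \<alpha> * Gamma \<alpha>"
    using nonneg by (intro Gamma_plus1 not_nonpos_Ints_if_pos) simp
  moreover have "2 powr (\<alpha> - 1) = 2 * 2 powr (\<alpha> - 1 - 1)" by (simp add: powr_diff)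
  ultimately show ?thesis by (simp add: w_coef_def)
qed

lemma w_coef_three_term:
  assumes "\<alpha> > - 1"
  shows "(2 * real j + real d) * w_coef d (Suc j) (\<alpha> + 1) =
    (real j + real d - 1) * w_coef d (Suc (Suc j)) \<alpha> + (real j + 1) * w_coef d j \<alpha>"
proof -
  define A B where "A = (real j + \<alpha> + real d) / 2" and "B = (\<alpha> - real j) / 2"
  define C where
    "C = pi powr (real d / 2) * Gamma (\<alpha> + 1) / 2 powr (\<alpha> - 1) * rGamma (A + 1) * rGamma (B + 1)"
  have args: "(real (Suc (Suc j)) + \<alpha> + real d) / 2 = A + 1" "(\<alpha> - real (Suc (Suc j))) / 2 + 1 = B"
    "(real (Suc j) + \<alpha> + 1 + real d) / 2 = A + 1" "(\<alpha> + 1 - real (Suc j)) / 2 + 1 = B + 1"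
    by (simp_all add: A_def B_def field_simps)
  have rGamma: "rGamma A = A * rGamma (A + 1)" "rGamma B = B * rGamma (B + 1)"
    by (simp_all add: rGamma_plus1)
  have "w_coef d (Suc j) (\<alpha> + 1) = (\<alpha> + 1) / 2 * C"
    unfolding w_coef_add_1[OF assms] args by (simp add: C_def ac_simps)
  moreover have "w_coef d (Suc (Suc j)) \<alpha> = B * C"
    unfolding w_coef_def args by (simp add: C_def rGamma ac_simps)
  moreover have "w_coef d j \<alpha> = A * C"
    unfolding w_coef_def A_def[symmetric] B_def[symmetric] by (simp add: C_def rGamma ac_simps)
  moreover have "(2 * real j + real d) * ((\<alpha> + 1) / 2) = (real j + real d - 1) * B + (real j + 1) * A"
    by (simp add: A_def B_def field_simps)
  ultimately show ?thesis by (metis (no_types, lifting) mult.assoc distrib_right)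
qed

lemma w_coef_moment_recursion:
  assumes nonneg: "\<alpha> \<ge> 0" and odd: "\<alpha> = 0 \<Longrightarrow> odd j"
  shows "(\<alpha> + real j + real d - 1) * w_coef d j (\<alpha> + 1) =
    real j * w_coef d (j - 1) \<alpha> + \<alpha> * w_coef d j (\<alpha> - 1)"
proof -
  define A B where "A = (\<alpha> + real j + real d - 1) / 2" and "B = (\<alpha> + 1 - real j) / 2"
  define C where "C = pi powr (real d / 2) * Gamma (\<alpha> + 1) / 2 powr (\<alpha> - 1)"
  have args: "(real j + \<alpha> + 1 + real d) / 2 = A + 1" "(\<alpha> + 1 - real j) / 2 + 1 = B + 1"
    "(real j + (\<alpha> - 1) + real d) / 2 = A" "(\<alpha> - 1 - real j) / 2 + 1 = B"
    by (simp_all add: A_def B_def field_simps)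
  have rGamma: "rGamma A = A * rGamma (A + 1)" "rGamma B = B * rGamma (B + 1)"
    by (simp_all add: rGamma_plus1)
  have AB: "\<alpha> + real j + real d - 1 = 2 * A" "\<alpha> + 1 = real j + 2 * B"
    by (simp_all add: A_def B_def field_simps)
  have raise_power: "w_coef d j (\<alpha> + 1) = C * ((\<alpha> + 1) / 2) * rGamma (A + 1) * rGamma (B + 1)"
    using nonneg by (simp add: w_coef_add_1 args C_def)
  have lower_degree: "real j * w_coef d (j - 1) \<alpha> = real j * (C * rGamma A * rGamma (B + 1))"
  proof (cases j)
    case (Suc i)
    then have "(real (j - 1) + \<alpha> + real d) / 2 = A" "(\<alpha> - real (j - 1)) / 2 + 1 = B + 1"
      by (simp_all add: A_def B_def field_simps)
    then show ?thesis by (simp only: w_coef_def C_def) simp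
  qed simp
  have lower_power: "\<alpha> * w_coef d j (\<alpha> - 1) = 2 * C * rGamma A * rGamma B"
    using w_coef_diff_1[OF nonneg odd, of d] unfolding args by (simp add: C_def)
  show ?thesis
    unfolding raise_power lower_degree lower_power unfolding AB rGamma by (simp add: algebra_simps)
qed

lemma w_coef_eq_0:
  assumes "m < j" "even (m + j)"
  shows "w_coef d j (real m) = 0"
proof -
  have "\<exists>k. j = m + 2 * Suc k" using assms by presburger
  then obtain k where "j = m + 2 * Suc k" by blast
  then have "(real m - real j) / 2 + 1 = - real k" by (simp add: field_simps)
  then have "rGamma ((real m - real j) / 2 + 1) = 0" by (simp only: rGamma_eq_zero_iff) simp
  then show ?thesis by (simp add: w_coef_def)
qed

lemma w_coef_diag_pos: "d > 0 \<Longrightarrow> w_coef d j (real j) > 0"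
  unfolding w_coef_def rGamma_inverse_Gamma
  by (intro divide_pos_pos mult_pos_pos) (auto intro!: Gamma_real_pos)

lemma w_coef_0_0: "w_coef d 0 0 = 1 / gaussian_radial_moment d 0"
  by (simp add: w_coef_def gaussian_radial_moment_def rGamma_inverse_Gamma inverse_eq_divide powr_minus)

section \<open>Moments of spherical harmonics\<close>

lemma sphere_mean_sph_harm:
  fixes h :: "real^'n \<Rightarrow> complex"
  assumes dim: "CARD('n) \<ge> 2" and harm_h: "h \<in> sph_harm j" and pos_j: "j > 0"
  shows "(LINT v|\<omega>. h v) = 0"
proof -
  note hom_partial = hom_poly_partial_deriv[OF sph_harm_hom_poly[OF harm_h]]
  have integrable: "integrable \<omega> (\<lambda>v. of_real (v $ i) * partial_deriv i h v)"
    "integrable \<omega> (partial_deriv i (partial_deriv i h))" for i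
    by (rule integrable_sphere_hom_poly[OF hom_poly_mult[OF hom_poly_component hom_partial]]
        integrable_sphere_hom_poly[OF hom_poly_partial_deriv[OF hom_partial]])+
  let ?c = "complex_of_real (real (j - 1) + real CARD('n) - 1)"
  have "?c * (of_nat j * (LINT v|\<omega>. h v)) = ?c * (LINT v|\<omega>. dir_deriv v h v)"
    by (simp add: Euler_hom_poly[OF sph_harm_hom_poly[OF harm_h]])
  also have "\<dots> = (\<Sum>i\<in>UNIV. ?c * (LINT v|\<omega>. of_real (v $ i) * partial_deriv i h v))"
    unfolding dir_deriv_def by (simp add: integrable sum_distrib_left)
  also have "\<dots> = (\<Sum>i\<in>UNIV. LINT v|\<omega>. partial_deriv i (partial_deriv i h) v)"
    by (simp only: sphere_integration_by_parts[OF hom_partial])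
  also have "\<dots> = (LINT v|\<omega>. laplacian h v)"
    unfolding laplacian_def by (simp add: integrable)
  also have "\<dots> = 0" by (simp add: sph_harm_laplacian[OF harm_h])
  finally have "?c * (of_nat j * (LINT v|\<omega>. h v)) = 0" .
  moreover have "?c \<noteq> 0" unfolding of_real_eq_0_iff using dim pos_j by simp
  ultimately show ?thesis using pos_j by simp
qed

definition sphere_moment :: "nat \<Rightarrow> nat \<Rightarrow> nat \<Rightarrow> real" where
  "sphere_moment d m j = (if even (m + j) then w_coef d j (real m) else 0)"

lemma sphere_moment_Suc:
  "(real (j + m) + real d - 1) * sphere_moment d (Suc m) j =
    real j * sphere_moment d m (j - 1) + real m * sphere_moment d (m - 1) j"
proof (cases "even (Suc m + j)")
  case True
  then have "real j * sphere_moment d m (j - 1) = real j * w_coef d (j - 1) (real m)"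
    by (cases j) (simp_all add: sphere_moment_def)
  moreover have "real m * sphere_moment d (m - 1) j = real m * w_coef d j (real m - 1)"
    using True by (cases m) (simp_all add: sphere_moment_def)
  ultimately show ?thesis
    using w_coef_moment_recursion[of "real m" j d] True by (auto simp: sphere_moment_def ac_simps)
next
  case False
  then show ?thesis by (cases j; cases m) (auto simp: sphere_moment_def)
qed

lemma sphere_moment_eq_0: "m < j \<Longrightarrow> sphere_moment d m j = 0"
  by (simp add: sphere_moment_def w_coef_eq_0)

lemma sphere_moment_0_sph_harm:
  fixes h :: "real^'n \<Rightarrow> complex"
  assumes dim: "CARD('n) \<ge> 2" and harm_h: "h \<in> sph_harm j"
  shows "(LINT v|\<omega>. h v) = of_real (sphere_moment CARD('n) 0 j) * h u"
proof (cases "j = 0")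
  case True
  note scaleR_0 = hom_poly_scaleR[OF sph_harm_hom_poly[OF harm_h], of 0]
  have "h v = h u" for v using scaleR_0[of v] scaleR_0[of u] True by simp
  then have "(LINT v|\<omega>. h v) = (LINT v|(\<omega> :: (real^'n) measure). h u)"
    by (intro Bochner_Integration.integral_cong refl)
  then show ?thesis
    using True by (simp add: sphere_moment_def measure_sphere w_coef_0_0 scaleR_conv_of_real)
next
  case False
  then show ?thesis using sphere_mean_sph_harm[OF dim harm_h] by (simp add: sphere_moment_eq_0)
qed

lemma sphere_integral_inner_power_Suc:
  fixes h :: "real^'n \<Rightarrow> complex"
  assumes unit: "norm u = 1" and hom_h: "hom_poly j h"
  shows "of_real (real (j + k) + real CARD('n) - 1) * (LINT v|\<omega>. h v * of_real ((u \<bullet> v) ^ Suc k)) =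
    (LINT v|\<omega>. dir_deriv u h v * of_real ((u \<bullet> v) ^ k)) +
    of_nat k * (LINT v|\<omega>. h v * of_real ((u \<bullet> v) ^ (k - 1)))"
proof -
  let ?F = "\<lambda>x. h x * of_real ((u \<bullet> x) ^ k)"
  have hom_F: "hom_poly (j + k) ?F" by (intro hom_poly_mult hom_h hom_poly_inner_power)
  have "dir_deriv u ?F = (\<lambda>v. dir_deriv u h v * of_real ((u \<bullet> v) ^ k) +
      of_nat k * (h v * of_real ((u \<bullet> v) ^ (k - 1))))"
    by (simp add: fun_eq_iff dir_deriv_mult[OF hom_h hom_poly_inner_power] dir_deriv_inner_power
        dot_square_norm unit
        del: of_real_power)
  moreover have "integrable \<omega> (\<lambda>v. dir_deriv u h v * of_real ((u \<bullet> v) ^ k))"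
    "integrable \<omega> (\<lambda>v. h v * of_real ((u \<bullet> v) ^ (k - 1)))"
    by (rule
        integrable_sphere_hom_poly[OF hom_poly_mult[OF hom_poly_dir_deriv[OF hom_h] hom_poly_inner_power]]
        integrable_sphere_hom_poly[OF hom_poly_mult[OF hom_h hom_poly_inner_power]])+
  ultimately show ?thesis using sphere_integral_dir_deriv[OF hom_F, of u] by (simp add: mult_ac)
qed

theorem sphere_moment_sph_harm:
  fixes h :: "real^'n \<Rightarrow> complex"
  assumes dim: "CARD('n) \<ge> 2" and unit: "norm u = 1" and harm_h: "h \<in> sph_harm j"
  shows "(LINT v|\<omega>. h v * of_real ((u \<bullet> v) ^ m)) = of_real (sphere_moment CARD('n) m j) * h u"
  using harm_h
proof (induction m arbitrary: j h rule: less_induct)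
  case (less m)
  note hom_h = sph_harm_hom_poly[OF less.prems]
  show ?case
  proof (cases m)
    case 0
    then show ?thesis using sphere_moment_0_sph_harm[OF dim less.prems] by simp
  next
    case (Suc k)
    let ?c = "complex_of_real (real (j + k) + real CARD('n) - 1)"
    have "?c * (LINT v|\<omega>. h v * of_real ((u \<bullet> v) ^ m)) =
        of_real (sphere_moment CARD('n) k (j - 1)) * dir_deriv u h u +
        of_nat k * (of_real (sphere_moment CARD('n) (k - 1) j) * h u)"
      unfolding Suc sphere_integral_inner_power_Suc[OF unit hom_h]
      using less.IH[OF _ sph_harm_dir_deriv[OF less.prems], of k u]
        less.IH[OF _ less.prems, of "k - 1"] Suc
      by (cases "k = 0") simp_all
    also have "\<dots> = of_real (real j * sphere_moment CARD('n) k (j - 1) +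
        real k * sphere_moment CARD('n) (k - 1) j) * h u"
      by (simp add: Euler_hom_poly[OF hom_h] algebra_simps)
    also have "\<dots> = ?c * (of_real (sphere_moment CARD('n) m j) * h u)"
      unfolding sphere_moment_Suc[symmetric] by (simp add: Suc)
    finally have "?c * (LINT v|\<omega>. h v * of_real ((u \<bullet> v) ^ m)) =
        ?c * (of_real (sphere_moment CARD('n) m j) * h u)" .
    moreover have "?c \<noteq> 0" unfolding of_real_eq_0_iff using dim by simp
    ultimately show ?thesis by simp
  qed
qed

lemma sphere_poly_sph_harm:
  fixes h :: "real^'n \<Rightarrow> complex"
  assumes dim: "CARD('n) \<ge> 2" and unit: "norm u = 1" and harm_h: "h \<in> sph_harm j"
    and degree_p: "degree p \<le> j"
  shows "(LINT v|\<omega>. h v * of_real (poly p (u \<bullet> v))) =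
      of_real (coeff p j * w_coef CARD('n) j (real j)) * h u"
proof -
  have integrable: "integrable \<omega> (\<lambda>v. h v * of_real ((u \<bullet> v) ^ i))" for i
    by (rule
        integrable_sphere_hom_poly[OF hom_poly_mult[OF sph_harm_hom_poly[OF harm_h] hom_poly_inner_power]])
  have "poly p t = (\<Sum>i\<le>j. coeff p i * t ^ i)" for t
    using poly_as_sum_of_monoms'[OF degree_p]
    by (metis (no_types, lifting) poly_monom poly_sum sum.cong)
  then have "(LINT v|\<omega>. h v * of_real (poly p (u \<bullet> v))) =
      (LINT v|\<omega>. (\<Sum>i\<le>j. of_real (coeff p i) * (h v * of_real ((u \<bullet> v) ^ i))))"
    by (simp add: sum_distrib_left ac_simps)
  also have "\<dots> = (\<Sum>i\<le>j. of_real (coeff p i) * (of_real (sphere_moment CARD('n) i j) * h u))"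
    using integrable by (simp only: sphere_moment_sph_harm[OF dim unit harm_h, symmetric]) simp
  also have "\<dots> = (\<Sum>i\<in>{j}. of_real (coeff p i) * (of_real (sphere_moment CARD('n) i j) * h u))"
    by (rule sum.mono_neutral_right) (auto simp: sphere_moment_eq_0)
  finally show ?thesis by (simp add: sphere_moment_def)
qed

section \<open>Legendre polynomials and zonal harmonics\<close>

text \<open>The Legendre polynomials in dimension \<open>d\<close>: the Gegenbauer polynomials with parameter \<open>d/2 - 1\<close>,
  normalised to take the value \<open>1\<close> at \<open>1\<close>.\<close>

definition legendre_a :: "nat \<Rightarrow> nat \<Rightarrow> real" where
  "legendre_a d j = (2 * real j + real d) / (real j + real d - 1)"

definition legendre_b :: "nat \<Rightarrow> nat \<Rightarrow> real" where
  "legendre_b d j = (real j + 1) / (real j + real d - 1)"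

fun legendre_poly :: "nat \<Rightarrow> nat \<Rightarrow> real poly" where
  "legendre_poly d 0 = 1"
| "legendre_poly d (Suc 0) = [:0, 1:]"
| "legendre_poly d (Suc (Suc j)) =
    smult (legendre_a d j) (pCons 0 (legendre_poly d (Suc j))) -
    smult (legendre_b d j) (legendre_poly d j)"

lemma legendre_b_mult: "d \<ge> 2 \<Longrightarrow> (real j + real d - 1) * legendre_b d j = real j + 1"
  by (simp add: legendre_b_def)

lemma legendre_a_eq: "d \<ge> 2 \<Longrightarrow> legendre_a d j = legendre_b d j + 1"
  unfolding legendre_a_def legendre_b_def by (simp add: divide_add_eq_iff)

lemma poly_legendre_1: "d \<ge> 2 \<Longrightarrow> poly (legendre_poly d j) 1 = 1"
  by (induction d j rule: legendre_poly.induct) (auto simp: legendre_a_eq)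

lemma poly_legendre_minus: "poly (legendre_poly d j) (- t) = (- 1) ^ j * poly (legendre_poly d j) t"
  by (induction d j rule: legendre_poly.induct) (simp_all add: algebra_simps)

lemma degree_legendre_poly_le: "degree (legendre_poly d j) \<le> j"
proof (induction d j rule: legendre_poly.induct)
  case (3 d j)
  then show ?case
    by (auto intro!: order_trans[OF degree_smult_le] degree_diff_le degree_pCons_le[THEN order_trans])
qed simp_all

lemma coeff_legendre_poly_pos: "d \<ge> 2 \<Longrightarrow> coeff (legendre_poly d j) j > 0"
proof (induction d j rule: legendre_poly.induct)
  case (3 d j)
  have "coeff (legendre_poly d j) (Suc (Suc j)) = 0"
    using degree_legendre_poly_le[of d j] by (intro coeff_eq_0) simp
  with 3 show ?case by (simp add: legendre_a_def)
qed simp_all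

abbreviation legendre_kernel :: "nat \<Rightarrow> real^'n \<Rightarrow> real^'n \<Rightarrow> real" where
  "legendre_kernel j u v \<equiv> poly (legendre_poly CARD('n) j) (u \<bullet> v)"

text \<open>The homogenisation of \<open>legendre_poly\<close>, a polynomial in both arguments.\<close>

fun zonal :: "nat \<Rightarrow> real^'n \<Rightarrow> real^'n \<Rightarrow> complex" where
  "zonal 0 y x = 1"
| "zonal (Suc 0) y x = of_real (y \<bullet> x)"
| "zonal (Suc (Suc j)) y x =
    of_real (legendre_a CARD('n) j) * (of_real (y \<bullet> x) * zonal (Suc j) y x) +
    of_real (- legendre_b CARD('n) j * (y \<bullet> y)) * (of_real (x \<bullet> x) * zonal j y x)"

lemma zonal_sphere:
  "norm x = 1 \<Longrightarrow> norm y = 1 \<Longrightarrow> zonal j y x =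
      of_real (poly (legendre_poly CARD('n) j) (y \<bullet> (x :: real^'n)))"
  by (induction j y x rule: zonal.induct) (simp_all add: dot_square_norm)

lemma
  fixes y :: "real^'n"
  shows zonal_0_eq: "zonal 0 y = (\<lambda>x. 1)"
    and zonal_1_eq: "zonal (Suc 0) y = (\<lambda>x. of_real (y \<bullet> x))"
    and zonal_Suc_Suc_eq: "zonal (Suc (Suc j)) y = (\<lambda>x.
      of_real (legendre_a CARD('n) j) * (of_real (y \<bullet> x) * zonal (Suc j) y x) +
      of_real (- legendre_b CARD('n) j * (y \<bullet> y)) * (of_real (x \<bullet> x) * zonal j y x))"
  by (simp_all add: fun_eq_iff)

lemma hom_poly_zonal: "hom_poly j (zonal j y)"
proof (induction j rule: induct_nat_012)
  case (ge2 j)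
  have "hom_poly (Suc (Suc j)) (\<lambda>x. of_real (y \<bullet> x) * zonal (Suc j) y x)"
    "hom_poly (Suc (Suc j)) (\<lambda>x. of_real (x \<bullet> x) * zonal j y x)"
    using hom_poly_mult[OF hom_poly_inner[of y] ge2(2)]
      hom_poly_mult[OF hom_poly_inner_self ge2(1)] by simp_all
  then show ?case unfolding zonal_Suc_Suc_eq by (intro hom_poly_add hom_poly_cmult)
qed (use hom_poly_const hom_poly_inner in \<open>auto simp: zonal_0_eq zonal_1_eq\<close>)

lemma
  fixes y :: "real^'n"
  defines "a \<equiv> \<lambda>j. complex_of_real (legendre_a CARD('n) j)"
    and "b \<equiv> \<lambda>j. complex_of_real (- legendre_b CARD('n) j * (y \<bullet> y))"
  shows dir_deriv_zonal_Suc_Suc: "dir_deriv z (zonal (Suc (Suc j)) y) x =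
      a j * (of_real (z \<bullet> y) * zonal (Suc j) y x + of_real (y \<bullet> x) * dir_deriv z (zonal (Suc j) y) x) +
      b j * (2 * of_real (z \<bullet> x) * zonal j y x + of_real (x \<bullet> x) * dir_deriv z (zonal j y) x)"
    and laplacian_zonal_Suc_Suc: "laplacian (zonal (Suc (Suc j)) y) x =
      a j * (of_real (y \<bullet> x) * laplacian (zonal (Suc j) y) x + 2 * dir_deriv y (zonal (Suc j) y) x) +
      b j * (of_real (x \<bullet> x) * laplacian (zonal j y) x + (4 * of_nat j + 2 * of_nat CARD('n)) *
          zonal j y x)"
proof -
  note inner = hom_poly_mult[OF hom_poly_inner[of y] hom_poly_zonal[of "Suc j" y]]
    and inner_self = hom_poly_mult[OF hom_poly_inner_self hom_poly_zonal[of j y]]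
  have degree_eq: "1 + Suc j = 2 + j" by simp
  show "dir_deriv z (zonal (Suc (Suc j)) y) x =
      a j * (of_real (z \<bullet> y) * zonal (Suc j) y x + of_real (y \<bullet> x) * dir_deriv z (zonal (Suc j) y) x) +
      b j * (2 * of_real (z \<bullet> x) * zonal j y x + of_real (x \<bullet> x) * dir_deriv z (zonal j y) x)"
    unfolding a_def b_def zonal_Suc_Suc_eq
      dir_deriv_add[OF hom_poly_cmult[OF inner] hom_poly_cmult[OF inner_self]]
      dir_deriv_cmult[OF inner] dir_deriv_cmult[OF inner_self]
      dir_deriv_mult[OF hom_poly_inner hom_poly_zonal]
      dir_deriv_mult[OF hom_poly_inner_self hom_poly_zonal]
      dir_deriv_inner dir_deriv_inner_self ..
  show "laplacian (zonal (Suc (Suc j)) y) x =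
      a j * (of_real (y \<bullet> x) * laplacian (zonal (Suc j) y) x + 2 * dir_deriv y (zonal (Suc j) y) x) +
      b j * (of_real (x \<bullet> x) * laplacian (zonal j y) x + (4 * of_nat j + 2 * of_nat CARD('n)) *
          zonal j y x)"
    unfolding a_def b_def zonal_Suc_Suc_eq
      laplacian_add[OF hom_poly_cmult[OF inner, unfolded degree_eq] hom_poly_cmult[OF inner_self]]
      laplacian_cmult[OF inner] laplacian_cmult[OF inner_self]
      laplacian_inner_mult[OF hom_poly_zonal] laplacian_inner_self_mult[OF hom_poly_zonal] ..
qed

lemma zonal_three_term:
  fixes y :: "real^'n"
  assumes dim: "CARD('n) \<ge> 2"
  shows "of_real (real j + real CARD('n) - 2) * zonal (Suc j) y x =
    of_real (2 * real j + real CARD('n) - 2) * of_real (y \<bullet> x) * zonal j y x -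
    of_real (real j * (x \<bullet> x) * (y \<bullet> y)) * zonal (j - 1) y x"
proof (cases j)
  case (Suc i)
  let ?c = "real j + real CARD('n) - 2"
  have "?c \<noteq> 0" using dim Suc by simp
  then have coeffs: "?c * legendre_a CARD('n) i = 2 * real j + real CARD('n) - 2"
    "?c * legendre_b CARD('n) i = real j"
    by (simp_all add: Suc legendre_a_def legendre_b_def)
  have "of_real ?c * zonal (Suc (Suc i)) y x =
      of_real (?c * legendre_a CARD('n) i) * of_real (y \<bullet> x) * zonal (Suc i) y x -
      of_real (?c * legendre_b CARD('n) i * (x \<bullet> x) * (y \<bullet> y)) * zonal i y x"
    by (simp add: algebra_simps)
  then show ?thesis unfolding coeffs by (simp only: Suc diff_Suc_1)
qed simp

lemma dir_deriv_zonal: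
  fixes y :: "real^'n"
  assumes dim: "CARD('n) \<ge> 2"
  shows "dir_deriv y (zonal j y) x = of_real (real j * (y \<bullet> y)) * zonal (j - 1) y x"
proof (induction j rule: induct_nat_012)
  case 0
  then show ?case by (simp add: zonal_0_eq dir_deriv_const)
next
  case 1
  then show ?case by (simp add: zonal_1_eq dir_deriv_inner)
next
  case (ge2 j)
  let ?a = "legendre_a CARD('n) j" and ?b = "legendre_b CARD('n) j" and ?d = "real CARD('n)"
  define X Y where "X = complex_of_real (y \<bullet> x)" and "Y = complex_of_real (y \<bullet> y)"
  have coeffs: "?a * (real j + 1) - 2 * ?b = ?b * (2 * real j + ?d - 2)"
    "real j + 2 - ?a = ?b * (real j + ?d - 2)"
    using legendre_b_mult[OF dim, of j] by (simp_all add: legendre_a_eq[OF dim] algebra_simps)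
  have "dir_deriv y (zonal (Suc (Suc j)) y) x =
      of_real ?a * Y * zonal (Suc j) y x + Y * (of_real (?a * (real j + 1) - 2 * ?b) * X * zonal j y x -
        of_real (?b * (real j * (x \<bullet> x) * (y \<bullet> y))) * zonal (j - 1) y x)"
    unfolding dir_deriv_zonal_Suc_Suc ge2.IH by (simp add: X_def Y_def algebra_simps)
  also have "\<dots> = of_real ?a * Y * zonal (Suc j) y x + Y * (of_real ?b *
      (of_real (real j + ?d - 2) * zonal (Suc j) y x))"
    unfolding zonal_three_term[OF dim] coeffs(1) by (simp add: X_def algebra_simps)
  also have "\<dots> = of_real (?a + (real j + 2 - ?a)) * Y * zonal (Suc j) y x"
    unfolding coeffs(2) by (simp add: algebra_simps)
  finally show ?case by (simp add: Y_def algebra_simps del: zonal.simps)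
qed

theorem zonal_in_sph_harm:
  fixes y :: "real^'n"
  assumes dim: "CARD('n) \<ge> 2"
  shows "zonal j y \<in> sph_harm j"
proof (induction j rule: induct_nat_012)
  case 0
  then show ?case by (simp add: zonal_0_eq sph_harm_const)
next
  case 1
  then show ?case using sph_harm_inner by (simp add: zonal_1_eq)
next
  case (ge2 j)
  have coeffs: "legendre_a CARD('n) j * (real j + 1) =
      legendre_b CARD('n) j * (2 * real j + real CARD('n))"
    using legendre_b_mult[OF dim, of j] by (simp add: legendre_a_eq[OF dim] algebra_simps)
  have "laplacian (zonal (Suc (Suc j)) y) x = 0" for x
  proof -
    have "laplacian (zonal (Suc (Suc j)) y) x =
        2 * of_real ((legendre_a CARD('n) j * (real j + 1) -
          legendre_b CARD('n) j * (2 * real j + real CARD('n))) * (y \<bullet> y)) *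
          zonal j y x"
      unfolding laplacian_zonal_Suc_Suc dir_deriv_zonal[OF dim]
      by (simp add: sph_harm_laplacian[OF ge2(1)] sph_harm_laplacian[OF ge2(2)] algebra_simps)
    then show ?thesis by (simp add: coeffs)
  qed
  then show ?case by (intro sph_harmI hom_poly_zonal)
qed

definition legendre_norm :: "nat \<Rightarrow> nat \<Rightarrow> real" where
  "legendre_norm d j = coeff (legendre_poly d j) j * w_coef d j (real j)"

lemma legendre_norm_pos: "d \<ge> 2 \<Longrightarrow> legendre_norm d j > 0"
  by (simp add: legendre_norm_def coeff_legendre_poly_pos w_coef_diag_pos)

lemma zonal_reproducing:
  fixes h :: "real^'n \<Rightarrow> complex"
  assumes dim: "CARD('n) \<ge> 2" and unit: "norm u = 1" and harm_h: "h \<in> sph_harm j"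
  shows "(LINT v|\<omega>. h v * zonal j u v) = of_real (legendre_norm CARD('n) j) * h u"
proof -
  have "(LINT v|\<omega>. h v * zonal j u v) = (LINT v|\<omega>. h v * of_real (legendre_kernel j u v))"
    using unit by (intro Bochner_Integration.integral_cong) (simp_all add: zonal_sphere)
  then show ?thesis
    unfolding legendre_norm_def
    by (simp only: sphere_poly_sph_harm[OF dim unit harm_h degree_legendre_poly_le])
qed

theorem legendre_orthogonal:
  fixes u :: "real^'n"
  assumes dim: "CARD('n) \<ge> 2" and unit: "norm u = 1"
  shows "(LINT v|\<omega>. legendre_kernel i u v * legendre_kernel j u v) =
    (if i = j then legendre_norm CARD('n) j else 0)"
proof -
  let ?Q = "\<lambda>i v. legendre_kernel i u v"
  have orthogonal_le: "(LINT v|\<omega>. ?Q i v * ?Q j v) = (if i = j then legendre_norm CARD('n) j else 0)"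
    if i_le_j: "i \<le> j" for i j
  proof -
    have "complex_of_real (LINT v|\<omega>. ?Q i v * ?Q j v) = (LINT v|\<omega>. zonal j u v * of_real (?Q i v))"
      unfolding integral_complex_of_real[symmetric] using unit
      by (intro Bochner_Integration.integral_cong) (simp_all add: zonal_sphere)
    also have "\<dots> = of_real (coeff (legendre_poly CARD('n) i) j * w_coef CARD('n) j (real j)) *
        zonal j u u"
      by (rule sphere_poly_sph_harm[OF dim unit zonal_in_sph_harm[OF dim]
          order_trans[OF degree_legendre_poly_le i_le_j]])
    also have "zonal j u u = 1"
      using unit poly_legendre_1[OF dim] by (simp add: zonal_sphere dot_square_norm)
    also have "coeff (legendre_poly CARD('n) i) j =
        (if i = j then coeff (legendre_poly CARD('n) j) j else 0)"
      using i_le_j degree_legendre_poly_le[of "CARD('n)" i] by (auto intro: coeff_eq_0)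
    finally have "complex_of_real (LINT v|\<omega>. ?Q i v * ?Q j v) =
        of_real (if i = j then legendre_norm CARD('n) j else 0)"
      by (simp add: legendre_norm_def)
    then show ?thesis unfolding of_real_eq_iff .
  qed
  show ?thesis
    using orthogonal_le[of i j] orthogonal_le[of j i] by (cases "i \<le> j") (auto simp: mult.commute)
qed

section \<open>The projection as an integral operator\<close>

text \<open>On finite sums of products \<open>c(v) f(x)\<close>, integration over \<open>v\<close> commutes with the Laplacian in \<open>x\<close>
  by linearity alone.\<close>

inductive separable_kernel :: "nat \<Rightarrow> (real^'n \<Rightarrow> real^'n \<Rightarrow> complex) \<Rightarrow> bool" for j where
  prod: "continuous_on UNIV c \<Longrightarrow> hom_poly j f \<Longrightarrow> separable_kernel j (\<lambda>v x. c v * f x)"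
| add: "separable_kernel j K \<Longrightarrow> separable_kernel j L \<Longrightarrow> separable_kernel j (\<lambda>v x. K v x + L v x)"

lemma separable_kernel_hom_poly: "separable_kernel j K \<Longrightarrow> hom_poly j (K v)"
  by (induction rule: separable_kernel.induct) (auto intro: hom_poly_cmult hom_poly_add)

lemma separable_kernel_zero: "separable_kernel j (\<lambda>v x. 0)"
  using separable_kernel.prod[OF continuous_on_const[of _ 0] hom_poly_zero[of j]] by simp

lemma separable_kernel_sum:
  "(\<And>i. i \<in> I \<Longrightarrow> separable_kernel j (K i)) \<Longrightarrow> separable_kernel j (\<lambda>v x. \<Sum>i\<in>I. K i v x)"
  by (induction I rule: infinite_finite_induct) (auto intro: separable_kernel_zero separable_kernel.add)

lemma separable_kernel_mult:
  assumes cont_c: "continuous_on UNIV c" and hom_f: "hom_poly i f" and "separable_kernel j K"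
  shows "separable_kernel (i + j) (\<lambda>v x. c v * (f x * K v x))"
  using assms(3)
proof induction
  case (prod e g)
  have "separable_kernel (i + j) (\<lambda>v x. (c v * e v) * (f x * g x))"
    using prod by (intro separable_kernel.prod continuous_on_mult hom_poly_mult cont_c hom_f)
  then show ?case by (simp add: ac_simps)
next
  case (add K L)
  from separable_kernel.add[OF add.IH] show ?case by (simp add: distrib_left)
qed

lemma separable_kernel_zonal: "separable_kernel j (zonal j :: real^'n \<Rightarrow> real^'n \<Rightarrow> complex)"
proof (induction j rule: induct_nat_012)
  case 0
  then show ?case
    using separable_kernel.prod[OF continuous_on_const[of _ 1] hom_poly_const[of 1]]
    by (simp add: zonal_0_eq[abs_def])
next
  case 1
  have "separable_kernel 1 (\<lambda>v x::real^'n. \<Sum>i\<in>UNIV. of_real (v $ i) * of_real (x $ i))"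
    by (intro separable_kernel_sum separable_kernel.prod hom_poly_component continuous_intros)
  then show ?case by (simp add: zonal_1_eq[abs_def] inner_vec_def)
next
  case (ge2 j)
  let ?a = "complex_of_real (legendre_a CARD('n) j)" and ?b = "legendre_b CARD('n) j"
  have "separable_kernel (1 + Suc j)
      (\<lambda>v x::real^'n. \<Sum>i\<in>UNIV. (?a * of_real (v $ i)) * (of_real (x $ i) * zonal (Suc j) v x))"
    by (intro separable_kernel_sum separable_kernel_mult hom_poly_component continuous_intros ge2.IH)
  moreover have "separable_kernel (2 + j)
      (\<lambda>v x::real^'n. of_real (- ?b * (v \<bullet> v)) * (of_real (x \<bullet> x) * zonal j v x))"
    by (intro separable_kernel_mult hom_poly_inner_self continuous_intros ge2.IH)
  ultimately have "separable_kernel (Suc (Suc j)) (\<lambda>v x::real^'n.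
      (\<Sum>i\<in>UNIV. (?a * of_real (v $ i)) * (of_real (x $ i) * zonal (Suc j) v x)) +
      of_real (- ?b * (v \<bullet> v)) * (of_real (x \<bullet> x) * zonal j v x))"
    by (intro separable_kernel.add) simp_all
  also have "(\<lambda>v x::real^'n.
      (\<Sum>i\<in>UNIV. (?a * of_real (v $ i)) * (of_real (x $ i) * zonal (Suc j) v x)) +
      of_real (- ?b * (v \<bullet> v)) * (of_real (x \<bullet> x) * zonal j v x)) = zonal (Suc (Suc j))"
    by (simp add: fun_eq_iff inner_vec_def sum_distrib_left sum_distrib_right mult.assoc)
  finally show ?case .
qed

context
  fixes P :: "real^'n \<Rightarrow> complex"
  assumes integrable_P: "integrable \<omega> P"
begin

lemma integrable_continuous_mult: "continuous_on UNIV c \<Longrightarrow> integrable \<omega> (\<lambda>v. c v * P v)"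
  using integrable_P by (intro integrable_sphere_continuous_mult) (auto intro: continuous_on_subset)

lemma integral_prod_kernel: "(LINT v|\<omega>. c v * a * P v) = (LINT v|\<omega>. c v * P v) * a"
  by (simp only: mult.assoc mult.commute[of a] flip: integral_mult_left_zero)

lemma integrable_separable_kernel: "separable_kernel j K \<Longrightarrow> integrable \<omega> (\<lambda>v. K v x * P v)"
proof (induction rule: separable_kernel.induct)
  case (prod c f)
  from integrable_mult_left[OF integrable_continuous_mult[OF prod(1)], of "f x"] show ?case
    by (simp add: ac_simps)
qed (simp add: distrib_right)

lemma hom_poly_integral_kernel: "separable_kernel j K \<Longrightarrow> hom_poly j (\<lambda>x. LINT v|\<omega>. K v x * P v)"
  by (induction rule: separable_kernel.induct)
    (auto simp: integral_prod_kernel distrib_right integrable_separable_kernel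
        intro: hom_poly_cmult hom_poly_add)

lemma laplacian_integral_kernel:
  assumes "separable_kernel j K"
  shows "laplacian (\<lambda>x. LINT v|\<omega>. K v x * P v) x = (LINT v|\<omega>. laplacian (K v) x * P v)"
proof -
  have integrable_laplacian: "integrable \<omega> (\<lambda>v. laplacian (K v) x * P v)"
    if "separable_kernel j K" for K
    using that
  proof (induction rule: separable_kernel.induct)
    case (prod c f)
    from integrable_mult_left[OF integrable_continuous_mult[OF prod(1)], of "laplacian f x"] show ?case
      by (simp add: laplacian_cmult[OF prod(2)] ac_simps)
  qed (simp add: laplacian_add[OF separable_kernel_hom_poly separable_kernel_hom_poly] distrib_right)
  show ?thesis
    using assms
  proof (induction rule: separable_kernel.induct)
    case (prod c f)
    show ?case
      by (simp only: integral_prod_kernel laplacian_cmult[OF prod(2)])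
  next
    case (add K L)
    then show ?case
      by (simp add: distrib_right integrable_separable_kernel integrable_laplacian
          laplacian_add[OF hom_poly_integral_kernel hom_poly_integral_kernel, OF add.hyps]
          laplacian_add[OF separable_kernel_hom_poly separable_kernel_hom_poly, OF add.hyps])
  qed
qed

lemma integral_kernel_swap:
  assumes cont_g: "continuous_on (sphere 0 1) g" and "separable_kernel j K"
  shows "(LINT u|\<omega>. (LINT v|\<omega>. K v u * P v) * g u) = (LINT v|\<omega>. (LINT u|\<omega>. K v u * g u) * P v)"
proof -
  have inner: "integrable \<omega> (\<lambda>u. K v u * g u)" if "separable_kernel j K" for K v
    using that by (intro integrable_sphere_continuous continuous_on_mult cont_g)
      (rule continuous_on_hom_poly[OF separable_kernel_hom_poly])
  have outer_g: "integrable \<omega> (\<lambda>u. (LINT v|\<omega>. K v u * P v) * g u)" if "separable_kernel j K" for K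
    using that by (intro integrable_sphere_continuous continuous_on_mult cont_g)
      (rule continuous_on_hom_poly[OF hom_poly_integral_kernel])
  have outer_P: "integrable \<omega> (\<lambda>v. (LINT u|\<omega>. K v u * g u) * P v)" if "separable_kernel j K" for K
    using that
  proof (induction rule: separable_kernel.induct)
    case (prod c f)
    from integrable_mult_left[OF integrable_continuous_mult[OF prod(1)], of "LINT u|\<omega>. f u * g u"]
    show ?case by (simp add: ac_simps)
  qed (simp add: distrib_right inner)
  show ?thesis
    using assms(2)
  proof (induction rule: separable_kernel.induct)
    case (prod c f)
    have "(LINT u|\<omega>. (LINT v|\<omega>. c v * f u * P v) * g u) = (LINT v|\<omega>. c v * P v) * (LINT u|\<omega>. f u * g u)"
      unfolding integral_prod_kernel by (simp add: mult.assoc)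
    also have "\<dots> = (LINT v|\<omega>. c v * (LINT u|\<omega>. f u * g u) * P v)"
      by (rule integral_prod_kernel[symmetric])
    also have "\<dots> = (LINT v|\<omega>. (LINT u|\<omega>. c v * f u * g u) * P v)"
      by (simp add: mult.assoc)
    finally show ?case .
  next
    case (add K L)
    then show ?case
      by (simp add: distrib_right integrable_separable_kernel inner outer_g outer_P)
  qed
qed

end

definition zonal_projection :: "nat \<Rightarrow> (real^'n \<Rightarrow> complex) \<Rightarrow> real^'n \<Rightarrow> complex" where
  "zonal_projection j P x = of_real (1 / legendre_norm CARD('n) j) * (LINT v|\<omega>. zonal j v x * P v)"

lemma zonal_projection_in_sph_harm:
  fixes P :: "real^'n \<Rightarrow> complex"
  assumes dim: "CARD('n) \<ge> 2" and integrable_P: "integrable \<omega> P"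
  shows "zonal_projection j P \<in> sph_harm j"
proof -
  have "(\<lambda>x. LINT v|\<omega>. zonal j v x * P v) \<in> sph_harm j"
  proof (rule sph_harmI)
    show "hom_poly j (\<lambda>x. LINT v|\<omega>. zonal j v x * P v)"
      by (rule hom_poly_integral_kernel[OF integrable_P separable_kernel_zonal])
    show "laplacian (\<lambda>x. LINT v|\<omega>. zonal j v x * P v) x = 0" for x
      by (simp add: laplacian_integral_kernel[OF integrable_P separable_kernel_zonal]
          sph_harm_laplacian[OF zonal_in_sph_harm[OF dim]])
  qed
  then show ?thesis unfolding zonal_projection_def[abs_def] by (rule sph_harm_cmult)
qed

lemma sph_harm_eqI:
  fixes f g :: "real^'n \<Rightarrow> complex"
  assumes dim: "CARD('n) \<ge> 2" and harm_f: "f \<in> sph_harm j" and harm_g: "g \<in> sph_harm j"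
    and orth: "\<And>h. h \<in> sph_harm j \<Longrightarrow> (LINT v|\<omega>. (f v - g v) * cnj (h v)) = 0"
  shows "f = g"
proof (rule hom_poly_eqI_sphere[OF sph_harm_hom_poly[OF harm_f] sph_harm_hom_poly[OF harm_g]])
  fix u :: "real^'n" assume unit: "norm u = 1"
  have "of_real (legendre_norm CARD('n) j) * (f u - g u) = (LINT v|\<omega>. (f v - g v) * zonal j u v)"
    by (rule zonal_reproducing[OF dim unit sph_harm_diff[OF harm_f harm_g], symmetric])
  also have "\<dots> = (LINT v|\<omega>. (f v - g v) * cnj (zonal j u v))"
    using unit by (intro Bochner_Integration.integral_cong) (simp_all add: zonal_sphere)
  also have "\<dots> = 0" by (rule orth[OF zonal_in_sph_harm[OF dim]])
  finally show "f u = g u" using legendre_norm_pos[OF dim, of j] by simp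
qed

lemma integrable_mult_cnj_sph_harm:
  assumes "integrable \<omega> P" "h \<in> sph_harm j"
  shows "integrable \<omega> (\<lambda>v. P v * cnj (h v))"
proof -
  have "continuous_on (sphere 0 1) (\<lambda>v. cnj (h v))"
    using assms(2) by (intro continuous_intros) (rule continuous_on_hom_poly[OF sph_harm_hom_poly])
  from integrable_sphere_continuous_mult[OF this assms(1)] show ?thesis by (simp add: mult.commute)
qed

lemma sph_proj_eqI:
  fixes P :: "real^'n \<Rightarrow> complex"
  assumes dim: "CARD('n) \<ge> 2" and integrable_P: "integrable \<omega> P" and harm_f: "f \<in> sph_harm j"
    and orth: "\<And>h. h \<in> sph_harm j \<Longrightarrow> (LINT v|\<omega>. (P v - f v) * cnj (h v)) = 0"
  shows "sph_proj j P = f"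
  unfolding sph_proj_def
proof (rule the_equality)
  fix g assume harm_g: "g \<in> sph_harm j \<and> (\<forall>h\<in>sph_harm j. (LINT v|\<omega>. (P v - g v) * cnj (h v)) = 0)"
  have integrable: "integrable \<omega> (\<lambda>v. (P v - k v) * cnj (h v))"
    if "k \<in> sph_harm j" "h \<in> sph_harm j" for k h
    using that integrable_P by (intro integrable_mult_cnj_sph_harm Bochner_Integration.integrable_diff)
      (auto intro: integrable_sphere_hom_poly[OF sph_harm_hom_poly])
  show "g = f"
  proof (rule sph_harm_eqI[OF dim])
    fix h :: "real^'n \<Rightarrow> complex" assume harm_h: "h \<in> sph_harm j"
    have "(LINT v|\<omega>. (g v - f v) * cnj (h v)) =
        (LINT v|\<omega>. (P v - f v) * cnj (h v) - (P v - g v) * cnj (h v))"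
      by (simp add: algebra_simps)
    also have "\<dots> = 0"
      using harm_g harm_f harm_h by (subst Bochner_Integration.integral_diff) (auto simp: integrable orth)
    finally show "(LINT v|\<omega>. (g v - f v) * cnj (h v)) = 0" .
  qed (use harm_f harm_g in auto)
qed (use harm_f orth in auto)

theorem sph_proj_eq_zonal_projection:
  fixes P :: "real^'n \<Rightarrow> complex"
  assumes dim: "CARD('n) \<ge> 2" and integrable_P: "integrable \<omega> P"
  shows "sph_proj j P = zonal_projection j P"
proof (rule sph_proj_eqI[OF dim integrable_P zonal_projection_in_sph_harm[OF dim integrable_P]])
  fix h :: "real^'n \<Rightarrow> complex" assume harm_h: "h \<in> sph_harm j"
  let ?N = "complex_of_real (legendre_norm CARD('n) j)"
  have reproduce: "(LINT u|\<omega>. zonal j v u * cnj (h u)) = ?N * cnj (h v)" if unit: "norm v = 1" for v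
  proof -
    have "(LINT u|\<omega>. zonal j v u * cnj (h u)) = (LINT u|\<omega>. cnj (h u * zonal j v u))"
      using unit by (intro Bochner_Integration.integral_cong) (simp_all add: zonal_sphere mult.commute)
    also have "\<dots> = cnj (LINT u|\<omega>. h u * zonal j v u)" by (rule Bochner_Integration.integral_cnj)
    finally show ?thesis by (simp add: zonal_reproducing[OF dim unit harm_h])
  qed
  have "continuous_on (sphere 0 1) (\<lambda>v. cnj (h v))"
    using harm_h by (intro continuous_intros) (rule continuous_on_hom_poly[OF sph_harm_hom_poly])
  then have "?N * (LINT u|\<omega>. zonal_projection j P u * cnj (h u)) =
      (LINT v|\<omega>. (LINT u|\<omega>. zonal j v u * cnj (h u)) * P v)"
    using legendre_norm_pos[OF dim, of j]
    by (simp add: zonal_projection_def mult.assoc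
        integral_kernel_swap[OF integrable_P _ separable_kernel_zonal, symmetric])
  also have "\<dots> = (LINT v|\<omega>. ?N * (P v * cnj (h v)))"
    by (intro Bochner_Integration.integral_cong)
      (simp_all add: reproduce mult.assoc mult.commute[of "P _"])
  also have "\<dots> = ?N * (LINT v|\<omega>. P v * cnj (h v))"
    by simp
  finally have "(LINT u|\<omega>. zonal_projection j P u * cnj (h u)) = (LINT v|\<omega>. P v * cnj (h v))"
    using legendre_norm_pos[OF dim, of j] by simp
  moreover have "integrable \<omega> (zonal_projection j P)"
    by (rule
        integrable_sphere_hom_poly[OF sph_harm_hom_poly[OF zonal_projection_in_sph_harm[OF dim integrable_P]]])
  ultimately show "(LINT v|\<omega>. (P v - zonal_projection j P v) * cnj (h v)) = 0"
    by (simp add: left_diff_distrib integrable_mult_cnj_sph_harm[OF _ harm_h] integrable_P)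
qed

abbreviation harmonic_part :: "nat \<Rightarrow> (real^'n \<Rightarrow> real) \<Rightarrow> real^'n \<Rightarrow> complex" where
  "harmonic_part j P \<equiv> sph_proj j (\<lambda>v. complex_of_real (P v))"

corollary harmonic_part_eq_integral:
  fixes P :: "real^'n \<Rightarrow> real"
  assumes dim: "CARD('n) \<ge> 2" and integrable_P: "integrable \<omega> P" and unit: "norm u = 1"
  shows "harmonic_part j P u =
    of_real ((LINT v|\<omega>. legendre_kernel j u v * P v) / legendre_norm CARD('n) j)"
proof -
  have "(LINT v|\<omega>. zonal j v u * complex_of_real (P v)) =
      (LINT v|\<omega>. complex_of_real (legendre_kernel j u v * P v))"
    using unit by (intro Bochner_Integration.integral_cong) (simp_all add: zonal_sphere inner_commute)
  then show ?thesis
    using integrable_P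
    by (simp add: sph_proj_eq_zonal_projection[OF dim] zonal_projection_def del: of_real_mult)
qed

section \<open>Absolute moments\<close>

lemma distr_std_gaussian_inner:
  fixes u :: "real^'n"
  assumes unit: "norm u = 1"
  shows "distr std_gaussian borel (\<lambda>x. u \<bullet> x) = std_normal_distribution"
proof (rule Levy_uniqueness)
  interpret gaussian: prob_space "std_gaussian :: (real^'n) measure" by (rule prob_space_std_gaussian)
  have inner [measurable]: "(\<lambda>x. u \<bullet> x) \<in> std_gaussian \<rightarrow>\<^sub>M borel" by measurable
  show "real_distribution (distr std_gaussian borel (\<lambda>x. u \<bullet> x))"
    by (intro gaussian.real_distribution_distr inner)
  show std_normal: "real_distribution std_normal_distribution" by (rule real_dist_normal_dist)
  then interpret std_normal: real_distribution std_normal_distribution .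
  have "char (distr std_gaussian borel (\<lambda>x. u \<bullet> x)) t = char std_normal_distribution t" for t
  proof -
    have "char (distr std_gaussian borel (\<lambda>x. u \<bullet> x)) t =
        (LINT x|std_gaussian. (\<Prod>i\<in>UNIV. iexp (t * u $ i * x $ i)))"
      unfolding char_def
      by (subst integral_distr) (simp_all add: inner_vec_def sum_distrib_left exp_sum mult.assoc)
    also have "\<dots> = (\<Prod>i\<in>UNIV. char std_normal_distribution (t * u $ i))"
      unfolding char_def
      by (intro integral_std_gaussian_prod std_normal.integrable_iexp) auto
    also have "\<dots> = of_real (exp (\<Sum>i\<in>UNIV. - ((t * u $ i)\<^sup>2) / 2))"
      unfolding char_std_normal_distribution by (simp add: exp_sum)
    also have "(\<Sum>i\<in>UNIV. - ((t * u $ i)\<^sup>2) / 2) = - (t\<^sup>2 * (u \<bullet> u)) / 2"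
      by (simp add: inner_vec_def power_mult_distrib power2_eq_square sum_distrib_left sum_negf
          sum_divide_distrib ac_simps)
    finally show ?thesis using unit by (simp add: char_std_normal_distribution dot_square_norm)
  qed
  then show "char (distr std_gaussian borel (\<lambda>x. u \<bullet> x)) = char std_normal_distribution" by (rule ext)
qed

lemma integrable_std_gaussian_norm_powr:
  assumes "\<beta> \<ge> 0"
  shows "integrable std_gaussian (\<lambda>x::real^'n. norm x powr \<beta>)"
proof (rule Bochner_Integration.integrable_bound)
  interpret gaussian: prob_space "std_gaussian :: (real^'n) measure" by (rule prob_space_std_gaussian)
  define k where "k = nat \<lceil>\<beta>\<rceil>"
  have "integrable std_gaussian (\<lambda>x::real^'n. complex_of_real ((x \<bullet> x) ^ k))"
    using hom_poly_power[OF hom_poly_inner_self, of k] by (intro integrable_std_gaussian_hom_poly) simp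
  from integrable_Re[OF this] show "integrable std_gaussian (\<lambda>x::real^'n. 1 + (x \<bullet> x) ^ k)" by simp
  have "norm x powr \<beta> \<le> 1 + (x \<bullet> x) ^ k" for x :: "real^'n"
  proof (cases "norm x \<le> 1")
    case True
    then have "norm x powr \<beta> \<le> 1" using assms by (intro powr_le1) auto
    then show ?thesis by (simp add: add_increasing2)
  next
    case False
    have "\<beta> \<le> real (2 * k)" unfolding k_def using assms by linarith
    then have "norm x powr \<beta> \<le> norm x powr real (2 * k)" using False by (intro powr_mono) auto
    also have "\<dots> = (x \<bullet> x) ^ k"
      using False by (subst powr_realpow) (auto simp: power_mult dot_square_norm)
    finally show ?thesis by simp
  qed
  then show "AE x in std_gaussian. norm (norm (x::real^'n) powr \<beta>) \<le> norm (1 + (x \<bullet> x) ^ k)"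
    by (intro AE_I2) simp
qed simp

lemma integral_std_gaussian_norm_powr:
  assumes "\<beta> \<ge> 0"
  shows "(LINT x|std_gaussian. norm (x::real^'n) powr \<beta>) =
    gaussian_radial_moment CARD('n) \<beta> / gaussian_radial_moment CARD('n) 0"
proof -
  have "(LINT v|\<omega>. norm (v::real^'n) powr \<beta>) = (LINT v|(\<omega> :: (real^'n) measure). 1)"
    by (intro Bochner_Integration.integral_cong) auto
  then show ?thesis
    using std_gaussian_polar[OF integrable_std_gaussian_norm_powr[OF assms] assms, where 'n='n]
    by (simp add: measure_sphere)
qed

lemma integral_std_normal_abs_powr:
  assumes "\<beta> \<ge> 0"
  shows "(LINT t|std_normal_distribution. \<bar>t\<bar> powr \<beta>) =
      gaussian_radial_moment 1 \<beta> / gaussian_radial_moment 1 0"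
proof -
  let ?e = "axis 1 1 :: real^1"
  have "(LINT t|std_normal_distribution. \<bar>t\<bar> powr \<beta>) = (LINT x|std_gaussian. \<bar>?e \<bullet> x\<bar> powr \<beta>)"
    using distr_std_gaussian_inner[of ?e] by (subst integral_distr[symmetric, of _ _ borel]) simp_all
  also have "\<dots> = (LINT x|std_gaussian. norm (x::real^1) powr \<beta>)"
    by (simp add: norm_real inner_axis')
  finally show ?thesis using integral_std_gaussian_norm_powr[OF assms, where 'n=1] by simp
qed

lemma Gamma_duplication_real:
  fixes x :: real
  assumes "x > 0"
  shows "Gamma x * Gamma (x + 1/2) = 2 powr (1 - 2 * x) * sqrt pi * Gamma (2 * x)"
proof -
  have "complex_of_real x \<notin> \<int>\<^sub>\<le>\<^sub>0" "complex_of_real (x + 1/2) \<notin> \<int>\<^sub>\<le>\<^sub>0"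
    using assms by (auto simp only: of_real_in_nonpos_Ints_iff not_nonpos_Ints_if_pos)
  then have "Gamma (complex_of_real x) * Gamma (complex_of_real x + 1/2) =
      exp ((1 - 2 * complex_of_real x) * of_real (ln 2)) * of_real (sqrt pi) *
      Gamma (2 * complex_of_real x)"
    by (intro Gamma_legendre_duplication) simp_all
  also have "Gamma (complex_of_real x) * Gamma (complex_of_real x + 1/2) =
      of_real (Gamma x * Gamma (x + 1/2))"
    by (simp flip: Gamma_complex_of_real)
  also have "exp ((1 - 2 * complex_of_real x) * of_real (ln 2)) * of_real (sqrt pi) *
      Gamma (2 * complex_of_real x) =
     of_real (exp ((1 - 2 * x) * ln 2) * sqrt pi * Gamma (2 * x))"
    by (simp flip: Gamma_complex_of_real exp_of_real)
  finally show ?thesis unfolding of_real_eq_iff by (simp add: powr_def)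
qed

lemma w_coef_0_eq:
  assumes nonneg_beta: "\<beta> \<ge> 0" and pos_d: "d > 0"
  shows "w_coef d 0 \<beta> * gaussian_radial_moment d \<beta> =
      gaussian_radial_moment 1 \<beta> / gaussian_radial_moment 1 0"
proof -
  have args: "(\<beta> + 1) / 2 + 1/2 = \<beta> / 2 + 1" "1 - 2 * ((\<beta> + 1) / 2) = - \<beta>" "2 * ((\<beta> + 1) / 2) = \<beta> + 1"
    by (simp_all add: field_simps)
  have "Gamma ((\<beta> + 1) / 2) * Gamma (\<beta> / 2 + 1) = 2 powr (- \<beta>) * sqrt pi * Gamma (\<beta> + 1)"
    using Gamma_duplication_real[of "(\<beta> + 1) / 2", unfolded args] nonneg_beta by simp
  then have Gamma: "Gamma (\<beta> + 1) = 2 powr \<beta> / sqrt pi * Gamma ((\<beta> + 1) / 2) * Gamma (\<beta> / 2 + 1)"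
    by (simp add: powr_minus field_simps)
  have pos: "Gamma (\<beta> / 2 + 1) > 0" "Gamma ((\<beta> + d) / 2) > 0"
    using nonneg_beta pos_d by (auto intro!: Gamma_real_pos)
  have powr: "2 powr \<beta> * 2 powr (\<beta> / 2 - 1) = 2 powr (\<beta> / 2) * 2 powr (\<beta> - 1)"
    by (simp add: field_simps flip: powr_add)
  have "w_coef d 0 \<beta> * gaussian_radial_moment d \<beta> =
      2 powr \<beta> * 2 powr (\<beta> / 2 - 1) / 2 powr (\<beta> - 1) * Gamma ((\<beta> + 1) / 2) / sqrt pi"
    unfolding w_coef_def gaussian_radial_moment_def rGamma_inverse_Gamma Gamma
    using pos by (simp add: add.commute[of "real d"] inverse_eq_divide mult_ac)
  also have "\<dots> = 2 powr (\<beta> / 2) * Gamma ((\<beta> + 1) / 2) / sqrt pi"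
    unfolding powr by simp
  also have "\<dots> = gaussian_radial_moment 1 \<beta> / gaussian_radial_moment 1 0"
    by (simp add: gaussian_radial_moment_def Gamma_one_half_real powr_diff add.commute powr_half_sqrt)
  finally show ?thesis .
qed

lemma w_coef_1_eq:
  assumes "\<alpha> > - 1"
  shows "w_coef d 1 \<alpha> = w_coef d 0 (\<alpha> + 1)"
proof -
  have arg_eq: "(\<alpha> - real 1) / 2 + 1 = (\<alpha> + 1) / 2" by (simp add: field_simps)
  have rGamma: "rGamma ((\<alpha> + 1) / 2) = (\<alpha> + 1) / 2 * rGamma ((\<alpha> + 1) / 2 + 1)"
    by (rule rGamma_plus1[symmetric])
  show ?thesis
    unfolding w_coef_add_1[OF assms] unfolding w_coef_def arg_eq rGamma by (simp add: ac_simps)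
qed

lemma inner_sphere_bound: "norm u = 1 \<Longrightarrow> v \<in> sphere 0 1 \<Longrightarrow> u \<bullet> v \<in> {-1..1}"
  using Cauchy_Schwarz_ineq2[of u v] by (auto simp: abs_le_iff)

lemma continuous_on_sphere_inner:
  fixes u :: "real^'n" and q :: "real \<Rightarrow> real"
  assumes "norm u = 1" "continuous_on {-1..1} q"
  shows "continuous_on (sphere 0 1) (\<lambda>v. q (u \<bullet> v))"
  using inner_sphere_bound[OF assms(1)]
  by (intro continuous_on_compose2[OF assms(2)] continuous_intros) blast

lemma integrable_sphere_inner:
  fixes u :: "real^'n" and q :: "real \<Rightarrow> real"
  shows "norm u = 1 \<Longrightarrow> continuous_on {-1..1} q \<Longrightarrow> integrable \<omega> (\<lambda>v. q (u \<bullet> v))"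
  by (intro integrable_sphere_continuous continuous_on_sphere_inner)

theorem sphere_abs_moment:
  fixes u :: "real^'n"
  assumes unit: "norm u = 1" and nonneg_beta: "\<beta> \<ge> 0"
  shows "(LINT v|\<omega>. \<bar>u \<bullet> v\<bar> powr \<beta>) = w_coef CARD('n) 0 \<beta>"
proof -
  have integrable: "integrable std_gaussian (\<lambda>x. \<bar>u \<bullet> x\<bar> powr \<beta>)"
  proof (rule
      Bochner_Integration.integrable_bound[OF integrable_std_gaussian_norm_powr[OF nonneg_beta]])
    show "AE x in std_gaussian. norm (\<bar>u \<bullet> x\<bar> powr \<beta>) \<le> norm (norm x powr \<beta>)"
      using unit Cauchy_Schwarz_ineq2[of u] nonneg_beta by (intro AE_I2) (auto intro!: powr_mono2)
  qed simp
  have homogeneous: "\<bar>u \<bullet> x\<bar> powr \<beta> = norm x powr \<beta> *\<^sub>R \<bar>u \<bullet> direction x\<bar> powr \<beta>" for x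
  proof -
    have "\<bar>u \<bullet> x\<bar> = norm x * \<bar>u \<bullet> direction x\<bar>"
      by (metis abs_mult abs_norm_cancel inner_scaleR_right norm_scaleR_direction)
    then show ?thesis by (simp add: powr_mult)
  qed
  have "gaussian_radial_moment CARD('n) \<beta> * (LINT v|\<omega>. \<bar>u \<bullet> v\<bar> powr \<beta>) =
      (LINT x|std_gaussian. \<bar>u \<bullet> x\<bar> powr \<beta>)"
    using std_gaussian_polar[OF integrable nonneg_beta homogeneous] by simp
  also have "\<dots> = (LINT t|std_normal_distribution. \<bar>t\<bar> powr \<beta>)"
    using distr_std_gaussian_inner[OF unit] by (subst integral_distr[symmetric, of _ _ borel]) simp_all
  also have "\<dots> = gaussian_radial_moment CARD('n) \<beta> * w_coef CARD('n) 0 \<beta>"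
    using w_coef_0_eq[OF nonneg_beta, of "CARD('n)"]
    by (simp add: integral_std_normal_abs_powr[OF nonneg_beta] mult.commute)
  finally show ?thesis using gaussian_radial_moment_pos[OF nonneg_beta, of "CARD('n)"] by simp
qed

section \<open>Funk-Hecke coefficients of signed powers\<close>

definition signed_powr :: "nat \<Rightarrow> real \<Rightarrow> real \<Rightarrow> real" where
  "signed_powr j \<alpha> t = \<bar>t\<bar> powr \<alpha> * sgn t ^ j"

lemma signed_powr_Suc_Suc: "signed_powr (Suc (Suc j)) \<alpha> = signed_powr j \<alpha>"
  by (auto simp: signed_powr_def fun_eq_iff sgn_if)

lemma signed_powr_even: "even j \<Longrightarrow> signed_powr j = signed_powr 0"
  and signed_powr_odd: "odd j \<Longrightarrow> signed_powr j = signed_powr 1"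
  by (induction j rule: induct_nat_012) (auto simp: signed_powr_Suc_Suc fun_eq_iff)

lemma signed_powr_minus: "signed_powr j \<alpha> (- t) = (- 1) ^ j * signed_powr j \<alpha> t"
  by (simp add: signed_powr_def sgn_minus power_minus[of "sgn t"])

lemma signed_powr_add_1: "signed_powr (Suc j) (\<alpha> + 1) t = t * signed_powr j \<alpha> t"
  by (cases "t = 0") (auto simp: signed_powr_def powr_add sgn_if)

lemma continuous_on_signed_powr:
  assumes "\<alpha> > 0" shows "continuous_on A (signed_powr j \<alpha>)"
proof (cases "even j")
  case True
  have "continuous_on A (\<lambda>t::real. \<bar>t\<bar> powr \<alpha>)"
    using assms by (intro continuous_on_powr' continuous_intros) auto
  then show ?thesis unfolding signed_powr_even[OF True] by (simp add: signed_powr_def[abs_def])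
next
  case False
  have "signed_powr 1 \<alpha> = (\<lambda>t. max 0 t powr \<alpha> - max 0 (- t) powr \<alpha>)"
    by (auto simp: signed_powr_def sgn_if max_def)
  moreover have "continuous_on A (\<lambda>t::real. max 0 t powr \<alpha> - max 0 (- t) powr \<alpha>)"
    using assms by (intro continuous_on_diff continuous_on_powr' continuous_intros) auto
  ultimately show ?thesis by (simp only: signed_powr_odd[OF False])
qed

definition funk_hecke_coef :: "real^'n \<Rightarrow> (real \<Rightarrow> real) \<Rightarrow> nat \<Rightarrow> real" where
  "funk_hecke_coef u q j = (LINT v|\<omega>. q (u \<bullet> v) * legendre_kernel j u v)"

lemma integrable_funk_hecke:
  fixes u :: "real^'n"
  assumes "norm u = 1" "continuous_on {-1..1} q"
  shows "integrable \<omega> (\<lambda>v. q (u \<bullet> v) * poly p (u \<bullet> v))"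
  using assms by (intro integrable_sphere_inner[of u "\<lambda>t. q t * poly p t"] continuous_intros)

lemma funk_hecke_coef_Suc_Suc:
  fixes u :: "real^'n"
  assumes unit: "norm u = 1" and cont_q: "continuous_on {-1..1} q"
  shows "funk_hecke_coef u q (Suc (Suc j)) =
    legendre_a CARD('n) j * funk_hecke_coef u (\<lambda>t. t * q t) (Suc j) -
    legendre_b CARD('n) j * funk_hecke_coef u q j"
proof -
  let ?Q = "\<lambda>j v. legendre_kernel j u v"
  have "q (u \<bullet> v) * ?Q (Suc (Suc j)) v =
      legendre_a CARD('n) j * (u \<bullet> v * q (u \<bullet> v) * ?Q (Suc j) v) -
      legendre_b CARD('n) j * (q (u \<bullet> v) * ?Q j v)" for v
    by (simp add: algebra_simps)
  moreover have "integrable \<omega> (\<lambda>v. u \<bullet> v * q (u \<bullet> v) * ?Q (Suc j) v)"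
      "integrable \<omega> (\<lambda>v. q (u \<bullet> v) * ?Q j v)"
    by (rule integrable_funk_hecke[OF unit continuous_on_mult[OF continuous_on_id cont_q]]
        integrable_funk_hecke[OF unit cont_q])+
  ultimately show ?thesis by (simp only: funk_hecke_coef_def) simp
qed

theorem funk_hecke_signed_powr:
  fixes u :: "real^'n"
  assumes unit: "norm u = 1" and dim: "CARD('n) \<ge> 2" and pos_alpha: "\<alpha> > 0"
  shows "funk_hecke_coef u (signed_powr j \<alpha>) j = w_coef CARD('n) j \<alpha>"
  using pos_alpha
proof (induction j arbitrary: \<alpha> rule: induct_nat_012)
  case 0
  then show ?case by (simp add: funk_hecke_coef_def signed_powr_def sphere_abs_moment[OF unit])
next
  case 1
  have "signed_powr (Suc 0) \<alpha> t * t = \<bar>t\<bar> powr (\<alpha> + 1)" for t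
    using signed_powr_add_1[of "Suc 0" \<alpha> t]
    by (simp add: signed_powr_Suc_Suc signed_powr_def mult.commute)
  then have "funk_hecke_coef u (signed_powr (Suc 0) \<alpha>) (Suc 0) = w_coef CARD('n) 0 (\<alpha> + 1)"
    using 1 by (simp add: funk_hecke_coef_def sphere_abs_moment[OF unit])
  then show ?case using w_coef_1_eq[of \<alpha> "CARD('n)"] 1 by simp
next
  case (ge2 j)
  have "funk_hecke_coef u (signed_powr (Suc (Suc j)) \<alpha>) (Suc (Suc j)) =
      legendre_a CARD('n) j * w_coef CARD('n) (Suc j) (\<alpha> + 1) -
      legendre_b CARD('n) j * w_coef CARD('n) j \<alpha>"
    using ge2 funk_hecke_coef_Suc_Suc[OF unit continuous_on_signed_powr[OF ge2.prems], of j j]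
    by (simp add: signed_powr_Suc_Suc flip: signed_powr_add_1)
  then show ?case
    using w_coef_three_term[of \<alpha> j "CARD('n)"] ge2.prems dim
    by (simp add: legendre_a_def legendre_b_def diff_divide_distrib[symmetric] eq_divide_eq
        divide_eq_eq)
qed

section \<open>The logarithmic kernel\<close>

lemma sum_inverse_odd: "(\<Sum>k<n. 1 / (2 * real k + 1)) = harm (2 * n) - harm n / 2"
proof (induction n)
  case (Suc n)
  have "harm (2 * Suc n) = harm (2 * n) + 1 / (2 * real n + 1) + 1 / (2 * real n + 2)"
    by (simp add: harm_Suc inverse_eq_divide add.commute)
  moreover have "harm (Suc n) / 2 = harm n / 2 + 1 / (2 * real n + 2)"
    by (simp add: harm_Suc field_simps)
  ultimately show ?case using Suc unfolding sum.lessThan_Suc by linarith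
qed (simp add: harm_def)

lemma beta_d_eq_Digamma: "beta_d d = 1 - euler_mascheroni / 2 - ln 2 - Digamma (real d / 2 + 1) / 2"
proof (cases "even d")
  case True
  then obtain n where d_eq: "d = 2 * n" by (elim evenE)
  have "real d / 2 + 1 = of_nat (Suc n)" by (simp add: d_eq)
  then have "Digamma (real d / 2 + 1) = harm n - euler_mascheroni" by (simp only: Digamma_of_nat)
  then show ?thesis by (simp add: beta_d_def d_eq field_simps)
next
  case False
  then have "\<exists>n. d + 1 = 2 * n" by presburger
  then obtain n where d_eq: "d + 1 = 2 * n" by blast
  have "real (d + 1) = 2 * real n" unfolding d_eq by simp
  then have "real d / 2 + 1 = of_nat n + 1/2" by simp
  then have "Digamma (real d / 2 + 1) = (\<Sum>k<n. 2 / real (2 * k + 1)) - euler_mascheroni - 2 * ln 2"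
    by (simp only: Digamma_half_integer of_real_eq_id id_apply)
  also have "(\<Sum>k<n. 2 / real (2 * k + 1)) = 2 * (\<Sum>k<n. 1 / (2 * real k + 1))"
    by (simp add: sum_distrib_left add.commute)
  finally have "Digamma (real d / 2 + 1) =
      2 * (harm (2 * n) - harm n / 2) - euler_mascheroni - 2 * ln 2"
    by (simp only: sum_inverse_odd)
  moreover have "beta_d d = 1 - harm (2 * n) + harm n / 2"
    using False d_eq by (simp add: beta_d_def)
  ultimately show ?thesis by (simp add: field_simps)
qed

lemma has_real_derivative_Gamma_2: "(Gamma has_real_derivative 1 - euler_mascheroni) (at 2)"
proof -
  have "Digamma (2::real) = 1 - euler_mascheroni"
    using Digamma_of_nat[of 1, where 'a=real] by (simp add: harm_def)
  moreover have "Gamma (2::real) = 1" using Gamma_fact[of 1, where 'a=real] by simp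
  ultimately show ?thesis
    using has_field_derivative_Gamma[of "2::real" UNIV] by (simp add: not_nonpos_Ints_if_pos)
qed

lemma w_coef_has_real_derivative_at_1:
  fixes d j :: nat
  defines "x \<equiv> (real j + 1 + real d) / 2" and "y \<equiv> (1 - real j) / 2 + 1"
  assumes deriv_rGamma: "(rGamma has_real_derivative D) (at y)"
  shows "(w_coef d j has_real_derivative pi powr (real d / 2) * rGamma x *
    ((1 - euler_mascheroni - ln 2 - Digamma x / 2) * rGamma y + D / 2)) (at 1)"
proof -
  have Gamma: "((\<lambda>\<alpha>. Gamma (\<alpha> + 1)) has_real_derivative 1 - euler_mascheroni) (at 1)"
    using has_real_derivative_Gamma_2 DERIV_shift[of Gamma "1 - euler_mascheroni :: real" 1 1] by simp
  have rGamma_x: "((\<lambda>\<alpha>. rGamma ((real j + \<alpha> + real d) / 2)) has_real_derivative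
      (- rGamma x * Digamma x) * (1 / 2)) (at 1)"
  proof (rule DERIV_chain2[where f=rGamma and g="\<lambda>\<alpha>. (real j + \<alpha> + real d) / 2"])
    show "(rGamma has_real_derivative - rGamma x * Digamma x) (at ((real j + 1 + real d) / 2))"
      unfolding x_def by (intro has_field_derivative_rGamma_no_nonpos_int not_nonpos_Ints_if_pos) simp
  qed (auto intro!: derivative_eq_intros)
  have rGamma_y: "((\<lambda>\<alpha>. rGamma ((\<alpha> - real j) / 2 + 1)) has_real_derivative D * (1 / 2)) (at 1)"
  proof (rule DERIV_chain2[where f=rGamma and g="\<lambda>\<alpha>. (\<alpha> - real j) / 2 + 1"])
    show "(rGamma has_real_derivative D) (at ((1 - real j) / 2 + 1))"
      using deriv_rGamma unfolding y_def .
  qed (auto intro!: derivative_eq_intros)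
  have powr: "((\<lambda>\<alpha>. 2 powr (1 - \<alpha>)) has_real_derivative - ln 2) (at 1)"
    unfolding powr_def by (auto intro!: derivative_eq_intros)
  have w_coef: "w_coef d j =
      (\<lambda>\<alpha>. pi powr (real d / 2) * (Gamma (\<alpha> + 1) * (rGamma ((real j + \<alpha> + real d) / 2) *
      (rGamma ((\<alpha> - real j) / 2 + 1) * 2 powr (1 - \<alpha>)))))"
    by (auto simp: w_coef_def fun_eq_iff powr_diff)
  have "Gamma (1 + 1 :: real) = 1" using Gamma_fact[of 1, where 'a=real] by simp
  then show ?thesis
    unfolding w_coef
    by (intro DERIV_cong[OF DERIV_cmult[OF
        DERIV_mult[OF Gamma DERIV_mult[OF rGamma_x DERIV_mult[OF rGamma_y powr]]]]])
      (simp add: x_def[symmetric] y_def[symmetric], simp add: algebra_simps)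
qed

lemma w_coef_has_real_derivative_w_star:
  assumes odd_j: "odd j"
  shows "(w_coef d j has_real_derivative w_star d j) (at 1)"
proof (cases "j = 1")
  case True
  have y_eq: "(1 - real j) / 2 + 1 = 1" and x_eq: "(real j + 1 + real d) / 2 = real d / 2 + 1"
    by (simp_all add: True)
  have "Digamma (1::real) = - euler_mascheroni"
    using Digamma_of_nat[of 0, where 'a=real] by (simp add: harm_def)
  then have "(rGamma has_real_derivative euler_mascheroni) (at ((1 - real j) / 2 + 1))"
    unfolding y_eq using has_field_derivative_rGamma_no_nonpos_int[of "1::real" UNIV]
    by (simp add: not_nonpos_Ints_if_pos)
  note deriv = w_coef_has_real_derivative_at_1[OF this, of d]
  have "(1 - euler_mascheroni - ln 2 - Digamma (real d / 2 + 1) / 2) * rGamma 1 +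
      euler_mascheroni / 2 = beta_d d"
    by (simp add: beta_d_eq_Digamma)
  with deriv show ?thesis
    unfolding x_eq y_eq by (simp add: True w_star_def rGamma_inverse_Gamma inverse_eq_divide)
next
  case False
  with odd_j have "\<exists>n. j = 2 * n + 3" by presburger
  then obtain n where j_eq: "j = 2 * n + 3" by blast
  have y_eq: "(1 - real j) / 2 + 1 = - of_nat n" by (simp add: j_eq field_simps)
  have "(rGamma has_real_derivative (-1) ^ n * fact n) (at ((1 - real j) / 2 + 1))"
    unfolding y_eq by (rule has_field_derivative_rGamma_nonpos_int)
  note deriv = w_coef_has_real_derivative_at_1[OF this, of d]
  have "(real j - 1) / 2 = 1 + of_nat n" by (simp add: j_eq)
  then have "Gamma ((real j - 1) / 2) = fact n" by (simp only: Gamma_fact)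
  moreover have "(j - 3) div 2 = n" by (simp add: j_eq)
  ultimately have "w_star d j = (- 1) ^ n * pi powr (real d / 2) *
      fact n / (2 * Gamma ((real j + 1 + real d) / 2))"
    unfolding w_star_def using False by (simp add: ac_simps)
  moreover have "rGamma (- of_nat n :: real) = 0" by (simp add: rGamma_eq_zero_iff)
  ultimately show ?thesis
    using deriv unfolding y_eq by (simp add: rGamma_inverse_Gamma field_simps)
qed

lemma powr_quotient_bound:
  fixes t h :: real
  assumes abs_t_le: "\<bar>t\<bar> \<le> 1" and pos_h: "h > 0"
  shows "\<bar>(\<bar>t\<bar> powr (1 + h) - \<bar>t\<bar>) / h\<bar> \<le> 1"
proof (cases "t = 0")
  case False
  define s where "s = \<bar>t\<bar>"
  have pos_s: "0 < s" "s \<le> 1" using abs_t_le False by (auto simp: s_def)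
  have "1 + h * ln s \<le> s powr h"
    unfolding powr_def using pos_s exp_ge_add_one_self[of "h * ln s"] by simp
  then have "1 - s powr h \<le> h * (- ln s)" by simp
  also have "\<dots> \<le> h * (1 / s - 1)"
    using pos_h pos_s ln_le_minus_one[of "1 / s"] by (intro mult_left_mono) (auto simp: ln_div)
  finally have "s * (1 - s powr h) \<le> s * (h * (1 / s - 1))" using pos_s by (intro mult_left_mono) auto
  also have "\<dots> \<le> h" using pos_s pos_h by (simp add: field_simps)
  finally have "s * (1 - s powr h) \<le> h" .
  moreover have "s powr h \<le> 1" using pos_s pos_h by (simp add: powr_le1)
  then have "s * (1 - s powr h) \<ge> 0" using pos_s by simp
  moreover have "s powr (1 + h) - s = - (s * (1 - s powr h))"
    using pos_s by (simp add: powr_add algebra_simps)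
  ultimately show ?thesis using pos_h unfolding s_def[symmetric] by (simp add: abs_divide)
qed (use pos_h in simp)

lemma continuous_on_times_ln_abs: "continuous_on A (\<lambda>t::real. t * ln \<bar>t\<bar>)"
proof (rule continuous_at_imp_continuous_on, rule ballI)
  fix t :: real
  show "isCont (\<lambda>t. t * ln \<bar>t\<bar>) t"
  proof (cases "t = 0")
    case True
    have "((\<lambda>t::real. t * ln \<bar>t\<bar>) \<longlongrightarrow> 0) (at_left 0)" "((\<lambda>t::real. t * ln \<bar>t\<bar>) \<longlongrightarrow> 0) (at_right 0)"
      by real_asymp+
    then show ?thesis using True by (simp add: isCont_def filterlim_at_split)
  next
    case False
    then show ?thesis by (auto intro!: continuous_intros)
  qed
qed

lemma has_real_derivative_signed_powr:
  assumes "odd j"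
  shows "((\<lambda>\<alpha>. signed_powr j \<alpha> t) has_real_derivative t * ln \<bar>t\<bar>) (at 1)"
proof (cases "t = 0")
  case False
  then have "((\<lambda>\<alpha>. \<bar>t\<bar> powr \<alpha>) has_real_derivative \<bar>t\<bar> powr 1 * ln \<bar>t\<bar>) (at 1)"
    by (auto intro!: derivative_eq_intros)
  from DERIV_cmult_right[OF this, of "sgn t"] have
    "((\<lambda>\<alpha>. signed_powr 1 \<alpha> t) has_real_derivative \<bar>t\<bar> powr 1 * ln \<bar>t\<bar> * sgn t) (at 1)"
    by (simp add: signed_powr_def)
  then show ?thesis
    unfolding signed_powr_odd[OF assms] by (rule DERIV_cong) (simp add: sgn_if)
qed (simp add: signed_powr_def)

lemma signed_powr_quotient_bound:
  assumes "odd j" "\<bar>t\<bar> \<le> 1" "h > 0"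
  shows "\<bar>(signed_powr j (1 + h) t - signed_powr j 1 t) / h\<bar> \<le> 1"
proof -
  have "(signed_powr j (1 + h) t - signed_powr j 1 t) / h = sgn t * ((\<bar>t\<bar> powr (1 + h) - \<bar>t\<bar>) / h)"
    unfolding signed_powr_odd[OF assms(1)]
    by (simp add: signed_powr_def algebra_simps diff_divide_distrib)
  then have "\<bar>(signed_powr j (1 + h) t - signed_powr j 1 t) / h\<bar> =
      \<bar>sgn t\<bar> * \<bar>(\<bar>t\<bar> powr (1 + h) - \<bar>t\<bar>) / h\<bar>"
    by (simp only: abs_mult)
  also have "\<dots> \<le> 1 * 1"
    using powr_quotient_bound[OF assms(2,3)] by (intro mult_mono) (auto simp: sgn_if)
  finally show ?thesis by simp
qed

lemma has_real_derivative_LIMSEQ: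
  assumes "(f has_real_derivative D) (at a)"
  shows "(\<lambda>n. (f (a + 1 / real (Suc n)) - f a) / (1 / real (Suc n))) \<longlonglongrightarrow> D"
proof -
  have "filterlim (\<lambda>n. 1 / real (Suc n)) (at 0) sequentially"
    using LIMSEQ_inverse_real_of_nat by (auto simp: filterlim_at inverse_eq_divide)
  with assms show ?thesis unfolding DERIV_def by (rule filterlim_compose)
qed

lemma funk_hecke_coef_LIMSEQ:
  fixes u :: "real^'n"
  assumes unit: "norm u = 1" and cont_q: "\<And>n. continuous_on {-1..1} (q n)"
    and bound: "\<And>n t. t \<in> {-1..1} \<Longrightarrow> \<bar>q n t\<bar> \<le> B"
    and limit: "\<And>t. t \<in> {-1..1} \<Longrightarrow> (\<lambda>n. q n t) \<longlonglongrightarrow> f t"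
  shows "(\<lambda>n. funk_hecke_coef u (q n) j) \<longlonglongrightarrow> funk_hecke_coef u f j"
  unfolding funk_hecke_coef_def
proof (rule integral_dominated_convergence)
  let ?Q = "\<lambda>v. legendre_kernel j u v"
  have int_Q: "integrable \<omega> ?Q"
    using integrable_funk_hecke[OF unit continuous_on_const, of 1] by simp
  show measurable_integrand: "(\<lambda>v. q n (u \<bullet> v) * ?Q v) \<in> borel_measurable \<omega>" for n
    by (rule borel_measurable_integrable[OF integrable_funk_hecke[OF unit cont_q]])
  show "AE v in \<omega>. (\<lambda>n. q n (u \<bullet> v) * ?Q v) \<longlonglongrightarrow> f (u \<bullet> v) * ?Q v"
    using inner_sphere_bound[OF unit] by (intro AE_I2 tendsto_mult limit tendsto_const) simp
  show "(\<lambda>v. f (u \<bullet> v) * ?Q v) \<in> borel_measurable \<omega>"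
  proof (rule borel_measurable_LIMSEQ_real[OF _ measurable_integrand])
    show "(\<lambda>n. q n (u \<bullet> v) * ?Q v) \<longlonglongrightarrow> f (u \<bullet> v) * ?Q v" if "v \<in> space \<omega>" for v
      using that inner_sphere_bound[OF unit] by (intro tendsto_mult limit tendsto_const) simp
  qed
  show "integrable \<omega> (\<lambda>v. B * \<bar>?Q v\<bar>)" using int_Q by simp
  show "AE v in \<omega>. norm (q n (u \<bullet> v) * ?Q v) \<le> B * \<bar>?Q v\<bar>" for n
    using inner_sphere_bound[OF unit]
    by (intro AE_I2) (auto simp: abs_mult intro!: mult_right_mono bound)
qed

theorem funk_hecke_log:
  fixes u :: "real^'n"
  assumes unit: "norm u = 1" and dim: "CARD('n) \<ge> 2" and odd_j: "odd j"
  shows "funk_hecke_coef u (\<lambda>t. t * ln \<bar>t\<bar>) j = w_star CARD('n) j"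
proof (rule LIMSEQ_unique)
  let ?h = "\<lambda>n. 1 / real (Suc n)"
  let ?q = "\<lambda>n t. (signed_powr j (1 + ?h n) t - signed_powr j 1 t) / ?h n"
  have pos: "1 + ?h n > 0" "?h n > 0" for n by (auto intro: add_pos_pos)
  show "(\<lambda>n. funk_hecke_coef u (?q n) j) \<longlonglongrightarrow> funk_hecke_coef u (\<lambda>t. t * ln \<bar>t\<bar>) j"
  proof (rule funk_hecke_coef_LIMSEQ[OF unit])
    show "continuous_on {-1..1} (?q n)" for n
      using pos by (intro continuous_intros continuous_on_signed_powr) auto
    show "\<bar>?q n t\<bar> \<le> 1" if "t \<in> {-1..1}" for n t
      using that pos(2) by (intro signed_powr_quotient_bound[OF odd_j]) auto
    show "(\<lambda>n. ?q n t) \<longlonglongrightarrow> t * ln \<bar>t\<bar>" for t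
      by (rule has_real_derivative_LIMSEQ[OF has_real_derivative_signed_powr[OF odd_j]])
  qed
  have "funk_hecke_coef u (?q n) j = (w_coef CARD('n) j (1 + ?h n) - w_coef CARD('n) j 1) / ?h n" for n
  proof -
    let ?Q = "\<lambda>v. legendre_kernel j u v"
    have "?q n (u \<bullet> v) * ?Q v =
        (signed_powr j (1 + ?h n) (u \<bullet> v) * ?Q v - signed_powr j 1 (u \<bullet> v) * ?Q v) / ?h n" for v
      by (simp add: algebra_simps)
    moreover have "integrable \<omega> (\<lambda>v. signed_powr j \<alpha> (u \<bullet> v) * ?Q v)" if "\<alpha> > 0" for \<alpha>
      by (rule integrable_funk_hecke[OF unit continuous_on_signed_powr[OF that]])
    ultimately have "funk_hecke_coef u (?q n) j =
        (funk_hecke_coef u (signed_powr j (1 + ?h n)) j - funk_hecke_coef u (signed_powr j 1) j) / ?h n"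
      using pos(1) unfolding funk_hecke_coef_def
      by (simp only: integral_divide_zero Bochner_Integration.integral_diff zero_less_one)
    then show ?thesis by (simp only: funk_hecke_signed_powr[OF unit dim] pos(1) zero_less_one)
  qed
  then show "(\<lambda>n. funk_hecke_coef u (?q n) j) \<longlonglongrightarrow> w_star CARD('n) j"
    by (simp only: has_real_derivative_LIMSEQ[OF w_coef_has_real_derivative_w_star[OF odd_j]])
qed

section \<open>Orthogonal expansions\<close>

definition square_integrable :: "'a measure \<Rightarrow> ('a \<Rightarrow> real) \<Rightarrow> bool" where
  "square_integrable M f \<longleftrightarrow> f \<in> borel_measurable M \<and> integrable M (\<lambda>x. (f x)\<^sup>2)"

lemma square_integrable_imp_integrable_mult:
  assumes "square_integrable M f" "square_integrable M g"
  shows "integrable M (\<lambda>x. f x * g x)"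
proof (rule Bochner_Integration.integrable_bound)
  show "integrable M (\<lambda>x. (f x)\<^sup>2 + (g x)\<^sup>2)" "(\<lambda>x. f x * g x) \<in> borel_measurable M"
    using assms by (auto simp: square_integrable_def)
  have "\<bar>a * b\<bar> \<le> a\<^sup>2 + b\<^sup>2" for a b :: real
    using sum_squares_bound[of "\<bar>a\<bar>" "\<bar>b\<bar>"] abs_ge_zero[of "a * b"]
    unfolding abs_mult power2_abs by linarith
  then show "AE x in M. norm (f x * g x) \<le> norm ((f x)\<^sup>2 + (g x)\<^sup>2)"
    by (intro AE_I2) simp
qed

lemma square_integrable_cmult: "square_integrable M f \<Longrightarrow> square_integrable M (\<lambda>x. c * f x)"
  by (auto simp: square_integrable_def power_mult_distrib)

lemma square_integrable_add:
  assumes "square_integrable M f" "square_integrable M g"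
  shows "square_integrable M (\<lambda>x. f x + g x)"
  using assms square_integrable_imp_integrable_mult[OF assms]
  by (auto simp: square_integrable_def power2_sum mult.assoc)

lemma square_integrable_sum:
  "(\<And>i. i \<in> I \<Longrightarrow> square_integrable M (f i)) \<Longrightarrow> square_integrable M (\<lambda>x. \<Sum>i\<in>I. f i x)"
  by (induction I rule: infinite_finite_induct)
    (auto intro: square_integrable_add simp: square_integrable_def[of _ "\<lambda>_. 0"])

lemma square_integrable_diff:
  "square_integrable M f \<Longrightarrow> square_integrable M g \<Longrightarrow> square_integrable M (\<lambda>x. f x - g x)"
  using square_integrable_add[of M f "\<lambda>x. -1 * g x"] square_integrable_cmult[of M g "-1"] by simp

lemma Cauchy_Schwarz_integral:
  assumes square_f: "square_integrable M f" and square_g: "square_integrable M g"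
  shows "(LINT x|M. f x * g x)\<^sup>2 \<le> (LINT x|M. (f x)\<^sup>2) * (LINT x|M. (g x)\<^sup>2)"
proof -
  define A B C where "A = (LINT x|M. (f x)\<^sup>2)" and "B = (LINT x|M. (g x)\<^sup>2)"
    and "C = (LINT x|M. f x * g x)"
  have quadratic: "0 \<le> A - 2 * t * C + t\<^sup>2 * B" for t
  proof -
    have "0 \<le> (LINT x|M. (f x - t * g x)\<^sup>2)" by simp
    also have "\<dots> = (LINT x|M. (f x)\<^sup>2 - 2 * t * (f x * g x) + t\<^sup>2 * (g x)\<^sup>2)"
      by (simp add: power2_diff power_mult_distrib algebra_simps)
    also have "\<dots> = A - 2 * t * C + t\<^sup>2 * B"
      using square_f square_g square_integrable_imp_integrable_mult[OF square_f square_g]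
      by (simp add: square_integrable_def A_def B_def C_def)
    finally show ?thesis .
  qed
  have "B \<ge> 0" by (simp add: B_def)
  then consider "B > 0" | "B = 0" by linarith
  then have "C\<^sup>2 \<le> A * B"
  proof cases
    case 1
    then show ?thesis using quadratic[of "C / B"] by (simp add: power2_eq_square field_simps)
  next
    case 2
    then have "C = 0" using quadratic[of "(A + 1) / (2 * C)"] by (cases "C = 0") auto
    then show ?thesis using 2 by simp
  qed
  then show ?thesis by (simp add: A_def B_def C_def)
qed

locale orthogonal_sequence =
  fixes M :: "'a measure" and e :: "nat \<Rightarrow> 'a \<Rightarrow> real" and N :: "nat \<Rightarrow> real"
  assumes square_integrable_e: "square_integrable M (e j)"
    and N_pos: "N j > 0"
    and orthogonal: "(LINT x|M. e i x * e j x) = (if i = j then N j else 0)"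
begin

definition fourier_coef :: "('a \<Rightarrow> real) \<Rightarrow> nat \<Rightarrow> real" where
  "fourier_coef f j = (LINT x|M. f x * e j x) / N j"

lemma fourier_coef_mult: "fourier_coef f j * N j = (LINT x|M. f x * e j x)"
  using N_pos[of j] by (simp add: fourier_coef_def)

lemma square_integrable_combination: "square_integrable M (\<lambda>x. \<Sum>j<n. a j * e j x)"
  by (intro square_integrable_sum square_integrable_cmult square_integrable_e)

lemma integral_mult_combination:
  assumes "square_integrable M f"
  shows "(LINT x|M. f x * (\<Sum>j<n. a j * e j x)) = (\<Sum>j<n. a j * fourier_coef f j * N j)"
proof -
  have "(LINT x|M. f x * (\<Sum>j<n. a j * e j x)) = (LINT x|M. (\<Sum>j<n. a j * (f x * e j x)))"
    by (simp add: sum_distrib_left mult_ac)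
  also have "\<dots> = (\<Sum>j<n. a j * (LINT x|M. f x * e j x))"
    using square_integrable_imp_integrable_mult[OF assms square_integrable_e] by simp
  finally show ?thesis by (simp add: mult.assoc fourier_coef_mult)
qed

lemma integral_combination_square: "(LINT x|M. (\<Sum>j<n. a j * e j x)\<^sup>2) = (\<Sum>j<n. (a j)\<^sup>2 * N j)"
proof -
  have "fourier_coef (\<lambda>x. \<Sum>i<n. a i * e i x) j = a j" if "j < n" for j
  proof -
    have "(LINT x|M. e j x * (\<Sum>i<n. a i * e i x)) = (\<Sum>i<n. if i = j then a j * N j else 0)"
      unfolding integral_mult_combination[OF square_integrable_e]
      by (intro sum.cong) (auto simp: mult.assoc fourier_coef_mult orthogonal)
    then show ?thesis using that N_pos[of j] by (simp add: fourier_coef_def mult.commute)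
  qed
  then show ?thesis
    unfolding power2_eq_square integral_mult_combination[OF square_integrable_combination] by simp
qed

lemma integral_residual_square:
  assumes square_f: "square_integrable M f"
  shows "(LINT x|M. (f x - (\<Sum>j<n. a j * e j x))\<^sup>2) =
    (LINT x|M. (f x)\<^sup>2) - (\<Sum>j<n. (fourier_coef f j)\<^sup>2 * N j) + (\<Sum>j<n. (a j - fourier_coef f j)\<^sup>2 * N j)"
proof -
  let ?S = "\<lambda>x. \<Sum>j<n. a j * e j x"
  have "(LINT x|M. (f x - ?S x)\<^sup>2) = (LINT x|M. (f x)\<^sup>2 - 2 * (f x * ?S x) + (?S x)\<^sup>2)"
    by (simp add: power2_diff mult.assoc diff_add_eq)
  also have "\<dots> = (LINT x|M. (f x)\<^sup>2) - 2 * (\<Sum>j<n. a j * fourier_coef f j * N j) + (\<Sum>j<n. (a j)\<^sup>2 * N j)"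
    using square_f square_integrable_combination[of a n]
      square_integrable_imp_integrable_mult[OF square_f square_integrable_combination[of a n]]
    by (simp add: square_integrable_def integral_mult_combination[OF square_f]
        integral_combination_square)
  finally show ?thesis
    by (simp add: power2_diff algebra_simps sum.distrib sum_subtractf sum_distrib_left)
qed

lemma Bessel_inequality:
  assumes "square_integrable M f"
  shows "(\<Sum>j<n. (fourier_coef f j)\<^sup>2 * N j) \<le> (LINT x|M. (f x)\<^sup>2)"
proof -
  have "0 \<le> (LINT x|M. (f x - (\<Sum>j<n. fourier_coef f j * e j x))\<^sup>2)" by simp
  then show ?thesis by (simp add: integral_residual_square[OF assms])
qed

theorem fourier_coef_abs_summable:
  assumes square_f: "square_integrable M f" and square_g: "square_integrable M g"
  shows "summable (\<lambda>j. \<bar>fourier_coef f j * fourier_coef g j * N j\<bar>)"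
proof (rule bounded_imp_summable)
  fix n
  have "\<bar>fourier_coef f j * fourier_coef g j * N j\<bar> \<le>
      ((fourier_coef f j)\<^sup>2 * N j + (fourier_coef g j)\<^sup>2 * N j) / 2" for j
    using sum_squares_bound[of "\<bar>fourier_coef f j\<bar>" "\<bar>fourier_coef g j\<bar>"] N_pos[of j]
    by (simp add: abs_mult flip: distrib_right)
  then have "(\<Sum>j<Suc n. \<bar>fourier_coef f j * fourier_coef g j * N j\<bar>) \<le>
      (\<Sum>j<Suc n. ((fourier_coef f j)\<^sup>2 * N j + (fourier_coef g j)\<^sup>2 * N j) / 2)"
    by (intro sum_mono)
  also have "\<dots> \<le> ((LINT x|M. (f x)\<^sup>2) + (LINT x|M. (g x)\<^sup>2)) / 2"
    unfolding sum_divide_distrib[symmetric] sum.distrib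
    by (intro divide_right_mono add_mono Bessel_inequality square_f square_g) simp
  finally show "(\<Sum>j\<le>n. \<bar>fourier_coef f j * fourier_coef g j * N j\<bar>) \<le>
      ((LINT x|M. (f x)\<^sup>2) + (LINT x|M. (g x)\<^sup>2)) / 2"
    by (simp only: lessThan_Suc_atMost)
qed simp

lemma residual_tendsto_0:
  assumes square_f: "square_integrable M f"
    and dense: "\<And>\<epsilon>. \<epsilon> > 0 \<Longrightarrow> \<exists>n a. (LINT x|M. (f x - (\<Sum>j<n. a j * e j x))\<^sup>2) < \<epsilon>"
  shows "(\<lambda>n. LINT x|M. (f x - (\<Sum>j<n. fourier_coef f j * e j x))\<^sup>2) \<longlonglongrightarrow> 0"
proof (rule LIMSEQ_I)
  let ?r = "\<lambda>n. LINT x|M. (f x - (\<Sum>j<n. fourier_coef f j * e j x))\<^sup>2"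
  fix \<epsilon> :: real assume "\<epsilon> > 0"
  from dense[OF this] obtain n a where approx: "(LINT x|M. (f x - (\<Sum>j<n. a j * e j x))\<^sup>2) < \<epsilon>" by blast
  have "?r m < \<epsilon>" if "n \<le> m" for m
  proof -
    have "?r m \<le> ?r n"
      using that N_pos by (simp add: integral_residual_square[OF square_f] sum_mono2 less_imp_le)
    also have "\<dots> \<le> (LINT x|M. (f x - (\<Sum>j<n. a j * e j x))\<^sup>2)"
      using N_pos by (simp add: integral_residual_square[OF square_f] sum_nonneg less_imp_le)
    also note approx
    finally show ?thesis .
  qed
  then show "\<exists>n. \<forall>m\<ge>n. norm (?r m - 0) < \<epsilon>" by (intro exI[of _ n]) auto
qed

theorem fourier_coef_sums:
  assumes square_f: "square_integrable M f" and square_g: "square_integrable M g"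
    and dense: "\<And>\<epsilon>. \<epsilon> > 0 \<Longrightarrow> \<exists>n a. (LINT x|M. (f x - (\<Sum>j<n. a j * e j x))\<^sup>2) < \<epsilon>"
  shows "(\<lambda>j. fourier_coef f j * fourier_coef g j * N j) sums (LINT x|M. f x * g x)"
proof -
  let ?S = "\<lambda>n x. \<Sum>j<n. fourier_coef f j * e j x"
    and ?r = "\<lambda>n. LINT x|M. (f x - (\<Sum>j<n. fourier_coef f j * e j x))\<^sup>2"
  let ?p = "\<lambda>n. \<Sum>j<n. fourier_coef f j * fourier_coef g j * N j"
  have diff: "(LINT x|M. (f x - ?S n x) * g x) = (LINT x|M. f x * g x) - ?p n" for n
  proof -
    have "(LINT x|M. (f x - ?S n x) * g x) = (LINT x|M. f x * g x - g x * ?S n x)"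
      by (simp only: left_diff_distrib mult.commute[of "?S n _"])
    also have "\<dots> = (LINT x|M. f x * g x) - (LINT x|M. g x * ?S n x)"
      by (intro Bochner_Integration.integral_diff square_integrable_imp_integrable_mult
          square_f square_g
          square_integrable_combination)
    finally show ?thesis by (simp only: integral_mult_combination[OF square_g])
  qed
  have "(\<lambda>n. (LINT x|M. f x * g x) - ?p n) \<longlonglongrightarrow> 0"
  proof (rule Lim_null_comparison)
    have "norm ((LINT x|M. f x * g x) - ?p n) \<le> sqrt (?r n * (LINT x|M. (g x)\<^sup>2))" for n
      unfolding diff[symmetric] real_norm_def
      by (intro real_le_rsqrt, unfold power2_abs)
        (intro Cauchy_Schwarz_integral square_integrable_diff square_f square_g
            square_integrable_combination)
    then show "\<forall>\<^sub>F n in sequentially. norm ((LINT x|M. f x * g x) - ?p n) \<le>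
        sqrt (?r n * (LINT x|M. (g x)\<^sup>2))"
      by (intro always_eventually allI)
    have "(\<lambda>n. sqrt (?r n * (LINT x|M. (g x)\<^sup>2))) \<longlonglongrightarrow> sqrt (0 * (LINT x|M. (g x)\<^sup>2))"
      by (intro tendsto_intros residual_tendsto_0 square_f dense)
    then show "(\<lambda>n. sqrt (?r n * (LINT x|M. (g x)\<^sup>2))) \<longlonglongrightarrow> 0" by simp
  qed
  from tendsto_diff[OF tendsto_const[of "LINT x|M. f x * g x"] this] show ?thesis
    by (simp add: sums_def)
qed

end

lemma Weierstrass_poly:
  fixes q :: "real \<Rightarrow> real"
  assumes "continuous_on {a..b} q" "\<epsilon> > 0"
  obtains p :: "real poly" where "\<And>t. t \<in> {a..b} \<Longrightarrow> \<bar>q t - poly p t\<bar> < \<epsilon>"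
proof -
  obtain g where g: "real_polynomial_function g" "\<And>t. t \<in> {a..b} \<Longrightarrow> \<bar>q t - g t\<bar> < \<epsilon>"
    using Stone_Weierstrass_real_polynomial_function[OF compact_Icc assms] by auto
  obtain c n where "g = (\<lambda>t. \<Sum>i\<le>n. c i * t ^ i)"
    using real_polynomial_function_imp_sum[OF g(1)] by blast
  then have "g t = poly (\<Sum>i\<le>n. monom (c i) i) t" for t by (simp add: poly_sum poly_monom)
  with g(2) that show thesis by metis
qed

lemma poly_eq_combination:
  fixes Q :: "nat \<Rightarrow> 'a::field poly"
  assumes triangular_Q: "\<And>j. degree (Q j) \<le> j" "\<And>j. coeff (Q j) j \<noteq> 0"
  shows "(\<And>i. i \<ge> n \<Longrightarrow> coeff p i = 0) \<Longrightarrow> \<exists>a. p = (\<Sum>j<n. smult (a j) (Q j))"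
proof (induction n arbitrary: p)
  case 0
  then show ?case by (simp add: poly_eq_iff)
next
  case (Suc n)
  define c where "c = coeff p n / coeff (Q n) n"
  have "coeff (p - smult c (Q n)) i = 0" if "i \<ge> n" for i
  proof (cases "i = n")
    case False
    then show ?thesis using that Suc.prems[of i] coeff_eq_0[of "Q n" i] triangular_Q(1)[of n] by simp
  qed (simp add: c_def triangular_Q(2))
  from Suc.IH[OF this] obtain a where "p - smult c (Q n) = (\<Sum>j<n. smult (a j) (Q j))" by blast
  then have "p = (\<Sum>j<Suc n. smult ((a(n := c)) j) (Q j))" by (simp add: algebra_simps)
  then show ?case by blast
qed

section \<open>Funk-Hecke expansion\<close>

lemma orthogonal_sequence_legendre:
  fixes u :: "real^'n"
  assumes "CARD('n) \<ge> 2" "norm u = 1"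
  shows "orthogonal_sequence \<omega> (\<lambda>j v. legendre_kernel j u v) (legendre_norm CARD('n))"
proof
  show "square_integrable \<omega> (\<lambda>v. legendre_kernel j u v)" for j
    unfolding square_integrable_def
    by (intro conjI measurable_sphere_continuous integrable_sphere_continuous continuous_intros)
qed (simp_all add: legendre_norm_pos legendre_orthogonal assms)

lemma sphere_legendre_dense:
  fixes u :: "real^'n"
  assumes dim: "CARD('n) \<ge> 2" and unit: "norm u = 1" and cont_q: "continuous_on {-1..1} q"
    and pos_epsilon: "\<epsilon> > 0"
  shows "\<exists>n a. (LINT v|\<omega>. (q (u \<bullet> v) - (\<Sum>j<n. a j * legendre_kernel j u v))\<^sup>2) < \<epsilon>"
proof -
  define W where "W = measure (\<omega> :: (real^'n) measure) (sphere 0 1)"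
  have nonneg_W: "W \<ge> 0" by (simp add: W_def)
  define \<delta> where "\<delta> = sqrt (\<epsilon> / (W + 1))"
  have pos_delta: "\<delta> > 0" "\<delta>\<^sup>2 * W < \<epsilon>" using pos_epsilon nonneg_W by (simp_all add: \<delta>_def field_simps)
  obtain p where approx_p: "\<And>t. t \<in> {-1..1} \<Longrightarrow> \<bar>q t - poly p t\<bar> < \<delta>"
    using Weierstrass_poly[OF cont_q pos_delta(1)] by blast
  have "\<exists>a. p = (\<Sum>j<Suc (degree p). smult (a j) (legendre_poly CARD('n) j))"
    by (intro poly_eq_combination degree_legendre_poly_le less_imp_neq[THEN not_sym]
        coeff_legendre_poly_pos dim coeff_eq_0) simp
  then obtain a where p_eq: "p = (\<Sum>j<Suc (degree p). smult (a j) (legendre_poly CARD('n) j))" by blast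
  have "(LINT v|\<omega>. (q (u \<bullet> v) - poly p (u \<bullet> v))\<^sup>2) \<le> (LINT v|(\<omega> :: (real^'n) measure). \<delta>\<^sup>2)"
  proof (rule integral_mono)
    show "integrable \<omega> (\<lambda>v. (q (u \<bullet> v) - poly p (u \<bullet> v))\<^sup>2)"
      by (rule integrable_sphere_inner[OF unit]) (intro continuous_intros cont_q)
    fix v assume "v \<in> space (\<omega> :: (real^'n) measure)"
    then have "\<bar>q (u \<bullet> v) - poly p (u \<bullet> v)\<bar> \<le> \<delta>"
      using inner_sphere_bound[OF unit, of v] by (intro less_imp_le approx_p) simp
    then show "(q (u \<bullet> v) - poly p (u \<bullet> v))\<^sup>2 \<le> \<delta>\<^sup>2"
      using pos_delta(1) by (simp add: abs_le_square_iff[symmetric])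
  qed simp
  also have "\<dots> = \<delta>\<^sup>2 * W" by (simp add: W_def mult.commute)
  also note pos_delta(2)
  finally have "(LINT v|\<omega>. (q (u \<bullet> v) - (\<Sum>j<Suc (degree p). a j * legendre_kernel j u v))\<^sup>2) < \<epsilon>"
    by (subst (asm) p_eq) (simp add: poly_sum)
  then show ?thesis by blast
qed

lemma square_integrable_sphere_imp_integrable: "square_integrable \<omega> P \<Longrightarrow> integrable \<omega> P"
  using square_integrable_imp_integrable_mult[of \<omega> P "\<lambda>_. 1"] by (simp add: square_integrable_def)

theorem
  fixes u :: "real^'n" and P :: "real^'n \<Rightarrow> real"
  assumes dim: "CARD('n) \<ge> 2" and unit: "norm u = 1" and cont_q: "continuous_on {-1..1} q"
    and square_P: "square_integrable \<omega> P"
  shows funk_hecke_expansion_summable: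
      "summable (\<lambda>j. norm (of_real (funk_hecke_coef u q j) * harmonic_part j P u))"
    and funk_hecke_expansion_sums:
      "(\<lambda>j. of_real (funk_hecke_coef u q j) * harmonic_part j P u) sums
        of_real (LINT v|\<omega>. q (u \<bullet> v) * P v)"
proof -
  interpret orthogonal_sequence \<omega> "\<lambda>j v. legendre_kernel j u v" "legendre_norm CARD('n)"
    by (rule orthogonal_sequence_legendre[OF dim unit])
  have square_q: "square_integrable \<omega> (\<lambda>v. q (u \<bullet> v))"
    unfolding square_integrable_def
    by (intro conjI measurable_sphere_continuous integrable_sphere_continuous
        continuous_on_sphere_inner[OF unit]
        continuous_on_power cont_q)
  note integrable_P = square_integrable_sphere_imp_integrable[OF square_P]
  have summand: "of_real (funk_hecke_coef u q j) * harmonic_part j P u =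
      of_real (fourier_coef (\<lambda>v. q (u \<bullet> v)) j * fourier_coef P j * legendre_norm CARD('n) j)" for j
    using N_pos[of j]
    by (simp add: harmonic_part_eq_integral[OF dim integrable_P unit]
        fourier_coef_def funk_hecke_coef_def mult.commute)
  show "summable (\<lambda>j. norm (of_real (funk_hecke_coef u q j) * harmonic_part j P u))"
    unfolding summand norm_of_real by (rule fourier_coef_abs_summable[OF square_q square_P])
  show "(\<lambda>j. of_real (funk_hecke_coef u q j) * harmonic_part j P u) sums
      of_real (LINT v|\<omega>. q (u \<bullet> v) * P v)"
    unfolding summand
    by (intro sums_of_real fourier_coef_sums square_q square_P sphere_legendre_dense dim unit cont_q)
qed

lemma funk_hecke_coef_parity:
  fixes u :: "real^'n"
  assumes unit: "norm u = 1" and cont_q: "continuous_on {-1..1} q"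
    and parity: "\<And>t. q (- t) = (- 1) ^ e * q t" and odd: "odd (j + e)"
  shows "funk_hecke_coef u q j = 0"
proof -
  let ?F = "\<lambda>v. q (u \<bullet> v) * legendre_kernel j u v"
  have "?F (- v) = (- 1) ^ (j + e) * ?F v" for v
    by (simp add: parity poly_legendre_minus power_add)
  then have "(LINT v|\<omega>. - ?F v) = (LINT v|\<omega>. ?F (- v))" using odd by simp
  also have "\<dots> = (LINT v|\<omega>. ?F v)"
    by (rule integral_sphere_uminus[OF borel_measurable_integrable[OF
        integrable_funk_hecke[OF unit cont_q]]])
  finally show ?thesis by (simp add: funk_hecke_coef_def)
qed

corollary
  fixes u :: "real^'n" and P :: "real^'n \<Rightarrow> real"
  assumes dim: "CARD('n) \<ge> 2" and unit: "norm u = 1" and cont_q: "continuous_on {-1..1} q"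
    and square_P: "square_integrable \<omega> P" and e_le: "e \<le> 1"
    and parity: "\<And>t. q (- t) = (- 1) ^ e * q t"
    and coef: "\<And>k. funk_hecke_coef u q (2 * k + e) = w (2 * k + e)"
  shows funk_hecke_parity_summable:
      "summable (\<lambda>k. norm (of_real (w (2 * k + e)) * harmonic_part (2 * k + e) P u))"
    and funk_hecke_parity_suminf:
      "(\<Sum>k. of_real (w (2 * k + e)) * harmonic_part (2 * k + e) P u) =
        of_real (LINT v|\<omega>. q (u \<bullet> v) * P v)"
proof -
  let ?f = "\<lambda>j. of_real (funk_hecke_coef u q j) * harmonic_part j P u"
  have mono: "strict_mono (\<lambda>k. 2 * k + e)" by (auto simp: strict_mono_def)
  have zero: "?f j = 0" if "j \<notin> range (\<lambda>k. 2 * k + e)" for j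
  proof -
    have "odd (j + e)"
    proof
      assume "even (j + e)"
      then have "j = 2 * ((j - e) div 2) + e" using e_le by presburger
      then show False using that by auto
    qed
    then show ?thesis by (simp add: funk_hecke_coef_parity[OF unit cont_q parity])
  qed
  show "summable (\<lambda>k. norm (of_real (w (2 * k + e)) * harmonic_part (2 * k + e) P u))"
    using funk_hecke_expansion_summable[OF dim unit cont_q square_P] zero
      summable_mono_reindex[OF mono, of "\<lambda>j. norm (?f j)"] by (simp add: coef)
  show "(\<Sum>k. of_real (w (2 * k + e)) * harmonic_part (2 * k + e) P u) =
      of_real (LINT v|\<omega>. q (u \<bullet> v) * P v)"
    using funk_hecke_expansion_sums[OF dim unit cont_q square_P] zero sums_mono_reindex[OF mono, of ?f]
    by (intro sums_unique[symmetric]) (simp add: coef)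
qed

corollary
  fixes u :: "real^'n" and P :: "real^'n \<Rightarrow> real"
  assumes dim: "CARD('n) \<ge> 2" and unit: "norm u = 1" and square_P: "square_integrable \<omega> P"
    and pos_alpha: "\<alpha> > 0" and e_le: "e \<le> 1"
  shows signed_powr_expansion_summable:
      "summable (\<lambda>k. norm (of_real (w_coef CARD('n) (2 * k + e) \<alpha>) * harmonic_part (2 * k + e) P u))"
    and signed_powr_expansion_suminf:
      "(\<Sum>k. of_real (w_coef CARD('n) (2 * k + e) \<alpha>) * harmonic_part (2 * k + e) P u) =
        of_real (LINT v|\<omega>. signed_powr e \<alpha> (u \<bullet> v) * P v)"
proof -
  have "signed_powr (2 * k + e) \<alpha> = signed_powr e \<alpha>" for k
    using signed_powr_even[of e] signed_powr_even[of "2 * k + e"]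
      signed_powr_odd[of e] signed_powr_odd[of "2 * k + e"]
    by (cases "even e") simp_all
  then have coef: "funk_hecke_coef u (signed_powr e \<alpha>) (2 * k + e) =
      w_coef CARD('n) (2 * k + e) \<alpha>" for k
    using funk_hecke_signed_powr[OF unit dim pos_alpha, of "2 * k + e"] by simp
  show "summable (\<lambda>k. norm (of_real (w_coef CARD('n) (2 * k + e) \<alpha>) * harmonic_part (2 * k + e) P u))"
    by (rule funk_hecke_parity_summable[OF dim unit continuous_on_signed_powr[OF pos_alpha] square_P
        e_le signed_powr_minus coef])
  show "(\<Sum>k. of_real (w_coef CARD('n) (2 * k + e) \<alpha>) * harmonic_part (2 * k + e) P u) =
      of_real (LINT v|\<omega>. signed_powr e \<alpha> (u \<bullet> v) * P v)"
    by (rule funk_hecke_parity_suminf[OF dim unit continuous_on_signed_powr[OF pos_alpha] square_P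
        e_le signed_powr_minus coef])
qed

corollary
  fixes u :: "real^'n" and P :: "real^'n \<Rightarrow> real"
  assumes dim: "CARD('n) \<ge> 2" and unit: "norm u = 1" and square_P: "square_integrable \<omega> P"
  shows log_expansion_summable:
      "summable (\<lambda>k. norm (of_real (w_star CARD('n) (2 * k + 1)) * harmonic_part (2 * k + 1) P u))"
    and log_expansion_suminf:
      "(\<Sum>k. of_real (w_star CARD('n) (2 * k + 1)) * harmonic_part (2 * k + 1) P u) =
        of_real (LINT v|\<omega>. (u \<bullet> v * ln \<bar>u \<bullet> v\<bar>) * P v)"
  using dim
  by (intro funk_hecke_parity_summable[where q = "\<lambda>t. t * ln \<bar>t\<bar>"]
        funk_hecke_parity_suminf[where q = "\<lambda>t. t * ln \<bar>t\<bar>"]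
      unit square_P continuous_on_times_ln_abs funk_hecke_log; simp)+

section \<open>Characteristic exponents of stable distributions\<close>

lemma integral_density_sphere_inner:
  fixes z :: "real^'n" and P :: "real^'n \<Rightarrow> real" and F :: "real \<Rightarrow> complex"
  assumes integrable_P: "integrable \<omega> P" and nonneg: "\<forall>v\<in>sphere 0 1. 0 \<le> P v"
    and measurable_F: "F \<in> borel_measurable borel"
  shows "(LINT v|density \<omega> (\<lambda>v. ennreal (P v)). F (z \<bullet> v)) = (LINT v|\<omega>. P v *\<^sub>R F (z \<bullet> v))"
proof (rule integral_density)
  have "(\<lambda>v. z \<bullet> v) \<in> borel_measurable \<omega>"
    by (intro measurable_sphere_continuous continuous_intros)
  then show "(\<lambda>v. F (z \<bullet> v)) \<in> borel_measurable \<omega>" by (rule measurable_compose) (rule measurable_F)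
qed (use integrable_P nonneg in \<open>auto intro!: AE_I2\<close>)

lemma integrable_sphere_inner_mult:
  fixes u :: "real^'n"
  shows "norm u = 1 \<Longrightarrow> continuous_on {-1..1} q \<Longrightarrow> integrable \<omega> P \<Longrightarrow>
      integrable \<omega> (\<lambda>v. complex_of_real (q (u \<bullet> v) * P v))"
  by (intro integrable_of_real integrable_sphere_continuous_mult continuous_on_sphere_inner)

lemma inner_eq_norm_times_sgn: "z \<bullet> v = norm z * (sgn z \<bullet> v)" for z :: "'a::real_inner"
  by (cases "z = 0") (simp_all add: sgn_div_norm)

lemma inner_times_ln_abs_inner:
  fixes z :: "'a::real_inner"
  assumes "z \<noteq> 0"
  shows "z \<bullet> v * ln \<bar>z \<bullet> v\<bar> = norm z * (sgn z \<bullet> v * ln \<bar>sgn z \<bullet> v\<bar>) +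
    norm z * ln (norm z) * (sgn z \<bullet> v)"
  unfolding inner_eq_norm_times_sgn[of z v] using assms
  by (cases "sgn z \<bullet> v = 0") (simp_all add: abs_mult ln_mult algebra_simps)

lemma stable_exponent_density:
  fixes z :: "real^'n" and P :: "real^'n \<Rightarrow> real"
  assumes nonzero_z: "z \<noteq> 0" and integrable_P: "integrable \<omega> P" and nonneg: "\<forall>v\<in>sphere 0 1. 0 \<le> P v"
    and pos_alpha: "\<alpha> > 0" and alpha_neq_1: "\<alpha> \<noteq> 1"
  shows "stable_exponent \<alpha> (density \<omega> (\<lambda>v. ennreal (P v))) z =
    of_real (norm z powr \<alpha>) * (of_real (LINT v|\<omega>. signed_powr 0 \<alpha> (sgn z \<bullet> v) * P v)
      - \<i> * of_real (tan (pi * \<alpha> / 2)) * of_real (LINT v|\<omega>. signed_powr 1 \<alpha> (sgn z \<bullet> v) * P v))"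
proof -
  let ?T = "tan (pi * \<alpha> / 2)" and ?u = "sgn z"
  have unit: "norm ?u = 1" using nonzero_z by (simp add: norm_sgn)
  have "stable_exponent \<alpha> (density \<omega> (\<lambda>v. ennreal (P v))) z =
      (LINT v|\<omega>. P v *\<^sub>R (of_real (\<bar>z \<bullet> v\<bar> powr \<alpha>) * (1 - \<i> * of_real (?T * sgn (z \<bullet> v)))))"
    unfolding stable_exponent_def if_P[OF alpha_neq_1]
    by (rule integral_density_sphere_inner[OF integrable_P nonneg]) measurable
  also have "\<dots> = (LINT v|\<omega>. of_real (norm z powr \<alpha>) * (of_real (signed_powr 0 \<alpha> (?u \<bullet> v) * P v)
      - \<i> * of_real ?T * of_real (signed_powr 1 \<alpha> (?u \<bullet> v) * P v)))"
    using nonzero_z unfolding inner_eq_norm_times_sgn[of z]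
    by (simp add: abs_mult powr_mult sgn_mult signed_powr_def scaleR_conv_of_real algebra_simps)
  also have "\<dots> = of_real (norm z powr \<alpha>) * (of_real (LINT v|\<omega>. signed_powr 0 \<alpha> (?u \<bullet> v) * P v)
      - \<i> * of_real ?T * of_real (LINT v|\<omega>. signed_powr 1 \<alpha> (?u \<bullet> v) * P v))"
    using integrable_sphere_inner_mult[OF unit continuous_on_signed_powr[OF pos_alpha] integrable_P]
    by (simp only: integral_mult_right_zero Bochner_Integration.integral_diff integrable_mult_right
        integral_complex_of_real)
  finally show ?thesis .
qed

lemma stable_exponent_1_density:
  fixes z :: "real^'n" and P :: "real^'n \<Rightarrow> real"
  assumes nonzero_z: "z \<noteq> 0" and integrable_P: "integrable \<omega> P" and nonneg: "\<forall>v\<in>sphere 0 1. 0 \<le> P v"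
  shows "stable_exponent 1 (density \<omega> (\<lambda>v. ennreal (P v))) z =
    of_real (norm z) * (of_real (LINT v|\<omega>. signed_powr 0 1 (sgn z \<bullet> v) * P v)
      + \<i> * of_real (2 / pi) * of_real (LINT v|\<omega>. (sgn z \<bullet> v * ln \<bar>sgn z \<bullet> v\<bar>) * P v))
    + \<i> * of_real (norm z * ln (norm z) * (2 / pi)) * of_real (LINT v|\<omega>. (sgn z \<bullet> v) * P v)"
proof -
  let ?u = "sgn z"
  have unit: "norm ?u = 1" using nonzero_z by (simp add: norm_sgn)
  have "stable_exponent 1 (density \<omega> (\<lambda>v. ennreal (P v))) z =
      (LINT v|\<omega>. P v *\<^sub>R (of_real \<bar>z \<bullet> v\<bar> + \<i> * of_real (2 / pi * (z \<bullet> v) * ln \<bar>z \<bullet> v\<bar>)))"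
    unfolding stable_exponent_def
    by (simp only: simp_thms if_False)
      (rule integral_density_sphere_inner[OF integrable_P nonneg], measurable)
  also have "\<dots> = (LINT v|\<omega>. of_real (norm z) * (of_real (signed_powr 0 1 (?u \<bullet> v) * P v)
      + \<i> * of_real (2 / pi) * of_real ((?u \<bullet> v * ln \<bar>?u \<bullet> v\<bar>) * P v))
      + \<i> * of_real (norm z * ln (norm z) * (2 / pi)) * of_real (?u \<bullet> v * P v))"
  proof (intro Bochner_Integration.integral_cong refl)
    fix v
    have "\<bar>z \<bullet> v\<bar> = norm z * signed_powr 0 1 (?u \<bullet> v)"
      unfolding inner_eq_norm_times_sgn[of z] by (simp add: abs_mult signed_powr_def)
    then show "P v *\<^sub>R (of_real \<bar>z \<bullet> v\<bar> + \<i> * of_real (2 / pi * (z \<bullet> v) * ln \<bar>z \<bullet> v\<bar>)) =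
        of_real (norm z) * (of_real (signed_powr 0 1 (?u \<bullet> v) * P v)
        + \<i> * of_real (2 / pi) * of_real ((?u \<bullet> v * ln \<bar>?u \<bullet> v\<bar>) * P v))
        + \<i> * of_real (norm z * ln (norm z) * (2 / pi)) * of_real (?u \<bullet> v * P v)"
      unfolding mult.assoc[of "2 / pi"] inner_times_ln_abs_inner[OF nonzero_z]
      by (simp add: complex_eq_iff algebra_simps)
  qed
  also have "\<dots> = of_real (norm z) * (of_real (LINT v|\<omega>. signed_powr 0 1 (?u \<bullet> v) * P v)
      + \<i> * of_real (2 / pi) * of_real (LINT v|\<omega>. (?u \<bullet> v * ln \<bar>?u \<bullet> v\<bar>) * P v))
      + \<i> * of_real (norm z * ln (norm z) * (2 / pi)) * of_real (LINT v|\<omega>. ?u \<bullet> v * P v)"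
    using integrable_sphere_inner_mult[OF unit continuous_on_signed_powr[OF zero_less_one] integrable_P]
      integrable_sphere_inner_mult[OF unit continuous_on_times_ln_abs integrable_P]
      integrable_sphere_inner_mult[OF unit continuous_on_id integrable_P]
    by (simp only: integral_mult_right_zero Bochner_Integration.integral_add
        Bochner_Integration.integrable_add
        integrable_mult_right integral_complex_of_real)
  finally show ?thesis .
qed

lemma integral_inner_eq_harmonic_part_1:
  fixes u :: "real^'n" and P :: "real^'n \<Rightarrow> real"
  assumes dim: "CARD('n) \<ge> 2" and unit: "norm u = 1" and integrable_P: "integrable \<omega> P"
  shows "complex_of_real (LINT v|\<omega>. u \<bullet> v * P v) =
    of_real (pi powr (CARD('n) / 2) / Gamma (CARD('n) / 2 + 1)) * harmonic_part 1 P u"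
proof -
  have "complex_of_real (LINT v|\<omega>. u \<bullet> v * P v) =
      of_real (legendre_norm CARD('n) 1) * harmonic_part 1 P u"
    using legendre_norm_pos[OF dim, of 1]
    by (simp add: harmonic_part_eq_integral[OF dim integrable_P unit])
  moreover have "legendre_norm CARD('n) 1 = pi powr (CARD('n) / 2) / Gamma (CARD('n) / 2 + 1)"
  proof -
    have "Gamma (2 :: real) = 1" using Gamma_fact[of 1, where 'a=real] by simp
    then show ?thesis
      by (simp add: legendre_norm_def w_coef_def rGamma_inverse_Gamma inverse_eq_divide
          add_divide_distrib add.commute)
  qed
  ultimately show ?thesis by simp
qed

theorem theorem3p1:
  fixes \<alpha> :: real and P :: "real^'n \<Rightarrow> real" and \<mu> :: "(real^'n) measure" and z :: "real^'n"
  assumes d2: "CARD('n) \<ge> 2"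
    and alpha: "0 < \<alpha>" "\<alpha> < 2"
    and P_meas: "P \<in> borel_measurable sphere_measure"
    and P_nonneg: "\<forall>v \<in> sphere 0 1. 0 \<le> P v"
    and P_L2: "integrable sphere_measure (\<lambda>v. (P v)\<^sup>2)"
    and lam_nonzero: "emeasure (density sphere_measure (\<lambda>v. ennreal (P v))) (sphere 0 1) \<noteq> 0"
    and mu_prob: "prob_space \<mu>" and mu_sets: "sets \<mu> = sets borel"
    and mu_char: "\<forall>\<xi>. integral\<^sup>L \<mu> (\<lambda>x. exp (\<i> * of_real (x \<bullet> \<xi>)))
                   = exp (- stable_exponent \<alpha> (density sphere_measure (\<lambda>v. ennreal (P v))) \<xi>)"
    and z: "z \<noteq> 0"
  shows "let d = CARD('n); u = sgn z;
             Phi = stable_exponent \<alpha> (density sphere_measure (\<lambda>v. ennreal (P v))) z;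
             Pj = (\<lambda>j. sph_proj j (\<lambda>v. complex_of_real (P v)) u) in
         (\<alpha> \<noteq> 1 \<longrightarrow>
            summable (\<lambda>k. norm (of_real (w_coef d (2*k) \<alpha>) * Pj (2*k))) \<and>
            summable (\<lambda>k. norm (of_real (w_coef d (2*k+1) \<alpha>) * Pj (2*k+1))) \<and>
            Phi = of_real (norm z powr \<alpha>) *
                  ((\<Sum>k. of_real (w_coef d (2*k) \<alpha>) * Pj (2*k))
                   - \<i> * of_real (tan (pi * \<alpha> / 2)) * (\<Sum>k. of_real (w_coef d (2*k+1) \<alpha>) * Pj (2*k+1)))) \<and>
         (\<alpha> = 1 \<longrightarrow>
            summable (\<lambda>k. norm (of_real (w_coef d (2*k) 1) * Pj (2*k))) \<and>
            summable (\<lambda>k. norm (of_real (w_star d (2*k+1)) * Pj (2*k+1))) \<and>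
            Phi = of_real (norm z) *
                  ((\<Sum>k. of_real (w_coef d (2*k) 1) * Pj (2*k))
                   + \<i> * of_real (2 / pi) * (\<Sum>k. of_real (w_star d (2*k+1)) * Pj (2*k+1)))
                  + \<i> * of_real (norm z * ln (norm z)
                      * (2 * pi powr (real d / 2 - 1) / Gamma (real d / 2 + 1))) * Pj 1)"
proof -
  have unit: "norm (sgn z) = 1" using z by (simp add: norm_sgn)
  have square_P: "square_integrable \<omega> P" using P_meas P_L2 by (simp add: square_integrable_def)
  then have integrable_P: "integrable \<omega> P" by (rule square_integrable_sphere_imp_integrable)
  note even = signed_powr_expansion_summable[OF d2 unit square_P _ le0, unfolded add_0_right]
    signed_powr_expansion_suminf[OF d2 unit square_P _ le0, unfolded add_0_right]
  note odd = signed_powr_expansion_summable[OF d2 unit square_P _ order_refl]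
    signed_powr_expansion_suminf[OF d2 unit square_P _ order_refl]
  note log = log_expansion_summable[OF d2 unit square_P] log_expansion_suminf[OF d2 unit square_P]
  have "pi powr (CARD('n) / 2 - 1) = pi powr (CARD('n) / 2) / pi" by (simp add: powr_diff)
  then have first_harmonic: "of_real (norm z * ln (norm z) * (2 / pi)) *
      complex_of_real (LINT v|\<omega>. sgn z \<bullet> v * P v) =
      of_real (norm z * ln (norm z) * (2 * pi powr (CARD('n) / 2 - 1) / Gamma (CARD('n) / 2 + 1))) *
        harmonic_part 1 P (sgn z)"
    by (simp add: integral_inner_eq_harmonic_part_1[OF d2 unit integrable_P])
  show ?thesis
    unfolding Let_def
    by (simp only: stable_exponent_density[OF z integrable_P P_nonneg alpha(1)]
        stable_exponent_1_density[OF z integrable_P P_nonneg]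
        even[OF alpha(1)] odd[OF alpha(1)] even[OF zero_less_one] log
        mult.assoc first_harmonic[unfolded mult.assoc] simp_thms cong: imp_cong)
qed

end
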